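(* For each $N$, let $\mathcal{A}_{1,N},\dots,\mathcal{A}_{s,N}\subseteq M_N(\mathcal{L}^{\infty-})$ be unital symmetric subalgebras, $\mathcal{A}_{j,N}$ generated by a tuple $X^{(j)}_N=(X^{(j)}_{1,N},\dots,X^{(j)}_{k_j,N})$ and transposes, such that the entries of matrices from different subalgebras form independent sets. Suppose that all, or all but one, of the families $\{\mathcal{A}_{j,N}\}_N$ are orthogonally invariant, and that each family satisfies (P1), (P2), (P3). Then the subalgebras are asymptotically real infinitesimally free: for every noncommutative polynomial $p$ in all generators $x^{(j)}_i$ and their transposes, the limits $\tau(p)=\lim_N\mathbb{E}(\mathrm{tr}(p(X_N)))$ and $\tau'(p)=\lim_N N\big(\mathbb{E}(\mathrm{tr}(p(X_N)))-\tau(p)\big)$ exist, and in the real infinitesimal probability space $(\mathbb{C}\langle x,x^t\rangle,\tau,\tau',t)$ the unital symmetric subalgebras $\mathcal{B}_j$ generated by $x^{(j)}_1,\dots,x^{(j)}_{k_j}$ and their transposes ($1\le j\le s$) are real infinitesimally free.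
   Context: $\mathcal{L}^{\infty-}$ is the algebra of complex random variables with all moments finite; $\mathrm{Tr}$ is the trace on $M_N(\mathcal{L}^{\infty-})$, $\mathrm{tr}=\frac1N\mathrm{Tr}$, $t$ the transpose. $X_N$ denotes the joint tuple of all generators; $p(X_N)$ the evaluation of a polynomial in variables $x,x^t$. A family is orthogonally invariant if for every deterministic real orthogonal $O$, $(OX^{(j)}_{i,N}O^t)_i$ has the same joint distribution as $(X^{(j)}_{i,N})_i$. A family with generators $Y_N$ satisfies (P1) if there are linear functionals $\tau,\tau'$ with $\mathbb{E}(\mathrm{tr}(p(Y_N)))=\tau(p)+N^{-1}\tau'(p)+o(N^{-1})$ for every polynomial $p$ in $y,y^t$; (P2) if $k_2(\mathrm{Tr}(p_1(Y_N)),\mathrm{Tr}(p_2(Y_N)))$ converges for all $p_1,p_2$; (P3) if $N^{r-3}k_r(\mathrm{Tr}(p_1(Y_N)),\dots,\mathrm{Tr}(p_r(Y_N)))=o(1)$ for $r\ge3$ ($k_r$ classical cumulants). The involution $t$ on $\mathbb{C}\langle x,x^t\rangle$ reverses words and exchanges $x\leftrightarrow x^t$. A real infinitesimal probability space $(\mathcal{A},\tau,\tau',t)$: unital algebra with involution $t$, linear $\tau$ with $\tau(1)=1$, $\tau(a^t)=\tau(a)$, and linear $\tau'$ with $\tau'(1)=0$. Symmetric unital subalgebras $\mathcal{B}_1,\dots,\mathcal{B}_s$ are real infinitesimally free if whenever $a_i\in\mathcal{B}_{j_i}$, $\tau(a_i)=0$, $j_1\ne j_2,\dots,j_{n-1}\ne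 j_n$: (1) $\tau(a_1\cdots a_n)=0$; (2) for $n=2$, $\tau'(a_1a_2)=0$; (3) for $n=2k-1\ge3$, $\tau'(a_1\cdots a_n)=\tau(a_1a_n)\tau'(a_2\cdots a_{n-1})+\tau(a_1a_k^ta_n)\tau(a_2a_{k+1}^t)\cdots\tau(a_{k-1}a_{n-1}^t)$; (4) for $n=2k\ge4$, $\tau'(a_1\cdots a_n)=\tau(a_1a_n)\tau'(a_2\cdots a_{n-1})+\tau(a_1a_{k+1}^t)\cdots\tau(a_ka_n^t)$. *)

theory Defs
  imports "HOL-Probability.Probability" "HOL-Library.Disjoint_Sets"
begin

text \<open>A letter (j, i, b) stands for the generator x^(j)_i (b = False) or its
transpose (b = True). A noncommutative polynomial is a finitely supported
complex-valued function on words.\<close>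

type_synonym letter = "nat \<times> nat \<times> bool"
type_synonym word = "letter list"
type_synonym ncpoly = "word \<Rightarrow> complex"
type_synonym cmat = "nat \<Rightarrow> nat \<Rightarrow> complex"

definition ncpoly :: "ncpoly \<Rightarrow> bool" where
  "ncpoly p \<longleftrightarrow> finite {w. p w \<noteq> 0}"

definition poly_in :: "letter set \<Rightarrow> ncpoly \<Rightarrow> bool" where
  "poly_in S p \<longleftrightarrow> ncpoly p \<and> (\<forall>w. p w \<noteq> 0 \<longrightarrow> set w \<subseteq> S)"

definition pone :: ncpoly where
  "pone = (\<lambda>w. if w = [] then 1 else 0)"

definition padd :: "ncpoly \<Rightarrow> ncpoly \<Rightarrow> ncpoly" where
  "padd p q = (\<lambda>w. p w + q w)"

definition psmult :: "complex \<Rightarrow> ncpoly \<Rightarrow> ncpoly" where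
  "psmult c p = (\<lambda>w. c * p w)"

definition pmul :: "ncpoly \<Rightarrow> ncpoly \<Rightarrow> ncpoly" where
  "pmul p q = (\<lambda>w. \<Sum>m\<le>length w. p (take m w) * q (drop m w))"

fun flipl :: "letter \<Rightarrow> letter" where
  "flipl (j, i, b) = (j, i, \<not> b)"

definition ptr :: "ncpoly \<Rightarrow> ncpoly" where
  "ptr p = (\<lambda>w. p (rev (map flipl w)))"

definition pprod :: "(nat \<Rightarrow> ncpoly) \<Rightarrow> nat \<Rightarrow> nat \<Rightarrow> ncpoly" where
  "pprod a lo hi = foldr (\<lambda>m acc. pmul (a m) acc) [lo..<hi] pone"

definition fam_letters :: "(nat \<Rightarrow> nat) \<Rightarrow> nat \<Rightarrow> letter set" where
  "fam_letters k j = {(j', i, b). j' = j \<and> i < k j}"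

definition all_letters :: "(nat \<Rightarrow> nat) \<Rightarrow> nat \<Rightarrow> letter set" where
  "all_letters k s = (\<Union>j<s. fam_letters k j)"

definition real_inf_prob_space ::
  "(ncpoly \<Rightarrow> bool) \<Rightarrow> (ncpoly \<Rightarrow> complex) \<Rightarrow> (ncpoly \<Rightarrow> complex) \<Rightarrow> bool" where
  "real_inf_prob_space A \<tau> \<tau>' \<longleftrightarrow>
     A pone \<and>
     (\<forall>p q. A p \<longrightarrow> A q \<longrightarrow> A (padd p q) \<and> A (pmul p q)) \<and>
     (\<forall>c p. A p \<longrightarrow> A (psmult c p)) \<and>
     (\<forall>p. A p \<longrightarrow> A (ptr p) \<and> ptr (ptr p) = p) \<and>
     (\<forall>p q. A p \<longrightarrow> A q \<longrightarrow> ptr (pmul p q) = pmul (ptr q) (ptr p)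
        \<and> ptr (padd p q) = padd (ptr p) (ptr q)) \<and>
     (\<forall>c p. A p \<longrightarrow> ptr (psmult c p) = psmult c (ptr p)) \<and>
     (\<forall>p q. A p \<longrightarrow> A q \<longrightarrow> \<tau> (padd p q) = \<tau> p + \<tau> q \<and> \<tau>' (padd p q) = \<tau>' p + \<tau>' q) \<and>
     (\<forall>c p. A p \<longrightarrow> \<tau> (psmult c p) = c * \<tau> p \<and> \<tau>' (psmult c p) = c * \<tau>' p) \<and>
     \<tau> pone = 1 \<and> \<tau>' pone = 0 \<and>
     (\<forall>p. A p \<longrightarrow> \<tau> (ptr p) = \<tau> p)"

text \<open>Real infinitesimal freeness of the subalgebras B 0, ..., B (s-1);
indices of the elements a_1..a_n of the paper are shifted to a 0 .. a (n-1).\<close>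
definition real_inf_free ::
  "(ncpoly \<Rightarrow> complex) \<Rightarrow> (ncpoly \<Rightarrow> complex) \<Rightarrow> (nat \<Rightarrow> ncpoly \<Rightarrow> bool) \<Rightarrow> nat \<Rightarrow> bool" where
  "real_inf_free \<tau> \<tau>' B s \<longleftrightarrow>
    (\<forall>n a js. n \<ge> 1 \<and> (\<forall>m<n. js m < s \<and> B (js m) (a m) \<and> \<tau> (a m) = 0)
        \<and> (\<forall>m. Suc m < n \<longrightarrow> js m \<noteq> js (Suc m)) \<longrightarrow>
      \<tau> (pprod a 0 n) = 0 \<and>
      (n = 2 \<longrightarrow> \<tau>' (pprod a 0 n) = 0) \<and>
      (\<forall>k. k \<ge> 2 \<and> n = 2 * k - 1 \<longrightarrow>
         \<tau>' (pprod a 0 n) =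
           \<tau> (pmul (a 0) (a (n - 1))) * \<tau>' (pprod a 1 (n - 1))
           + \<tau> (pmul (a 0) (pmul (ptr (a (k - 1))) (a (n - 1))))
             * (\<Prod>l\<in>{1..k - 2}. \<tau> (pmul (a l) (ptr (a (k - 1 + l)))))) \<and>
      (\<forall>k. k \<ge> 2 \<and> n = 2 * k \<longrightarrow>
         \<tau>' (pprod a 0 n) =
           \<tau> (pmul (a 0) (a (n - 1))) * \<tau>' (pprod a 1 (n - 1))
           + (\<Prod>l<k. \<tau> (pmul (a l) (ptr (a (k + l)))))))"

text \<open>N x N matrices are functions on indices; only entries with indices below N matter.\<close>

definition matmul :: "nat \<Rightarrow> cmat \<Rightarrow> cmat \<Rightarrow> cmat" where
  "matmul N A B = (\<lambda>r c. \<Sum>m<N. A r m * B m c)"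

definition idmat :: cmat where
  "idmat = (\<lambda>r c. if r = c then 1 else 0)"

definition mtransp :: "cmat \<Rightarrow> cmat" where
  "mtransp A = (\<lambda>r c. A c r)"

fun word_eval :: "nat \<Rightarrow> (letter \<Rightarrow> cmat) \<Rightarrow> word \<Rightarrow> cmat" where
  "word_eval N G [] = idmat"
| "word_eval N G (l # w) = matmul N (G l) (word_eval N G w)"

definition poly_eval :: "nat \<Rightarrow> (letter \<Rightarrow> cmat) \<Rightarrow> ncpoly \<Rightarrow> cmat" where
  "poly_eval N G p = (\<lambda>r c. \<Sum>w\<in>{w. p w \<noteq> 0}. p w * word_eval N G w r c)"

definition mTrace :: "nat \<Rightarrow> cmat \<Rightarrow> complex" where
  "mTrace N A = (\<Sum>r<N. A r r)"

definition gens :: "(nat \<Rightarrow> nat \<Rightarrow> 'a \<Rightarrow> cmat) \<Rightarrow> 'a \<Rightarrow> letter \<Rightarrow> cmat" where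
  "gens Y \<omega> l = (case l of (j, i, b) \<Rightarrow> if b then mtransp (Y j i \<omega>) else Y j i \<omega>)"

definition TrP :: "nat \<Rightarrow> (nat \<Rightarrow> nat \<Rightarrow> 'a \<Rightarrow> cmat) \<Rightarrow> ncpoly \<Rightarrow> 'a \<Rightarrow> complex" where
  "TrP N Y p \<omega> = mTrace N (poly_eval N (gens Y \<omega>) p)"

definition Etr :: "'a measure \<Rightarrow> nat \<Rightarrow> (nat \<Rightarrow> nat \<Rightarrow> 'a \<Rightarrow> cmat) \<Rightarrow> ncpoly \<Rightarrow> complex" where
  "Etr M N Y p = (\<integral>\<omega>. TrP N Y p \<omega> / of_nat N \<partial>M)"

text \<open>Classical cumulant k_r(Y_0, ..., Y_(r-1)) via the moment-cumulant formula.\<close>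
definition cumulant :: "'a measure \<Rightarrow> (nat \<Rightarrow> 'a \<Rightarrow> complex) \<Rightarrow> nat \<Rightarrow> complex" where
  "cumulant M Y r =
     (\<Sum>\<pi>\<in>{\<pi>. partition_on {..<r} \<pi>}.
        (-1) ^ (card \<pi> - 1) * of_nat (fact (card \<pi> - 1)) *
        (\<Prod>B\<in>\<pi>. \<integral>\<omega>. (\<Prod>i\<in>B. Y i \<omega>) \<partial>M))"

definition real_orthogonal :: "nat \<Rightarrow> (nat \<Rightarrow> nat \<Rightarrow> real) \<Rightarrow> bool" where
  "real_orthogonal N Q \<longleftrightarrow>
     (\<forall>r<N. \<forall>c<N. (\<Sum>m<N. Q r m * Q c m) = (if r = c then 1 else 0))"

definition orth_conj :: "nat \<Rightarrow> (nat \<Rightarrow> nat \<Rightarrow> real) \<Rightarrow> cmat \<Rightarrow> cmat" where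
  "orth_conj N Q A = (\<lambda>r c. \<Sum>a<N. \<Sum>b<N. of_real (Q r a) * A a b * of_real (Q c b))"

definition entries_law :: "'a measure \<Rightarrow> nat \<Rightarrow> nat \<Rightarrow> (nat \<Rightarrow> 'a \<Rightarrow> cmat)
    \<Rightarrow> (nat \<times> nat \<times> nat \<Rightarrow> complex) measure" where
  "entries_law M N k Y =
     distr M (Pi\<^sub>M ({..<k} \<times> {..<N} \<times> {..<N}) (\<lambda>_. borel))
       (\<lambda>\<omega>. \<lambda>t\<in>{..<k} \<times> {..<N} \<times> {..<N}. case t of (i, r, c) \<Rightarrow> Y i \<omega> r c)"

definition orth_invariant :: "'a measure \<Rightarrow> nat \<Rightarrow> nat \<Rightarrow> (nat \<Rightarrow> 'a \<Rightarrow> cmat) \<Rightarrow> bool" where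
  "orth_invariant M N k Y \<longleftrightarrow>
     (\<forall>Q. real_orthogonal N Q \<longrightarrow>
        entries_law M N k (\<lambda>i \<omega>. orth_conj N Q (Y i \<omega>)) = entries_law M N k Y)"

definition entry_sigma :: "'a measure \<Rightarrow> nat \<Rightarrow> nat \<Rightarrow> (nat \<Rightarrow> 'a \<Rightarrow> cmat) \<Rightarrow> 'a set set" where
  "entry_sigma M N k Y =
     sigma_sets (space M)
       (\<Union>i<k. \<Union>r<N. \<Union>c<N. {(\<lambda>\<omega>. Y i \<omega> r c) -` B \<inter> space M | B. B \<in> sets borel})"

end

theory Submission
  imports Defs
begin

text \<open>
  Conjugating one orthogonally invariant family by a rotation in a coordinate plane does not change expectations. Differentiating the expectation of an entry of a matrix word
  times a product of traces at zero, and summing over all planes, gives an exact loop equation: the sum over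
  the cuts of the word at the boundaries of the blocks of that family of
  E[Tr U Tr V] - E[Tr(U V^t)], plus terms merging two traces, vanishes. In terms of normalised traces the
  transposed terms carry a factor 1/N and the merging terms a factor 1/N^2. The equation expresses
  an expectation of traces through others with more traces, up to 1/N corrections, until only pure
  traces are left. These factorise up to o(1/N) by independence and by the cumulant hypotheses.
  Hence all expectations of products of normalised traces expand to first order and factorise
  up to o(1/N).

  In the limit, the order-zero part of the loop equation yields freeness. For a cyclically alternating
  centred word the order 1/N part leaves only the terms U V^t with U and V of equal length, which
  are the product of the pairings in the definition of real infinitesimal freeness.
\<close>

section \<open>First-order expansions\<close>

text \<open>One exceptional family is affordable because two distinct families are never both
  exceptional. After cyclic rotation, a word of at least two blocks either gets shorter by a merge
  or begins with an invariant family and ends with another one. In the loop equation of the first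
  block's family, the cut before the word then returns the word itself up to the factor 1 - 1/N, and
  no cut after the word compensates it. Every other cut is proper and yields one more word at the
  same total length, so the number of words measures progress. The obstacle is that the transposed
  and merged terms carry small factors but decrease no measure. They can only be absorbed
  asymptotically, for all configurations of one total length together. Hence boundedness,
  factorisation up to o(1), factorisation up to o(1/N), convergence and expansion are obtained in
  this order inside one induction on the total length. The formula for \<tau>' reflects which cuts
  survive: on leaving a block of the chosen family the transposed remainder continues the
  alternation and the limit vanishes; on entering one, the two halves face each other and cancel
  block by block.\<close>

definition expands :: "(nat \<Rightarrow> complex) \<Rightarrow> complex \<Rightarrow> complex \<Rightarrow> bool" where
  "expands f a b \<longleftrightarrow> (\<lambda>N. of_nat N * (f N - a)) \<longlonglongrightarrow> b"

lemma eventually_pos_nat: "(\<And>N. N > 0 \<Longrightarrow> P N) \<Longrightarrow> eventually P sequentially"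
  by (auto simp: eventually_sequentially intro!: exI[of _ 1])

lemma tendsto_inverse_nat: "(\<lambda>N. 1 / of_nat N :: complex) \<longlonglongrightarrow> 0"
  by (rule lim_1_over_n)

lemma null_of_scaled_null:
  fixes f :: "nat \<Rightarrow> complex"
  assumes "(\<lambda>N. of_nat N * f N) \<longlonglongrightarrow> b"
  shows "f \<longlonglongrightarrow> 0"
proof -
  have "(\<lambda>N. 1 / of_nat N * (of_nat N * f N)) \<longlonglongrightarrow> 0 * b"
    by (intro tendsto_mult tendsto_inverse_nat assms)
  moreover have "eventually (\<lambda>N. 1 / of_nat N * (of_nat N * f N) = f N) sequentially"
    by (rule eventually_pos_nat) auto
  ultimately show ?thesis by (auto intro: Lim_transform_eventually)
qed

lemma expands_tendsto: "expands f a b \<Longrightarrow> f \<longlonglongrightarrow> a"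
  unfolding expands_def using null_of_scaled_null[of "\<lambda>N. f N - a" b]
  by (simp add: LIM_zero_cancel)

lemma expands_unique: "expands f a b \<Longrightarrow> expands f a' b' \<Longrightarrow> a = a' \<and> b = b'"
  using expands_tendsto LIMSEQ_unique expands_def by metis

lemma expands_perturb:
  assumes "expands g a b" and "(\<lambda>N. of_nat N * (f N - g N)) \<longlonglongrightarrow> 0"
  shows "expands f a b"
  using tendsto_add[OF assms(2) assms(1)[unfolded expands_def]]
  unfolding expands_def by (simp add: algebra_simps)

lemma expands_cong:
  assumes "expands g a b" and "\<And>N. N > 0 \<Longrightarrow> f N = g N"
  shows "expands f a b"
proof (rule expands_perturb[OF assms(1)])
  have "eventually (\<lambda>N. of_nat N * (f N - g N) = 0) sequentially"
    by (rule eventually_pos_nat) (simp add: assms(2))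
  then show "(\<lambda>N. of_nat N * (f N - g N)) \<longlonglongrightarrow> 0"
    by (rule tendsto_eventually)
qed

lemma expands_const: "expands (\<lambda>_. c) c 0"
  by (simp add: expands_def)

lemma expands_add: "expands f a b \<Longrightarrow> expands g a' b' \<Longrightarrow> expands (\<lambda>N. f N + g N) (a + a') (b + b')"
  unfolding expands_def by (drule (1) tendsto_add) (simp add: algebra_simps)

lemma expands_cmult: "expands f a b \<Longrightarrow> expands (\<lambda>N. c * f N) (c * a) (c * b)"
  unfolding expands_def by (drule tendsto_mult_left[where c = c]) (simp add: algebra_simps)

lemma expands_diff: "expands f a b \<Longrightarrow> expands g a' b' \<Longrightarrow> expands (\<lambda>N. f N - g N) (a - a') (b - b')"
  unfolding expands_def by (drule (1) tendsto_diff) (simp add: algebra_simps)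

text \<open>Coefficient pairs multiply as dual numbers a + b eps with eps^2 = 0, since the product
  of the two 1/N terms is o(1/N).\<close>

lemma expands_mult:
  assumes "expands f a b" "expands g a' b'"
  shows "expands (\<lambda>N. f N * g N) (a * a') (b * a' + a * b')"
proof -
  have "(\<lambda>N. (of_nat N * (f N - a)) * g N + a * (of_nat N * (g N - a'))) \<longlonglongrightarrow> b * a' + a * b'"
    using assms expands_tendsto[OF assms(2)] unfolding expands_def
    by (intro tendsto_add tendsto_mult tendsto_const)
  then show ?thesis unfolding expands_def by (simp add: algebra_simps)
qed

lemma expands_sum:
  assumes "\<And>i. i \<in> I \<Longrightarrow> expands (f i) (a i) (b i)"
  shows "expands (\<lambda>N. \<Sum>i\<in>I. f i N) (\<Sum>i\<in>I. a i) (\<Sum>i\<in>I. b i)"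
  using assms
  by (induction I rule: infinite_finite_induct)
     (auto intro!: expands_add simp: expands_const)

text \<open>A factor 1/N turns a mere limit into a first-order expansion. This is why the transposed
  terms of the loop equation need only converge before the words themselves can be expanded.\<close>

lemma expands_over_N: "f \<longlonglongrightarrow> a \<Longrightarrow> expands (\<lambda>N. f N / of_nat N) 0 a"
  unfolding expands_def
  by (erule Lim_transform_eventually) (rule eventually_pos_nat, simp)

definition expandable :: "(nat \<Rightarrow> complex) \<Rightarrow> bool" where
  "expandable f \<longleftrightarrow> (\<exists>a b. expands f a b)"

lemma expandable_cong: "expandable g \<Longrightarrow> (\<And>N. N > 0 \<Longrightarrow> f N = g N) \<Longrightarrow> expandable f"
  unfolding expandable_def by (meson expands_cong)

lemma expandable_Bseq: "expandable f \<Longrightarrow> Bseq f"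
  unfolding expandable_def using expands_tendsto convergentI convergent_imp_Bseq by metis

lemma expandable_prod_list:
  "(\<And>x. x \<in> set xs \<Longrightarrow> expandable (f x)) \<Longrightarrow> expandable (\<lambda>N. \<Prod>x\<leftarrow>xs. f x N)"
proof (induction xs)
  case Nil
  then show ?case by (auto simp: expandable_def intro: expands_const)
next
  case (Cons x xs)
  then have "expandable (f x)" "expandable (\<lambda>N. \<Prod>x\<leftarrow>xs. f x N)" by auto
  then show ?case by (auto simp: expandable_def dest: expands_mult)
qed

lemma null_mult_Bseq:
  fixes f g :: "nat \<Rightarrow> complex"
  assumes "f \<longlonglongrightarrow> 0" "Bseq g"
  shows "(\<lambda>N. f N * g N) \<longlonglongrightarrow> 0"
proof -
  from assms(2) obtain K where "eventually (\<lambda>N. norm (g N) \<le> K) sequentially"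
    unfolding Bfun_def by auto
  from lim_null_mult_right_bounded[OF assms(1) this] show ?thesis .
qed

lemma expandable_add: "expandable f \<Longrightarrow> expandable g \<Longrightarrow> expandable (\<lambda>N. f N + g N)"
  unfolding expandable_def using expands_add by blast

lemma expandable_lin_comb:
  assumes "\<And>i. i \<in> I \<Longrightarrow> expandable (f i)"
  shows "expandable (\<lambda>N. \<Sum>i\<in>I. c i * f i N)"
  using assms
proof (induction I rule: infinite_finite_induct)
  case (insert x F)
  then have "expandable (\<lambda>N. c x * f x N)" "expandable (\<lambda>N. \<Sum>i\<in>F. c i * f i N)"
    unfolding expandable_def using expands_cmult by blast+
  then have "expandable (\<lambda>N. c x * f x N + (\<Sum>i\<in>F. c i * f i N))" by (rule expandable_add)
  then show ?case using insert by simp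
qed (auto simp: expandable_def intro: expands_const)

lemma expands_diff_null:
  assumes "expands f a b" "expands g a b"
  shows "(\<lambda>N. of_nat N * (f N - g N)) \<longlonglongrightarrow> 0"
  using tendsto_diff[OF assms[unfolded expands_def]] by (simp add: algebra_simps)

text \<open>The coefficients \<open>A\<close> and \<open>B\<close> are produced before
  \<open>f\<close>: they depend only on the coefficients of the factors, so two families of factors
  with equal coefficients have products with equal expansions.\<close>

lemma expands_prod:
  assumes "finite I"
  obtains A B where "\<And>f. (\<And>i. i \<in> I \<Longrightarrow> expands (f i) (a i) (b i)) \<Longrightarrow> expands (\<lambda>N. \<Prod>i\<in>I. f i N) A B"
  using assms
proof (induction I arbitrary: thesis)
  case empty
  show ?case by (rule empty[of 1 0]) (simp add: expands_const)
next
  case (insert x I)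
  obtain A B where "\<And>f. (\<And>i. i \<in> I \<Longrightarrow> expands (f i) (a i) (b i)) \<Longrightarrow> expands (\<lambda>N. \<Prod>i\<in>I. f i N) A B"
    using insert.IH by blast
  then have "expands (\<lambda>N. \<Prod>i\<in>insert x I. f i N) (a x * A) (b x * A + a x * B)"
    if "\<And>i. i \<in> insert x I \<Longrightarrow> expands (f i) (a i) (b i)" for f
    using that insert.hyps by (simp add: expands_mult)
  then show ?case using insert.prems by blast
qed

text \<open>An o(1/N) change of a factor does not alter its two coefficients, so both products have
  the same expansion and differ by o(1/N).\<close>

lemma prod_null:
  fixes f g :: "'i \<Rightarrow> nat \<Rightarrow> complex"
  assumes "finite I" "\<And>i. i \<in> I \<Longrightarrow> (\<lambda>N. of_nat N * (f i N - g i N)) \<longlonglongrightarrow> 0"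
    "\<And>i. i \<in> I \<Longrightarrow> expandable (g i)"
  shows "(\<lambda>N. of_nat N * ((\<Prod>i\<in>I. f i N) - (\<Prod>i\<in>I. g i N))) \<longlonglongrightarrow> 0"
proof -
  have "\<forall>i\<in>I. \<exists>ab. expands (g i) (fst ab) (snd ab)" using assms(3) by (simp add: expandable_def)
  then obtain ab where ab: "\<forall>i\<in>I. expands (g i) (fst (ab i)) (snd (ab i))" by (rule bchoice[THEN exE])
  obtain A B where AB: "\<And>f. (\<And>i. i \<in> I \<Longrightarrow> expands (f i) (fst (ab i)) (snd (ab i))) \<Longrightarrow>
      expands (\<lambda>N. \<Prod>i\<in>I. f i N) A B"
    using expands_prod[OF assms(1), of "\<lambda>i. fst (ab i)" "\<lambda>i. snd (ab i)"] by blast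
  show ?thesis
  proof (rule expands_diff_null)
    show "expands (\<lambda>N. \<Prod>i\<in>I. g i N) A B" by (rule AB) (use ab in blast)
    show "expands (\<lambda>N. \<Prod>i\<in>I. f i N) A B"
      by (rule AB) (use ab assms(2) expands_perturb in blast)
  qed
qed

lemma expandable_prod:
  assumes "finite I" "\<And>i. i \<in> I \<Longrightarrow> expandable (g i)"
  shows "expandable (\<lambda>N. \<Prod>i\<in>I. g i N)"
  using assms
proof (induction I)
  case empty
  show ?case by (auto simp: expandable_def intro: expands_const)
next
  case (insert x I)
  then obtain a b a' b' where "expands (g x) a b" "expands (\<lambda>N. \<Prod>i\<in>I. g i N) a' b'"
    unfolding expandable_def by blast
  from expands_mult[OF this] show ?case using insert.hyps by (auto simp: expandable_def)
qed

text \<open>A big-O bound with a free scale \<open>S\<close>. The scale cannot be fixed in advance: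
  in the boundedness argument it is the total size of the unknown expectations themselves.\<close>

definition dominated :: "(nat \<Rightarrow> real) \<Rightarrow> (nat \<Rightarrow> complex) \<Rightarrow> bool" where
  "dominated S f \<longleftrightarrow> (\<exists>C\<ge>0. \<forall>\<^sub>F N in sequentially. norm (f N) \<le> C * S N)"

lemma dominatedI: "C \<ge> 0 \<Longrightarrow> (\<And>N. N > 0 \<Longrightarrow> norm (f N) \<le> C * S N) \<Longrightarrow> dominated S f"
  unfolding dominated_def by (auto intro: eventually_pos_nat)

lemma dominated_zero [simp]: "dominated S (\<lambda>_. 0)"
  unfolding dominated_def by (intro exI[of _ 0]) simp

lemma dominated_add:
  assumes "dominated S f" "dominated S g"
  shows "dominated S (\<lambda>N. f N + g N)"
proof -
  from assms obtain C D where CD: "C \<ge> 0" "D \<ge> 0"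
    and f: "\<forall>\<^sub>F N in sequentially. norm (f N) \<le> C * S N"
    and g: "\<forall>\<^sub>F N in sequentially. norm (g N) \<le> D * S N"
    unfolding dominated_def by blast
  from f g have "\<forall>\<^sub>F N in sequentially. norm (f N + g N) \<le> (C + D) * S N"
    by eventually_elim (simp add: distrib_right norm_triangle_mono)
  then show ?thesis unfolding dominated_def using CD by (intro exI[of _ "C + D"]) auto
qed

lemma dominated_mult_const:
  assumes "dominated S f"
  shows "dominated S (\<lambda>N. c * f N)"
proof -
  from assms obtain C where C: "C \<ge> 0"
    and f: "\<forall>\<^sub>F N in sequentially. norm (f N) \<le> C * S N"
    unfolding dominated_def by blast
  from f have "\<forall>\<^sub>F N in sequentially. norm (c * f N) \<le> (norm c * C) * S N"
    by eventually_elim (simp add: norm_mult mult.assoc mult_left_mono)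
  then show ?thesis unfolding dominated_def using C by (intro exI[of _ "norm c * C"]) auto
qed

lemma dominated_diff: "dominated S f \<Longrightarrow> dominated S g \<Longrightarrow> dominated S (\<lambda>N. f N - g N)"
  using dominated_add[of S f "\<lambda>N. - 1 * g N"] dominated_mult_const[of S g "-1"] by simp

lemma dominated_sum:
  "(\<And>i. i \<in> I \<Longrightarrow> dominated S (f i)) \<Longrightarrow> dominated S (\<lambda>N. \<Sum>i\<in>I. f i N)"
  by (induction I rule: infinite_finite_induct) (auto intro: dominated_add)

lemma dominated_mono:
  assumes "dominated S f" "\<And>N. N > 0 \<Longrightarrow> norm (g N) \<le> B N * norm (f N)"
    "\<And>N. N > 0 \<Longrightarrow> 0 \<le> B N" "\<And>N. N > 0 \<Longrightarrow> B N * S N \<le> S' N"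
  shows "dominated S' g"
proof -
  from assms(1) obtain C where C: "C \<ge> 0"
    and f: "\<forall>\<^sub>F N in sequentially. norm (f N) \<le> C * S N"
    unfolding dominated_def by blast
  from f have "\<forall>\<^sub>F N in sequentially. norm (g N) \<le> C * S' N"
    using eventually_gt_at_top[of 0]
  proof eventually_elim
    case (elim N)
    have "norm (g N) \<le> B N * norm (f N)" using assms(2) elim by simp
    also have "\<dots> \<le> B N * (C * S N)" using elim assms(3) by (intro mult_left_mono) auto
    also have "\<dots> = C * (B N * S N)" by simp
    also have "\<dots> \<le> C * S' N" using elim assms(4) C by (intro mult_left_mono) auto
    finally show ?case .
  qed
  then show ?thesis unfolding dominated_def using C by auto
qed

lemma Bseq_iff_dominated: "Bseq f \<longleftrightarrow> dominated (\<lambda>_. 1) f"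
proof
  assume "Bseq f"
  then obtain K where "K > 0" "\<forall>\<^sub>F N in sequentially. norm (f N) \<le> K" unfolding Bfun_def by blast
  then show "dominated (\<lambda>_. 1) f" unfolding dominated_def by (intro exI[of _ K]) auto
next
  assume "dominated (\<lambda>_. 1) f"
  then obtain C where "\<forall>\<^sub>F N in sequentially. norm (f N) \<le> C" unfolding dominated_def by auto
  then show "Bseq f" by (rule BfunI)
qed

lemma expandable_dominated: "expandable f \<Longrightarrow> dominated (\<lambda>_. 1) f"
  using expandable_Bseq Bseq_iff_dominated by blast

section \<open>Asymptotic analysis of the loop equations\<close>

definition cfg_len :: "'b list list \<Rightarrow> nat" where
  "cfg_len ws = sum_list (map length ws)"

lemma cfg_len_mset: "mset ws = mset ws' \<Longrightarrow> cfg_len ws = cfg_len ws'"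
  unfolding cfg_len_def by (metis mset_map sum_mset_sum_list)

lemma cfg_len_simps [simp]:
  "cfg_len [] = 0" "cfg_len (w # ws) = length w + cfg_len ws" "cfg_len (xs @ ys) = cfg_len xs + cfg_len ys"
  by (auto simp: cfg_len_def)

lemma cfg_len_member: "w \<in> set ws \<Longrightarrow> length w \<le> cfg_len ws"
  unfolding cfg_len_def by (simp add: member_le_sum_list)

lemma length_le_cfg_len: "(\<And>w. w \<in> set ws \<Longrightarrow> w \<noteq> []) \<Longrightarrow> length ws \<le> cfg_len ws"
proof (induction ws)
  case (Cons w ws)
  then have "length ws \<le> cfg_len ws" "w \<noteq> []" by auto
  then show ?case by (cases w) auto
qed simp

text \<open>Cutting, transposing and merging preserve the total length and stay in an alphabet
  closed under transposition, so the loop equations of one length close up on this set. Demanding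
  nonempty words bounds their number by \<open>L\<close> and makes the set finite.\<close>

definition configs :: "'b set \<Rightarrow> nat \<Rightarrow> 'b list list set" where
  "configs A L = {ws. (\<forall>w\<in>set ws. w \<noteq> [] \<and> set w \<subseteq> A) \<and> cfg_len ws = L}"

lemma finite_configs:
  assumes "finite A"
  shows "finite (configs A L)"
proof -
  let ?W = "{w. set w \<subseteq> A \<and> length w \<le> L}"
  have "finite ?W" by (rule finite_lists_length_le[OF assms])
  then have "finite {ws. set ws \<subseteq> ?W \<and> length ws \<le> L}" by (rule finite_lists_length_le)
  moreover have "configs A L \<subseteq> {ws. set ws \<subseteq> ?W \<and> length ws \<le> L}"
    using cfg_len_member length_le_cfg_len unfolding configs_def by fastforce
  ultimately show ?thesis by (rule finite_subset[rotated])
qed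

text \<open>Summation by parts moves the differences from the cut values \<open>g\<close> to the
  coefficients \<open>c\<close>. With indicator coefficients only the cuts where the word enters or
  leaves the chosen family remain, besides the two ends.\<close>

lemma sum_by_parts_cut:
  fixes g c :: "nat \<Rightarrow> complex"
  assumes "n \<ge> 1"
  shows "(\<Sum>i<n. c i * (g i - g (Suc i))) =
    c 0 * g 0 - (\<Sum>p\<in>{1..<n}. (c (p - 1) - c p) * g p) - c (n - 1) * g n"
  using assms
proof (induction n rule: nat_induct_at_least)
  case (Suc n)
  have "(\<Sum>p\<in>{1..<Suc n}. (c (p - 1) - c p) * g p) = (\<Sum>p\<in>{1..<n}. (c (p - 1) - c p) * g p) + (c (n - 1) - c n) * g n"
    using Suc by (simp add: sum.op_ivl_Suc)
  then show ?case using Suc by (simp add: algebra_simps)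
qed (simp add: algebra_simps)

text \<open>A block is an element of one of the subalgebras, with its family index given by fam;
  E N ws is the expectation of the product over the words w in ws of the normalised trace of the
  product of the blocks of w, and cen a c stands for a - c 1.\<close>
locale loop_system =
  fixes ok :: "'b \<Rightarrow> bool" and fam :: "'b \<Rightarrow> nat" and mrg :: "'b \<Rightarrow> 'b \<Rightarrow> 'b"
    and tp :: "'b \<Rightarrow> 'b" and cen :: "'b \<Rightarrow> complex \<Rightarrow> 'b" and invt :: "nat \<Rightarrow> bool"
    and E :: "nat \<Rightarrow> 'b list list \<Rightarrow> complex"
  assumes ok_mrg: "ok a \<Longrightarrow> ok b \<Longrightarrow> fam a = fam b \<Longrightarrow> ok (mrg a b)"
    and fam_mrg: "fam a = fam b \<Longrightarrow> fam (mrg a b) = fam a"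
    and ok_tp: "ok a \<Longrightarrow> ok (tp a)" and fam_tp [simp]: "fam (tp a) = fam a"
    and tp_tp [simp]: "tp (tp a) = a"
    and ok_cen: "ok a \<Longrightarrow> ok (cen a c)" and fam_cen [simp]: "fam (cen a c) = fam a"
    and invt: "ok a \<Longrightarrow> ok b \<Longrightarrow> fam a \<noteq> fam b \<Longrightarrow> invt (fam a) \<or> invt (fam b)"
    and E_perm: "mset ws = mset ws' \<Longrightarrow> E N ws = E N ws'"
    and E_nil: "N > 0 \<Longrightarrow> E N ([] # R) = E N R"
    and E_empty: "N > 0 \<Longrightarrow> E N [] = 1"
    and E_rot: "N > 0 \<Longrightarrow> E N ((u @ v) # R) = E N ((v @ u) # R)"
    and E_merge: "N > 0 \<Longrightarrow> ok a \<Longrightarrow> ok b \<Longrightarrow> fam a = fam b \<Longrightarrow>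
        E N ((a # b # u) # R) = E N ((mrg a b # u) # R)"
    and E_tp: "N > 0 \<Longrightarrow> E N (map tp (rev w) # R) = E N (w # R)"
    and E_cen: "N > 0 \<Longrightarrow> ok a \<Longrightarrow> (\<forall>b\<in>set u. ok b) \<Longrightarrow>
        E N [cen a c # u] = E N [a # u] - c * E N [u]"
    and E_loop: "N > 0 \<Longrightarrow> invt j \<Longrightarrow> (\<forall>b\<in>set w. ok b) \<Longrightarrow> (\<forall>v\<in>set R. \<forall>b\<in>set v. ok b) \<Longrightarrow>
        (\<Sum>i<length w. of_bool (fam (w ! i) = j) *
           ((E N (take i w # drop i w # R)
              - E N ((take i w @ map tp (rev (drop i w))) # R) / of_nat N)
          - (E N (take (Suc i) w # drop (Suc i) w # R)
              - E N ((take (Suc i) w @ map tp (rev (drop (Suc i) w))) # R) / of_nat N)))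
        + (\<Sum>m<length R. \<Sum>i<length (R ! m). of_bool (fam (R ! m ! i) = j) *
            ((E N ((w @ drop i (R ! m) @ take i (R ! m)) # take m R @ drop (Suc m) R)
               - E N ((w @ map tp (rev (drop i (R ! m) @ take i (R ! m)))) # take m R @ drop (Suc m) R))
           - (E N ((w @ drop (Suc i) (R ! m) @ take (Suc i) (R ! m)) # take m R @ drop (Suc m) R)
               - E N ((w @ map tp (rev (drop (Suc i) (R ! m) @ take (Suc i) (R ! m)))) # take m R @ drop (Suc m) R))))
          / (of_nat N)\<^sup>2 = 0"
    and base: "(\<forall>b\<in>set bs. ok b) \<Longrightarrow>
        (\<lambda>N. of_nat N * (E N (map (\<lambda>b. [b]) bs) - (\<Prod>b\<leftarrow>bs. E N [[b]]))) \<longlonglongrightarrow> 0"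
    and base_expandable: "ok b \<Longrightarrow> expandable (\<lambda>N. E N [[b]])"
begin

abbreviation okw :: "'b list \<Rightarrow> bool" where
  "okw w \<equiv> \<forall>b\<in>set w. ok b"

abbreviation tpw :: "'b list \<Rightarrow> 'b list" where
  "tpw w \<equiv> map tp (rev w)"

lemma okw_tpw: "okw w \<Longrightarrow> okw (tpw w)"
  by (auto intro: ok_tp)

definition defect :: "nat \<Rightarrow> 'b list list \<Rightarrow> complex" where
  "defect N ws = E N ws - (\<Prod>w\<leftarrow>ws. E N [w])"

lemma defect_perm:
  assumes "mset ws = mset ws'"
  shows "defect N ws = defect N ws'"
  using assms E_perm[OF assms, of N]
  by (simp add: defect_def flip: prod_mset_prod_list)

lemma defect_single: "defect N [w] = 0"
  by (simp add: defect_def)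

lemma defect_cong_word:
  assumes "\<And>R. E N (w # R) = E N (v # R)"
  shows "defect N (w # R) = defect N (v # R)"
  unfolding defect_def using assms by simp

text \<open>The shape in which the loop equation for the family of \<open>hd w\<close> can be solved
  for \<open>w\<close>: the first block makes the cut at 0 count, and the last block, being of
  another family, prevents the cut at the far end from cancelling it.\<close>

definition loopable :: "'b list \<Rightarrow> bool" where
  "loopable w \<longleftrightarrow> w \<noteq> [] \<and> okw w \<and> invt (fam (hd w)) \<and> fam (hd w) \<noteq> fam (last w)"

text \<open>Traces are cyclic, so equal families at the two ends can be merged. If the ends differ,
  one of them is invariant; either it is in front already, or the last block is rotated to the front
  and compared with its new cyclic neighbour.\<close>

lemma word_cases:
  assumes "length w \<ge> 2" "okw w"
  obtains (shorter) v where "length v < length w" "v \<noteq> []" "okw v"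
      "\<And>N R. N > 0 \<Longrightarrow> E N (w # R) = E N (v # R)"
  | (loopable) v where "mset v = mset w" "loopable v"
      "\<And>N R. N > 0 \<Longrightarrow> E N (w # R) = E N (v # R)"
proof -
  obtain a m z where w: "w = a # m @ [z]"
    using assms(1) by (cases w; cases "tl w" rule: rev_cases) auto
  have ok: "ok a" "ok z" "okw m" using assms(2) w by auto
  show thesis
  proof (cases "fam z = fam a")
    case True
    show thesis
    proof (rule shorter[of "mrg z a # m"])
      show "E N (w # R) = E N ((mrg z a # m) # R)" if "N > 0" for N R
        using E_rot[of N "a # m" "[z]" R] E_merge[of N z a m R] that True ok w by simp
    qed (use ok w True in \<open>auto intro: ok_mrg\<close>)
  next
    case False
    show thesis
    proof (cases "invt (fam a)")
      case True
      show thesis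
        by (rule loopable[of w]) (use True False ok assms in \<open>auto simp: loopable_def w\<close>)
    next
      case nota: False
      then have z: "invt (fam z)" using invt[of a z] ok False by auto
      \<comment> \<open>Once \<open>z\<close> is moved to the front, \<open>x\<close> is the last
        block; its family decides between a merge and a loopable rotation.\<close>
      obtain u x where ux: "a # m = u @ [x]" by (cases "a # m" rule: rev_cases) auto
      have "okw (u @ [x])" unfolding ux[symmetric] using ok by auto
      then have okx: "ok x" "okw u" by auto
      show thesis
      proof (cases "fam x = fam z")
        case True
        show thesis
        proof (rule shorter[of "mrg x z # u"])
          have wu: "w = u @ [x, z]" using w ux by simp
          show "E N (w # R) = E N ((mrg x z # u) # R)" if "N > 0" for N R
            using E_rot[of N u "[x,z]" R] E_merge[of N x z u R] that True ok okx wu by simp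
          show "length (mrg x z # u) < length w" using wu by simp
        qed (use ok okx w True in \<open>auto intro: ok_mrg\<close>)
      next
        case False
        show thesis
        proof (rule loopable[of "z # a # m"])
          show "loopable (z # a # m)"
          proof -
            have "last (z # a # m) = x" using ux by simp
            then show ?thesis unfolding loopable_def using z False ok by auto
          qed
          show "E N (w # R) = E N ((z # a # m) # R)" if "N > 0" for N R
            using E_rot[of N "a # m" "[z]" R] that w by simp
        qed (use w in auto)
      qed
    qed
  qed
qed

text \<open>It is 1 where the word leaves the family of its first block, -1 where it enters it
  again, and 0 at all other cuts.\<close>

definition jump :: "'b list \<Rightarrow> nat \<Rightarrow> complex" where
  "jump w p = of_bool (fam (w ! (p - 1)) = fam (hd w)) - of_bool (fam (w ! p) = fam (hd w))"

definition merges :: "nat \<Rightarrow> nat \<Rightarrow> 'b list \<Rightarrow> 'b list list \<Rightarrow> complex" where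
  "merges j N w R = (\<Sum>m<length R. \<Sum>i<length (R ! m). of_bool (fam (R ! m ! i) = j) *
            ((E N ((w @ drop i (R ! m) @ take i (R ! m)) # take m R @ drop (Suc m) R)
               - E N ((w @ tpw (drop i (R ! m) @ take i (R ! m))) # take m R @ drop (Suc m) R))
           - (E N ((w @ drop (Suc i) (R ! m) @ take (Suc i) (R ! m)) # take m R @ drop (Suc m) R)
               - E N ((w @ tpw (drop (Suc i) (R ! m) @ take (Suc i) (R ! m))) # take m R @ drop (Suc m) R))))"

text \<open>Summation by parts isolates the cut at 0, which equals (1 - 1/N) times the unknown. Its
  1/N part is moved to the other side and shares the bracket with the transposed terms; the far end
  has coefficient 0.\<close>

lemma loop_recursion:
  assumes N: "N > 0" and w: "loopable w" and R: "\<forall>v\<in>set R. okw v"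
  shows "E N (w # R) =
      (\<Sum>p\<in>{1..<length w}. jump w p * E N (take p w # drop p w # R))
    + (E N (w # R) - (\<Sum>p\<in>{1..<length w}. jump w p * E N ((take p w @ tpw (drop p w)) # R))) / of_nat N
    - merges (fam (hd w)) N w R / (of_nat N)\<^sup>2"
proof -
  let ?n = "length w" and ?j = "fam (hd w)"
  define g where "g p = E N (take p w # drop p w # R)
              - E N ((take p w @ tpw (drop p w)) # R) / of_nat N" for p
  define c where "c i = (of_bool (fam (w ! i) = ?j) :: complex)" for i
  have n: "?n \<ge> 1" using w by (cases w) (auto simp: loopable_def)
  have "(\<Sum>i<?n. c i * (g i - g (Suc i))) + merges ?j N w R / (of_nat N)\<^sup>2 = 0"
    unfolding g_def c_def merges_def
    by (rule E_loop[OF N _ _ R]) (use w in \<open>auto simp: loopable_def\<close>)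
  moreover have "c 0 = 1" "c (?n - 1) = 0"
    using w by (auto simp: c_def loopable_def hd_conv_nth last_conv_nth)
  \<comment> \<open>At the cut 0 the left factor is the empty word, of normalised trace 1, and the
    transposed term is the trace of the whole transposed word, which is again the original
    expectation.\<close>
  moreover have "g 0 = E N (w # R) - E N (w # R) / of_nat N"
    using E_nil[OF N] E_tp[OF N] by (simp add: g_def)
  moreover have "(\<Sum>p\<in>{1..<?n}. (c (p - 1) - c p) * g p) =
      (\<Sum>p\<in>{1..<?n}. jump w p * E N (take p w # drop p w # R))
      - (\<Sum>p\<in>{1..<?n}. jump w p * E N ((take p w @ tpw (drop p w)) # R)) / of_nat N"
  proof -
    have "jump w p = c (p - 1) - c p" for p by (simp add: jump_def c_def)
    then show ?thesis
      unfolding g_def sum_divide_distrib sum_subtractf[symmetric]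
      by (intro sum.cong) (auto simp: right_diff_distrib)
  qed
  moreover have "(\<Sum>i<?n. c i * (g i - g (Suc i))) = c 0 * g 0 -
      (\<Sum>p\<in>{1..<?n}. (c (p - 1) - c p) * g p) - c (?n - 1) * g ?n"
    by (rule sum_by_parts_cut[OF n])
  ultimately have "g 0 = (\<Sum>p\<in>{1..<?n}. jump w p * E N (take p w # drop p w # R))
      - (\<Sum>p\<in>{1..<?n}. jump w p * E N ((take p w @ tpw (drop p w)) # R)) / of_nat N
      - merges ?j N w R / (of_nat N)\<^sup>2" (is "_ = ?r")
    by algebra
  moreover have "E N (w # R) = g 0 + E N (w # R) / of_nat N"
    by (simp add: \<open>g 0 = E N (w # R) - E N (w # R) / of_nat N\<close>)
  ultimately have "E N (w # R) = ?r + E N (w # R) / of_nat N" by simp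
  then show ?thesis unfolding diff_divide_distrib by algebra
qed

section \<open>Boundedness of all configurations of a given total length\<close>

abbreviation okcfg :: "'b list list \<Rightarrow> bool" where
  "okcfg ws \<equiv> \<forall>w\<in>set ws. w \<noteq> [] \<and> okw w"

lemma configs_okcfg: "ws \<in> configs A L \<Longrightarrow> \<forall>b\<in>A. ok b \<Longrightarrow> okcfg ws"
  unfolding configs_def by blast

text \<open>Either only traces of single blocks are left, or some word of length at least two can be
  moved to the front. The loopable case keeps both the total length and the number of words, so
  either may serve as a measure.\<close>

lemma config_cases:
  assumes ws: "ws \<in> configs A L" and A: "\<forall>b\<in>A. ok b"
  obtains (pure) bs where "ws = map (\<lambda>b. [b]) bs" "set bs \<subseteq> A"
  | (shorter) ws' where "okcfg ws'" "cfg_len ws' < L"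
      "\<And>N. N > 0 \<Longrightarrow> E N ws = E N ws'" "\<And>N. N > 0 \<Longrightarrow> defect N ws = defect N ws'"
  | (loopable) w R where "loopable w" "w # R \<in> configs A L" "length (w # R) = length ws"
      "\<And>N. N > 0 \<Longrightarrow> E N ws = E N (w # R)" "\<And>N. N > 0 \<Longrightarrow> defect N ws = defect N (w # R)"
proof (cases "\<forall>w\<in>set ws. length w = 1")
  case True
  have "ws = map (\<lambda>b. [b]) (map hd ws)"
    using True by (auto simp: length_Suc_conv intro!: map_idI[symmetric])
  moreover have "set (map hd ws) \<subseteq> A"
    using True ws by (auto simp: configs_def subset_iff)
  ultimately show thesis by (rule pure)
next
  case False
  then obtain w where w: "w \<in> set ws" "length w \<noteq> 1" by blast
  obtain xs ys where "ws = xs @ w # ys" using split_list[OF w(1)] by blast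
  then have R: "mset ws = mset (w # (xs @ ys))" by simp
  define R where "R = xs @ ys"
  note R = R[folded R_def]
  have set: "set ws = set (w # R)" using R by (metis set_mset_mset)
  have cfg: "w # R \<in> configs A L"
    using ws set cfg_len_mset[OF R] unfolding configs_def by auto
  have len: "length (w # R) = length ws" using R by (metis size_mset)
  have eq: "E N ws = E N (w # R)" "defect N ws = defect N (w # R)" for N
    using E_perm[OF R] defect_perm[OF R] by auto
  have "w \<noteq> []" and okw: "okw w" using cfg A by (auto simp: configs_def)
  then have "length w \<ge> 2" using w(2) by (cases w; cases "tl w") auto
  then show thesis using okw
  proof (cases rule: word_cases)
    case (shorter v)
    show thesis
    proof (rule that(2)[of "v # R"])
      show "okcfg (v # R)" using shorter configs_okcfg[OF cfg A] by simp
      show "cfg_len (v # R) < L" using shorter cfg by (auto simp: configs_def)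
      show "E N ws = E N (v # R)" if "N > 0" for N using eq shorter(4)[OF that] by simp
      show "defect N ws = defect N (v # R)" if "N > 0" for N
        using eq defect_cong_word[OF shorter(4)[OF that]] by simp
    qed
  next
    case (loopable v)
    show thesis
    proof (rule that(3)[of v R])
      have "set v = set w" "length v = length w" using loopable(1)
        by (metis set_mset_mset, metis size_mset)
      then show "v # R \<in> configs A L" using cfg loopable(2) by (auto simp: configs_def loopable_def)
      show "E N ws = E N (v # R)" if "N > 0" for N using eq loopable(3)[OF that] by simp
      show "defect N ws = defect N (v # R)" if "N > 0" for N
        using eq defect_cong_word[OF loopable(3)[OF that]] by simp
    qed (use loopable len in auto)
  qed
qed

lemma configs_split:
  assumes "w # R \<in> configs A L" "p \<in> {1..<length w}" "tp ` A \<subseteq> A"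
  shows "take p w # drop p w # R \<in> configs A L"
    and "(take p w @ tpw (drop p w)) # R \<in> configs A L"
proof -
  have s: "set (take p w) \<subseteq> A" "set (drop p w) \<subseteq> A" "take p w \<noteq> []" "drop p w \<noteq> []"
    using assms by (auto simp: configs_def dest: in_set_takeD in_set_dropD)
  moreover have "length (take p w) + length (drop p w) = length w" by simp
  ultimately show "take p w # drop p w # R \<in> configs A L"
    using assms(1) by (simp add: configs_def)
  have "set (tpw (drop p w)) \<subseteq> A" using s assms(3) by auto
  with s show "(take p w @ tpw (drop p w)) # R \<in> configs A L"
    using assms(1,2) by (simp add: configs_def)
qed

lemma configs_merge:
  assumes "w # R \<in> configs A L" "m < length R" "tp ` A \<subseteq> A"
  shows "(w @ drop p (R ! m) @ take p (R ! m)) # take m R @ drop (Suc m) R \<in> configs A L"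
    and "(w @ tpw (drop p (R ! m) @ take p (R ! m))) # take m R @ drop (Suc m) R \<in> configs A L"
proof -
  have R: "R = take m R @ R ! m # drop (Suc m) R" using assms(2) by (simp add: id_take_nth_drop)
  have "cfg_len R = cfg_len (take m R) + length (R ! m) + cfg_len (drop (Suc m) R)"
    by (subst R) simp
  then have len: "length w + length (R ! m) + (cfg_len (take m R) + cfg_len (drop (Suc m) R)) = L"
    using assms(1) by (simp add: configs_def)
  have mem: "\<forall>v\<in>set (take m R @ drop (Suc m) R). v \<noteq> [] \<and> set v \<subseteq> A"
    using assms(1) by (auto simp: configs_def dest: in_set_takeD in_set_dropD)
  have m: "set (R ! m) \<subseteq> A" "w \<noteq> []" "set w \<subseteq> A" using assms by (auto simp: configs_def)
  have sub: "set (drop p (R ! m) @ take p (R ! m)) \<subseteq> A"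
    using m by (auto dest: in_set_takeD in_set_dropD)
  have l: "length (drop p (R ! m) @ take p (R ! m)) = length (R ! m)" by simp
  show "(w @ drop p (R ! m) @ take p (R ! m)) # take m R @ drop (Suc m) R \<in> configs A L"
    using mem m sub l len unfolding configs_def by (auto simp: min_def)
  have "set (tpw (drop p (R ! m) @ take p (R ! m))) \<subseteq> A" using sub assms(3) by auto
  moreover have "length (tpw (drop p (R ! m) @ take p (R ! m))) = length (R ! m)" by simp
  ultimately show "(w @ tpw (drop p (R ! m) @ take p (R ! m))) # take m R @ drop (Suc m) R \<in> configs A L"
    using mem m len unfolding configs_def mem_Collect_eq
    by (simp only: list.set ball_simps set_append cfg_len_simps length_append) auto
qed

lemma dominated_merges:
  assumes "w # R \<in> configs A L" "tp ` A \<subseteq> A" "\<And>x. x \<in> configs A L \<Longrightarrow> dominated S (\<lambda>N. E N x)"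
  shows "dominated S (\<lambda>N. merges j N w R)"
  unfolding merges_def
  by (intro dominated_sum dominated_mult_const dominated_diff assms(3) configs_merge[OF assms(1) _ assms(2)]) auto

text \<open>There is no a priori bound, since the algebras are not closed under adjoints. Let S be the
  sum of the absolute values over the finitely many configurations of a given length in a finite
  alphabet closed under transposition. The recursion bounds each of them by C + C S/N, so S is bounded.\<close>
lemma configs_bounded:
  assumes A: "finite A" "\<forall>b\<in>A. ok b" "tp ` A \<subseteq> A"
    and IH: "\<And>ws. okcfg ws \<Longrightarrow> cfg_len ws < L \<Longrightarrow> dominated (\<lambda>_. 1) (\<lambda>N. E N ws)"
    and ws: "ws \<in> configs A L"
  shows "dominated (\<lambda>_. 1) (\<lambda>N. E N ws)"
proof -
  define S where "S N = (\<Sum>x\<in>configs A L. norm (E N x))" for N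
  have fin: "finite (configs A L)" by (rule finite_configs[OF A(1)])
  have S0: "S N \<ge> 0" for N unfolding S_def by (intro sum_nonneg) auto
  have domS: "dominated S (\<lambda>N. E N x)" if "x \<in> configs A L" for x
    unfolding S_def by (rule dominatedI[of 1]) (use that fin in \<open>auto intro!: member_le_sum\<close>)
  define S' where "S' N = 1 + S N / real N" for N
  have S'1: "dominated S' f" if "dominated (\<lambda>_. 1) f" for f
    by (rule dominated_mono[OF that, of _ "\<lambda>_. 1"]) (auto simp: S'_def S0)
  have S'S: "dominated S' (\<lambda>N. f N / of_nat N)" if "dominated S f" for f
    by (rule dominated_mono[OF that, of _ "\<lambda>N. 1 / real N"]) (auto simp: S'_def S0 norm_divide)
  have S'S2: "dominated S' (\<lambda>N. f N / (of_nat N)\<^sup>2)" if "dominated S f" for f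
  proof (rule dominated_mono[OF that, of _ "\<lambda>N. 1 / (real N)\<^sup>2"])
    show "1 / (real N)\<^sup>2 * S N \<le> S' N" if "N > 0" for N
    proof -
      have "1 / (real N)\<^sup>2 * S N \<le> 1 / real N * S N" using that S0
        by (intro mult_right_mono) (auto simp: field_simps power2_eq_square)
      then show ?thesis by (simp add: S'_def)
    qed
  qed (auto simp: norm_divide norm_power)
  have key: "dominated S' (\<lambda>N. E N x)" if "x \<in> configs A L" for x
    using that
  \<comment> \<open>A proper cut keeps the total length and adds one word, and nonempty words bound
    their number by \<open>L\<close>. The transposed and merged terms do not decrease this measure
    and are bounded by the scale \<open>S\<close> instead.\<close>
  proof (induction "L - length x" arbitrary: x rule: less_induct)
    case less
    from less.prems A(2) show ?case
    proof (cases rule: config_cases)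
      case (pure bs)
      have ok: "\<forall>b\<in>set bs. ok b" using pure A by auto
      have "expandable (\<lambda>N. \<Prod>b\<leftarrow>bs. E N [[b]])"
        by (rule expandable_prod_list) (use ok base_expandable in auto)
      then obtain a b where "expands (\<lambda>N. \<Prod>b\<leftarrow>bs. E N [[b]]) a b" by (auto simp: expandable_def)
      from expands_perturb[OF this base[OF ok]] have "expandable (\<lambda>N. E N x)"
        unfolding expandable_def pure by blast
      then show ?thesis using S'1 expandable_dominated by blast
    next
      case (shorter ws')
      have "dominated S' (\<lambda>N. E N ws')" using S'1 IH shorter by blast
      then show ?thesis
        by (rule dominated_mono[of _ _ _ "\<lambda>_. 1"]) (use shorter in auto)
    next
      case (loopable w R)
      have ok: "\<forall>v\<in>set R. okw v" using configs_okcfg[OF loopable(2) A(2)] by simp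
      have rank: "L - length (take p w # drop p w # R) < L - length x" if "p \<in> {1..<length w}" for p
      proof -
        have "take p w # drop p w # R \<in> configs A L"
          by (rule configs_split[OF loopable(2) that A(3)])
        then have "length (take p w # drop p w # R) \<le> L"
          using length_le_cfg_len unfolding configs_def by blast
        then show ?thesis using loopable(3) by simp
      qed
      have "dominated S' (\<lambda>N. (\<Sum>p\<in>{1..<length w}. jump w p * E N (take p w # drop p w # R))
          + (E N (w # R) - (\<Sum>p\<in>{1..<length w}. jump w p * E N ((take p w @ tpw (drop p w)) # R))) / of_nat N
          - merges (fam (hd w)) N w R / (of_nat N)\<^sup>2)"
        by (intro dominated_diff dominated_add dominated_sum dominated_mult_const S'S S'S2 domS less.hyps rank
            dominated_merges[OF loopable(2) A(3)] configs_split[OF loopable(2) _ A(3)] loopable(2))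
      then show ?thesis
      proof (rule dominated_mono[of _ _ _ "\<lambda>_. 1"])
        show "norm (E N x) \<le> 1 * norm ((\<Sum>p\<in>{1..<length w}. jump w p * E N (take p w # drop p w # R))
          + (E N (w # R) - (\<Sum>p\<in>{1..<length w}. jump w p * E N ((take p w @ tpw (drop p w)) # R))) / of_nat N
          - merges (fam (hd w)) N w R / (of_nat N)\<^sup>2)" if "N > 0" for N
          using loop_recursion[OF that loopable(1) ok] loopable(4)[OF that] by simp
      qed auto
    qed
  qed
  have "\<exists>C\<ge>0. \<forall>\<^sub>F N in sequentially. S N \<le> C * S' N"
  proof -
    have "dominated S' (\<lambda>N. \<Sum>x\<in>configs A L. of_real (norm (E N x)))"
      by (intro dominated_sum) (rule dominated_mono[OF key, of _ _ "\<lambda>_. 1"], auto)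
    then have "dominated S' (\<lambda>N. of_real (S N))" by (simp add: S_def)
    then show ?thesis unfolding dominated_def using S0 by simp
  qed
  then obtain C where C: "C \<ge> 0" and ev: "\<forall>\<^sub>F N in sequentially. S N \<le> C * S' N" by blast
  have "\<forall>\<^sub>F N in sequentially. norm (E N ws) \<le> (2 * C) * 1"
    using ev eventually_gt_at_top[of "nat \<lceil>2 * C\<rceil>"] eventually_gt_at_top[of 0]
  proof eventually_elim
    case (elim N)
    have N: "2 * C \<le> real N" using elim(2) by linarith
    have "C * (S N / real N) = (C / real N) * S N" by simp
    also have "\<dots> \<le> (1 / 2) * S N"
      using N elim(3) S0 by (intro mult_right_mono) (auto simp: field_simps)
    finally have "C * (S N / real N) \<le> 1 / 2 * S N" .
    moreover have "S N \<le> C + C * (S N / real N)" using elim(1) by (simp add: S'_def distrib_left)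
    ultimately have "S N \<le> C + S N / 2" by linarith
    moreover have "norm (E N ws) \<le> S N"
      unfolding S_def using ws fin by (auto intro!: member_le_sum)
    ultimately show ?case by simp
  qed
  then show ?thesis unfolding dominated_def using C by (intro exI[of _ "2 * C"]) auto
qed

text \<open>This is the recursion for \<open>w # R\<close> minus the recursion for \<open>w\<close>
  alone multiplied by the factorised traces of \<open>R\<close>. The second one cuts
  \<open>w\<close> in the presence of no other word, which is where the defects of
  \<open>[take p w, drop p w]\<close> come from.\<close>

lemma defect_recursion:
  assumes N: "N > 0" and w: "loopable w" and R: "\<forall>v\<in>set R. okw v"
  shows "defect N (w # R) =
      (\<Sum>p\<in>{1..<length w}. jump w p *
         (defect N (take p w # drop p w # R) - defect N [take p w, drop p w] * (\<Prod>v\<leftarrow>R. E N [v])))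
    + (defect N (w # R) - (\<Sum>p\<in>{1..<length w}. jump w p * defect N ((take p w @ tpw (drop p w)) # R))) / of_nat N
    - merges (fam (hd w)) N w R / (of_nat N)\<^sup>2"
proof -
  let ?P = "\<Prod>v\<leftarrow>R. E N [v]"
  have 1: "(\<Sum>p\<in>{1..<length w}. jump w p *
         (defect N (take p w # drop p w # R) - defect N [take p w, drop p w] * ?P))
      = (\<Sum>p\<in>{1..<length w}. jump w p * E N (take p w # drop p w # R))
      - (\<Sum>p\<in>{1..<length w}. jump w p * E N (take p w # drop p w # [])) * ?P"
    unfolding sum_distrib_right sum_subtractf[symmetric]
    by (rule sum.cong) (simp_all add: defect_def algebra_simps)
  have 2: "(\<Sum>p\<in>{1..<length w}. jump w p * defect N ((take p w @ tpw (drop p w)) # R))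
      = (\<Sum>p\<in>{1..<length w}. jump w p * E N ((take p w @ tpw (drop p w)) # R))
      - (\<Sum>p\<in>{1..<length w}. jump w p * E N ((take p w @ tpw (drop p w)) # [])) * ?P"
    unfolding sum_distrib_right sum_subtractf[symmetric]
    by (rule sum.cong) (simp_all add: defect_def algebra_simps)
  have 3: "defect N (w # R) = E N (w # R) - E N (w # []) * ?P" by (simp add: defect_def)
  have 4: "merges (fam (hd w)) N w [] = 0" by (simp add: merges_def)
  show ?thesis
    unfolding 1 2 3
    using loop_recursion[OF N w R] loop_recursion[OF N w, of "[]"]
    unfolding 4 diff_divide_distrib by simp algebra
qed

lemma expandable_config:
  assumes "(\<lambda>N. of_nat N * defect N ws) \<longlonglongrightarrow> 0" "\<And>w. w \<in> set ws \<Longrightarrow> expandable (\<lambda>N. E N [w])"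
  shows "expandable (\<lambda>N. E N ws)"
proof -
  have "expandable (\<lambda>N. \<Prod>w\<leftarrow>ws. E N [w])" by (rule expandable_prod_list) (rule assms(2))
  then obtain a b where "expands (\<lambda>N. \<Prod>w\<leftarrow>ws. E N [w]) a b" unfolding expandable_def by blast
  from expands_perturb[OF this assms(1)[unfolded defect_def]] show ?thesis
    unfolding expandable_def by blast
qed

lemma null_scaled_mult:
  fixes a f g :: "nat \<Rightarrow> complex"
  assumes "(\<lambda>N. a N * f N) \<longlonglongrightarrow> 0" "dominated (\<lambda>_. 1) g"
  shows "(\<lambda>N. a N * (f N * g N)) \<longlonglongrightarrow> 0"
  using null_mult_Bseq[OF assms(1), of g] assms(2) Bseq_iff_dominated by (simp add: mult.assoc)

text \<open>The weight a is 1 in a first pass, where boundedness supplies the hypothesis prev, and N in a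
  second one, where the first pass does.\<close>
lemma defect_null_step:
  fixes a :: "nat \<Rightarrow> complex"
  assumes A: "\<forall>b\<in>A. ok b" "tp ` A \<subseteq> A"
    and IH: "\<And>ws. okcfg ws \<Longrightarrow> cfg_len ws < L \<Longrightarrow> (\<lambda>N. of_nat N * defect N ws) \<longlonglongrightarrow> 0"
    and IHe: "\<And>w. w \<noteq> [] \<Longrightarrow> okw w \<Longrightarrow> length w < L \<Longrightarrow> expandable (\<lambda>N. E N [w])"
    and bd: "\<And>x. x \<in> configs A L \<Longrightarrow> dominated (\<lambda>_. 1) (\<lambda>N. E N x)"
    and a: "\<And>f. (\<lambda>N. of_nat N * f N) \<longlonglongrightarrow> 0 \<Longrightarrow> (\<lambda>N. a N * f N) \<longlonglongrightarrow> 0"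
    and a2: "(\<lambda>N. a N / (of_nat N)\<^sup>2) \<longlonglongrightarrow> 0"
    and prev: "\<And>x. x \<in> configs A L \<Longrightarrow> (\<lambda>N. a N / of_nat N * defect N x) \<longlonglongrightarrow> 0"
    and ws: "ws \<in> configs A L"
  shows "(\<lambda>N. a N * defect N ws) \<longlonglongrightarrow> 0"
  using ws
proof (induction "L - length ws" arbitrary: ws rule: less_induct)
  case less
  from less.prems A(1) show ?case
  proof (cases rule: config_cases)
    case (pure bs)
    have ok: "\<forall>b\<in>set bs. ok b" using pure A by auto
    have "defect N ws = E N (map (\<lambda>b. [b]) bs) - (\<Prod>b\<leftarrow>bs. E N [[b]])" for N
      by (simp add: defect_def pure(1) comp_def)
    then have "(\<lambda>N. of_nat N * defect N ws) \<longlonglongrightarrow> 0"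
      using base[OF ok] by (simp only:)
    then show ?thesis by (rule a)
  next
    case (shorter ws')
    have "(\<lambda>N. a N * defect N ws') \<longlonglongrightarrow> 0" by (intro a IH shorter)
    then show ?thesis
      by (rule Lim_transform_eventually) (rule eventually_pos_nat, simp add: shorter)
  next
    case (loopable w R)
    note cfg = configs_okcfg[OF loopable(2) A(1)]
    have ok: "\<forall>v\<in>set R. okw v" using cfg by simp
    have len: "length w + cfg_len R = L" using loopable(2) by (simp add: configs_def)
    show ?thesis
    proof (cases "R = []")
      case True
      then have "eventually (\<lambda>N. a N * defect N ws = 0) sequentially"
        by (intro eventually_pos_nat) (simp add: loopable defect_single)
      then show ?thesis by (rule tendsto_eventually)
    next
      case False
      \<comment> \<open>A second word makes \<open>w\<close> and each word of \<open>R\<close>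
        shorter than \<open>L\<close>, so the induction on the total length supplies their
        expansions and the defects of the two halves of \<open>w\<close>.\<close>
      have "cfg_len R > 0" using False cfg by (cases R) auto
      then have lw: "length w < L" using len by simp
      have "w \<noteq> []" using loopable(1) by (simp add: loopable_def)
      then have lR: "length v < L" if "v \<in> set R" for v
        using cfg_len_member[OF that] len by (cases w) auto
      have PR: "dominated (\<lambda>_. 1) (\<lambda>N. \<Prod>v\<leftarrow>R. E N [v])"
        by (intro expandable_dominated expandable_prod_list IHe lR) (use cfg in auto)
      have rank: "L - length (take p w # drop p w # R) < L - length ws" if "p \<in> {1..<length w}" for p
      proof -
        have "take p w # drop p w # R \<in> configs A L"
          by (rule configs_split[OF loopable(2) that A(2)])
        then have "length (take p w # drop p w # R) \<le> L"
          using length_le_cfg_len unfolding configs_def by blast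
        then show ?thesis using loopable(3) by simp
      qed
      have uv: "(\<lambda>N. a N * defect N [take p w, drop p w]) \<longlonglongrightarrow> 0" if p: "p \<in> {1..<length w}" for p
      proof (rule a, rule IH)
        show "okcfg [take p w, drop p w]"
          using cfg p by (auto dest: in_set_takeD in_set_dropD)
        show "cfg_len [take p w, drop p w] < L" using lw by simp
      qed
      \<comment> \<open>Boundedness of the merged expectations suffices: even for the weight N the
        factor \<open>a N / (of_nat N)\<^sup>2\<close> tends to 0.\<close>
      have m: "(\<lambda>N. a N / (of_nat N)\<^sup>2 * merges (fam (hd w)) N w R) \<longlonglongrightarrow> 0"
        by (intro null_mult_Bseq a2)
           (simp add: Bseq_iff_dominated dominated_merges[OF loopable(2) A(2) bd])
      have "(\<lambda>N. (\<Sum>p\<in>{1..<length w}. jump w p * (a N * defect N (take p w # drop p w # R)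
            - a N * (defect N [take p w, drop p w] * (\<Prod>v\<leftarrow>R. E N [v]))))
          + (a N / of_nat N * defect N (w # R)
            - (\<Sum>p\<in>{1..<length w}. jump w p * (a N / of_nat N * defect N ((take p w @ tpw (drop p w)) # R))))
          - a N / (of_nat N)\<^sup>2 * merges (fam (hd w)) N w R)
        \<longlonglongrightarrow> (\<Sum>p\<in>{1..<length w}. jump w p * (0 - 0)) + (0 - (\<Sum>p\<in>{1..<length w}. jump w p * 0)) - 0"
        by (intro tendsto_add tendsto_diff tendsto_sum tendsto_mult tendsto_const m null_scaled_mult uv PR prev
            less.hyps rank configs_split[OF loopable(2) _ A(2)] loopable(2))
      then have lim: "(\<lambda>N. (\<Sum>p\<in>{1..<length w}. jump w p * (a N * defect N (take p w # drop p w # R)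
            - a N * (defect N [take p w, drop p w] * (\<Prod>v\<leftarrow>R. E N [v]))))
          + (a N / of_nat N * defect N (w # R)
            - (\<Sum>p\<in>{1..<length w}. jump w p * (a N / of_nat N * defect N ((take p w @ tpw (drop p w)) # R))))
          - a N / (of_nat N)\<^sup>2 * merges (fam (hd w)) N w R) \<longlonglongrightarrow> 0" by simp
      show ?thesis
      proof (rule Lim_transform_eventually[OF lim], rule eventually_pos_nat)
        fix N :: nat assume N: "N > 0"
        show "(\<Sum>p\<in>{1..<length w}. jump w p * (a N * defect N (take p w # drop p w # R)
            - a N * (defect N [take p w, drop p w] * (\<Prod>v\<leftarrow>R. E N [v]))))
          + (a N / of_nat N * defect N (w # R)
            - (\<Sum>p\<in>{1..<length w}. jump w p * (a N / of_nat N * defect N ((take p w @ tpw (drop p w)) # R))))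
          - a N / (of_nat N)\<^sup>2 * merges (fam (hd w)) N w R = a N * defect N ws"
        proof -
          have 1: "(\<Sum>p\<in>{1..<length w}. jump w p * (a N * defect N (take p w # drop p w # R)
              - a N * (defect N [take p w, drop p w] * (\<Prod>v\<leftarrow>R. E N [v]))))
            = a N * (\<Sum>p\<in>{1..<length w}. jump w p * (defect N (take p w # drop p w # R)
              - defect N [take p w, drop p w] * (\<Prod>v\<leftarrow>R. E N [v])))"
            unfolding sum_distrib_left by (rule sum.cong) (simp_all add: algebra_simps)
          have 2: "(\<Sum>p\<in>{1..<length w}. jump w p * (a N / of_nat N * defect N ((take p w @ tpw (drop p w)) # R)))
            = a N / of_nat N * (\<Sum>p\<in>{1..<length w}. jump w p * defect N ((take p w @ tpw (drop p w)) # R))"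
            unfolding sum_distrib_left by (rule sum.cong) (simp_all add: algebra_simps)
          show ?thesis
            unfolding loopable(5)[OF N] 1 2
            using arg_cong[OF defect_recursion[OF N loopable(1) ok], of "\<lambda>x. a N * x"]
            by (simp add: diff_divide_distrib right_diff_distrib distrib_left)
        qed
      qed
    qed
  qed
qed

text \<open>The loop equation is read twice. Bounded transposed terms divided by N vanish, which
  gives convergence of every word of length \<open>L\<close>; hence the transposed terms converge
  too, and divided by N they contribute a genuine first-order coefficient.\<close>

lemma expandable_step:
  assumes A: "\<forall>b\<in>A. ok b" "tp ` A \<subseteq> A"
    and IHe: "\<And>w. w \<noteq> [] \<Longrightarrow> okw w \<Longrightarrow> length w < L \<Longrightarrow> expandable (\<lambda>N. E N [w])"
    and bd: "\<And>x. x \<in> configs A L \<Longrightarrow> dominated (\<lambda>_. 1) (\<lambda>N. E N x)"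
    and fac: "\<And>x. x \<in> configs A L \<Longrightarrow> (\<lambda>N. of_nat N * defect N x) \<longlonglongrightarrow> 0"
    and w: "[w] \<in> configs A L"
  shows "expandable (\<lambda>N. E N [w])"
proof -
  \<comment> \<open>Here \<open>g\<close> collects the proper cuts: by \<open>fac\<close> their two
    halves factorise up to o(1/N), and both halves are shorter words with known expansions.\<close>
  have reduce: "expandable (\<lambda>N. E N [w]) \<or> (\<exists>v g. [v] \<in> configs A L \<and> loopable v \<and>
      (\<forall>N>0. E N [w] = E N [v]) \<and> expandable g \<and>
      (\<forall>N>0. E N [v] = g N + (E N [v] - (\<Sum>p\<in>{1..<length v}. jump v p * E N [take p v @ tpw (drop p v)])) / of_nat N))"
    if w: "[w] \<in> configs A L" for w
    using w A(1)
  proof (cases rule: config_cases)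
    case (pure bs)
    then obtain b where "w = [b]" "ok b" using A by (cases bs) auto
    then show ?thesis using base_expandable by simp
  next
    case (shorter ws')
    \<comment> \<open>The shortened configuration inherits the defect 0 of a single word, so its
      expansion follows from those of its own words.\<close>
    have "expandable (\<lambda>N. E N ws')"
    proof -
      have *: "\<And>v. v \<in> set ws' \<Longrightarrow> expandable (\<lambda>N. E N [v])"
        using shorter(1,2) by (intro IHe) (auto dest: cfg_len_member)
      then have "expandable (\<lambda>N. \<Prod>v\<leftarrow>ws'. E N [v])" by (rule expandable_prod_list)
      moreover have "(\<lambda>N. of_nat N * defect N ws') \<longlonglongrightarrow> 0"
      proof (rule tendsto_eventually, rule eventually_pos_nat)
        show "of_nat N * defect N ws' = 0" if "N > 0" for N
          using shorter(4)[OF that] defect_single by simp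
      qed
      ultimately show ?thesis using expandable_config * by blast
    qed
    then have "expandable (\<lambda>N. E N [w])" by (rule expandable_cong) (rule shorter(3))
    then show ?thesis by simp
  next
    case (loopable v R)
    then have R: "R = []" by simp
    define g where "g N = (\<Sum>p\<in>{1..<length v}. jump v p * E N [take p v, drop p v])" for N
    have lv: "length v = L" "okw v" using loopable(1,2) R by (auto simp: configs_def loopable_def)
    have "expandable (\<lambda>N. E N [take p v, drop p v])" if p: "p \<in> {1..<length v}" for p
    proof (rule expandable_config)
      show "(\<lambda>N. of_nat N * defect N [take p v, drop p v]) \<longlonglongrightarrow> 0"
        using fac configs_split(1)[OF loopable(2) p A(2)] R by simp
      show "expandable (\<lambda>N. E N [u])" if "u \<in> set [take p v, drop p v]" for u
        using that p lv by (intro IHe) (auto dest: in_set_takeD in_set_dropD)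
    qed
    then have "expandable g" unfolding g_def by (rule expandable_lin_comb)
    moreover have "E N [v] = g N + (E N [v] - (\<Sum>p\<in>{1..<length v}. jump v p * E N [take p v @ tpw (drop p v)])) / of_nat N"
      if "N > 0" for N
      using loop_recursion[OF that loopable(1), of "[]"] by (simp add: g_def merges_def)
    ultimately show ?thesis
      using loopable(1,2,4) unfolding R by (intro disjI2 exI[of _ v] exI[of _ g]) simp
  qed
  \<comment> \<open>First reading: existence of the limits only, but for all words of this length
    and alphabet, so that it covers the transposed words of the second reading.\<close>
  have conv: "\<exists>l. (\<lambda>N. E N [w]) \<longlonglongrightarrow> l" if w: "[w] \<in> configs A L" for w
    using reduce[OF w]
  proof (elim disjE exE conjE)
    assume "expandable (\<lambda>N. E N [w])"
    then show ?thesis unfolding expandable_def using expands_tendsto by blast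
  next
    fix v g assume v: "[v] \<in> configs A L" "loopable v" "\<forall>N>0. E N [w] = E N [v]" "expandable g"
      "\<forall>N>0. E N [v] = g N + (E N [v] - (\<Sum>p\<in>{1..<length v}. jump v p * E N [take p v @ tpw (drop p v)])) / of_nat N"
    define f where "f N = E N [v] - (\<Sum>p\<in>{1..<length v}. jump v p * E N [take p v @ tpw (drop p v)])" for N
    have "Bseq f" unfolding Bseq_iff_dominated f_def
      by (intro dominated_diff dominated_sum dominated_mult_const bd v configs_split(2)[OF v(1) _ A(2)])
    then have "(\<lambda>N. 1 / of_nat N * f N) \<longlonglongrightarrow> 0" by (rule null_mult_Bseq[OF tendsto_inverse_nat])
    moreover obtain l where "g \<longlonglongrightarrow> l" using v(4) expands_tendsto unfolding expandable_def by blast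
    ultimately have l: "(\<lambda>N. g N + 1 / of_nat N * f N) \<longlonglongrightarrow> l" using tendsto_add by fastforce
    have "(\<lambda>N. E N [w]) \<longlonglongrightarrow> l"
    proof (rule Lim_transform_eventually[OF l], rule eventually_pos_nat)
      show "g N + 1 / of_nat N * f N = E N [w]" if "N > 0" for N
        using v(3,5) that unfolding f_def by simp
    qed
    then show ?thesis by blast
  qed
  from reduce[OF w] show ?thesis
  proof (elim disjE exE conjE)
    fix v g assume v: "[v] \<in> configs A L" "loopable v" "\<forall>N>0. E N [w] = E N [v]" "expandable g"
      "\<forall>N>0. E N [v] = g N + (E N [v] - (\<Sum>p\<in>{1..<length v}. jump v p * E N [take p v @ tpw (drop p v)])) / of_nat N"
    define f where "f N = E N [v] - (\<Sum>p\<in>{1..<length v}. jump v p * E N [take p v @ tpw (drop p v)])" for N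
    obtain l0 where l0: "(\<lambda>N. E N [v]) \<longlonglongrightarrow> l0" using conv v(1) by blast
    have "\<forall>p. \<exists>l. p \<in> {1..<length v} \<longrightarrow> (\<lambda>N. E N [take p v @ tpw (drop p v)]) \<longlonglongrightarrow> l"
      using conv configs_split(2)[OF v(1) _ A(2)] by blast
    then obtain l where l: "\<And>p. p \<in> {1..<length v} \<Longrightarrow> (\<lambda>N. E N [take p v @ tpw (drop p v)]) \<longlonglongrightarrow> l p"
      by metis
    have "f \<longlonglongrightarrow> l0 - (\<Sum>p\<in>{1..<length v}. jump v p * l p)"
      unfolding f_def by (intro tendsto_diff tendsto_sum tendsto_mult tendsto_const l0 l)
    then have "expands (\<lambda>N. f N / of_nat N) 0 (l0 - (\<Sum>p\<in>{1..<length v}. jump v p * l p))"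
      by (rule expands_over_N)
    then have "expandable (\<lambda>N. g N + f N / of_nat N)"
      using v(4) by (intro expandable_add) (auto simp: expandable_def)
    then show ?thesis by (rule expandable_cong) (use v f_def in simp)
  qed
qed

text \<open>The two claims need each other: factorisation at length \<open>L\<close> uses expansions
  of shorter words, and the expansion of a word of length \<open>L\<close> uses factorisation of its
  two-word cuts, again of total length \<open>L\<close>.\<close>

theorem asymptotics:
  "(okcfg ws \<longrightarrow> cfg_len ws = L \<longrightarrow> (\<lambda>N. of_nat N * defect N ws) \<longlonglongrightarrow> 0) \<and>
   (w \<noteq> [] \<longrightarrow> okw w \<longrightarrow> length w = L \<longrightarrow> expandable (\<lambda>N. E N [w]))"
proof (induction L arbitrary: ws w rule: less_induct)
  case (less L)
  have IH: "(\<lambda>N. of_nat N * defect N ws) \<longlonglongrightarrow> 0" if "okcfg ws" "cfg_len ws < L" for ws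
    by (rule mp[OF mp[OF conjunct1[OF less[OF that(2)]] that(1)] refl])
  have IHe: "expandable (\<lambda>N. E N [w])" if "w \<noteq> []" "okw w" "length w < L" for w
    by (rule mp[OF mp[OF mp[OF conjunct2[OF less[OF that(3)]] that(1)] that(2)] refl])
  have IHb: "dominated (\<lambda>_. 1) (\<lambda>N. E N ws)" if "okcfg ws" "cfg_len ws < L" for ws
  proof (rule expandable_dominated, rule expandable_config)
    show "expandable (\<lambda>N. E N [w])" if "w \<in> set ws" for w
      using that \<open>okcfg ws\<close> \<open>cfg_len ws < L\<close> cfg_len_member[OF that] by (intro IHe) auto
  qed (rule IH[OF that])
  have step: "(\<lambda>N. of_nat N * defect N ws) \<longlonglongrightarrow> 0 \<and> (\<forall>w. ws = [w] \<longrightarrow> expandable (\<lambda>N. E N [w]))"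
    if ok: "okcfg ws" and L: "cfg_len ws = L" for ws
  proof -
    define B where "B = (\<Union>w\<in>set ws. set w)"
    \<comment> \<open>The letters occurring in \<open>ws\<close> and their transposes: a finite
      alphabet that the recursion never leaves.\<close>
    define A where "A = B \<union> tp ` B"
    have A: "finite A" "\<forall>b\<in>A. ok b" "tp ` A \<subseteq> A"
      using ok by (auto simp: A_def B_def intro: ok_tp)
    have ws: "ws \<in> configs A L" using ok L by (auto simp: configs_def A_def B_def)
    have bd: "dominated (\<lambda>_. 1) (\<lambda>N. E N x)" if "x \<in> configs A L" for x
      by (rule configs_bounded[OF A IHb that])
    \<comment> \<open>A configuration of at most one word has no defect; with two or more words each
      is shorter than \<open>L\<close>, so the product of their traces is bounded by the induction
      hypothesis.\<close>
    have bdd: "dominated (\<lambda>_. 1) (\<lambda>N. defect N x)" if "x \<in> configs A L" for x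
    proof (cases "length x \<le> 1")
      case True
      then have "defect N x = 0" if "N > 0" for N
        using that defect_single by (cases x) (auto simp: defect_def E_empty)
      then show ?thesis by (intro dominatedI[of 0]) auto
    next
      case False
      have "length w < L" if w: "w \<in> set x" for w
      proof -
        obtain xs ys where x: "x = xs @ w # ys" using split_list[OF w] by blast
        have "xs @ ys \<noteq> []" using False x by auto
        moreover have "\<forall>y\<in>set (xs @ ys). y \<noteq> []" "cfg_len x = L"
          using \<open>x \<in> configs A L\<close> x by (auto simp: configs_def)
        ultimately have "cfg_len (xs @ ys) > 0" by (cases "xs @ ys") (auto simp del: cfg_len_simps(3))
        then show ?thesis using \<open>cfg_len x = L\<close> x by auto
      qed
      then have "expandable (\<lambda>N. \<Prod>w\<leftarrow>x. E N [w])"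
        by (intro expandable_prod_list IHe) (use configs_okcfg[OF \<open>x \<in> configs A L\<close> A(2)] in auto)
      then show ?thesis unfolding defect_def
        by (intro dominated_diff bd that expandable_dominated)
    qed
    have f0: "(\<lambda>N. 1 * defect N x) \<longlonglongrightarrow> 0" if "x \<in> configs A L" for x
    proof (rule defect_null_step[OF A(2,3) IH IHe bd _ _ _ that])
      show "(\<lambda>N. 1 * f N) \<longlonglongrightarrow> 0" if "(\<lambda>N. of_nat N * f N) \<longlonglongrightarrow> 0" for f :: "nat \<Rightarrow> complex"
        using null_of_scaled_null[OF that] by simp
      show "(\<lambda>N. 1 / (of_nat N)\<^sup>2 :: complex) \<longlonglongrightarrow> 0"
        using tendsto_mult[OF tendsto_inverse_nat tendsto_inverse_nat] by (simp add: power2_eq_square)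
      show "(\<lambda>N. 1 / of_nat N * defect N x) \<longlonglongrightarrow> 0" if "x \<in> configs A L" for x
        using null_mult_Bseq[OF tendsto_inverse_nat] bdd[OF that] Bseq_iff_dominated by blast
    qed
    have f1: "(\<lambda>N. of_nat N * defect N x) \<longlonglongrightarrow> 0" if "x \<in> configs A L" for x
    proof (rule defect_null_step[OF A(2,3) IH IHe bd _ _ _ that])
      show "(\<lambda>N. of_nat N / (of_nat N)\<^sup>2 :: complex) \<longlonglongrightarrow> 0"
        by (rule Lim_transform_eventually[OF tendsto_inverse_nat])
           (rule eventually_pos_nat, simp add: power2_eq_square)
      show "(\<lambda>N. of_nat N / of_nat N * defect N x) \<longlonglongrightarrow> 0" if "x \<in> configs A L" for x
        using f0[OF that] by (rule Lim_transform_eventually) (rule eventually_pos_nat, simp)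
    qed
    show ?thesis
    proof (intro conjI allI impI)
      show "expandable (\<lambda>N. E N [w])" if "ws = [w]" for w
        by (rule expandable_step[OF A(2,3) IHe bd f1]) (use ws that in auto)
    qed (rule f1[OF ws])
  qed
  show ?case
    using step[of ws] step[of "[w]"] by auto
qed

lemma defect_null: "okcfg ws \<Longrightarrow> (\<lambda>N. of_nat N * defect N ws) \<longlonglongrightarrow> 0"
  using asymptotics by blast

lemma expandable_word: "okw w \<Longrightarrow> expandable (\<lambda>N. E N [w])"
proof (cases "w = []")
  case True
  have "expandable (\<lambda>N. 1)" unfolding expandable_def using expands_const by blast
  then show ?thesis by (rule expandable_cong) (simp add: True E_nil E_empty)
qed (use asymptotics in blast)

subsection \<open>Limits and freeness\<close>

definition t :: "'b list \<Rightarrow> complex" where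
  "t w = lim (\<lambda>N. E N [w])"

definition t' :: "'b list \<Rightarrow> complex" where
  "t' w = lim (\<lambda>N. of_nat N * (E N [w] - t w))"

lemma t_expands: "okw w \<Longrightarrow> expands (\<lambda>N. E N [w]) (t w) (t' w)"
proof -
  assume "okw w"
  from expandable_word[OF this] obtain a b where ab: "expands (\<lambda>N. E N [w]) a b"
    unfolding expandable_def by blast
  have "t w = a" unfolding t_def by (rule limI) (rule expands_tendsto[OF ab])
  moreover from this have "t' w = b" using ab unfolding t'_def expands_def by (simp add: limI)
  ultimately show ?thesis using ab by simp
qed

lemma t_eqI:
  assumes "okw w" "expands (\<lambda>N. E N [w]) a b"
  shows "t w = a" "t' w = b"
  using expands_unique[OF t_expands[OF assms(1)] assms(2)] by auto

lemma t_cong: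
  assumes "okw u" "okw v" "\<And>N. N > 0 \<Longrightarrow> E N [u] = E N [v]"
  shows "t u = t v" "t' u = t' v"
  using t_eqI[OF assms(1) expands_cong[OF t_expands[OF assms(2)] assms(3)]] by auto

lemma t_nil [simp]: "t [] = 1" "t' [] = 0"
proof -
  have "expands (\<lambda>N. E N [[]]) 1 0"
    by (rule expands_cong[OF expands_const]) (simp add: E_nil E_empty)
  then show "t [] = 1" "t' [] = 0" using t_eqI[of "[]"] by auto
qed

lemma t_rot:
  assumes "okw (u @ v)"
  shows "t (u @ v) = t (v @ u)" "t' (u @ v) = t' (v @ u)"
  by (rule t_cong; use assms E_rot in auto)+

lemma t_tpw:
  assumes "okw w"
  shows "t (tpw w) = t w" "t' (tpw w) = t' w"
  by (rule t_cong; use assms E_tp okw_tpw[OF assms] in auto)+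

lemma t_merge:
  assumes "okw (a # b # u)" "fam a = fam b"
  shows "t (a # b # u) = t (mrg a b # u)" "t' (a # b # u) = t' (mrg a b # u)"
  by (rule t_cong; use assms E_merge ok_mrg in auto)+

lemma t_cen:
  assumes "okw (a # u)"
  shows "t (cen a c # u) = t (a # u) - c * t u" "t' (cen a c # u) = t' (a # u) - c * t' u"
proof -
  have "expands (\<lambda>N. E N [a # u] - c * E N [u]) (t (a # u) - c * t u) (t' (a # u) - c * t' u)"
    by (intro expands_diff expands_cmult t_expands) (use assms in auto)
  then have "expands (\<lambda>N. E N [cen a c # u]) (t (a # u) - c * t u) (t' (a # u) - c * t' u)"
    by (rule expands_cong) (use E_cen assms in auto)
  then show "t (cen a c # u) = t (a # u) - c * t u" "t' (cen a c # u) = t' (a # u) - c * t' u"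
    using t_eqI[of "cen a c # u"] assms ok_cen by auto
qed

text \<open>The centring device of free probability: the product of two neighbours of one family is
  its mean plus a centred block of that family, so that alternation and centring are
  restored.\<close>

definition joined :: "'b \<Rightarrow> 'b \<Rightarrow> 'b" where
  "joined x y = cen (mrg x y) (t [x, y])"

lemma joined:
  assumes "okw (x # y # u)" "fam x = fam y"
  shows "t (x # y # u) = t (joined x y # u) + t [x, y] * t u"
    and "t' (x # y # u) = t' (joined x y # u) + t [x, y] * t' u"
    and "t [joined x y] = 0" "ok (joined x y)" "fam (joined x y) = fam x"
proof -
  have ok: "okw (mrg x y # u)" using assms ok_mrg by auto
  show "t (x # y # u) = t (joined x y # u) + t [x, y] * t u"
    "t' (x # y # u) = t' (joined x y # u) + t [x, y] * t' u"
    using t_cen[OF ok] t_merge[OF assms] by (auto simp: joined_def)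
  show "t [joined x y] = 0"
    using t_cen(1)[of "mrg x y" "[]" "t [x, y]"] t_merge(1)[of x y "[]"] assms ok
    by (auto simp: joined_def)
  show "ok (joined x y)" "fam (joined x y) = fam x"
    using ok assms fam_mrg by (auto simp: joined_def ok_cen)
qed

lemma t_expands_pair:
  assumes "okw u" "okw v"
  shows "expands (\<lambda>N. E N [u, v]) (t u * t v) (t' u * t v + t u * t' v)"
proof -
  have *: "expands (\<lambda>N. E N [u] * E N [v]) (t u * t v) (t' u * t v + t u * t' v)"
    by (intro expands_mult t_expands assms)
  \<comment> \<open>Factorisation is available for nonempty words only, and the cuts at the two ends
    of a word produce empty ones.\<close>
  consider "u = []" | "v = []" | "u \<noteq> []" "v \<noteq> []" by blast
  then show ?thesis
  proof cases
    case 1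
    then show ?thesis by (intro expands_cong[OF *]) (simp add: E_nil E_empty)
  next
    case 2
    have "E N [u, []] = E N [[], u]" for N by (rule E_perm) simp
    then show ?thesis using 2 by (intro expands_cong[OF *]) (simp add: E_nil E_empty)
  next
    case 3
    then have "(\<lambda>N. of_nat N * defect N [u, v]) \<longlonglongrightarrow> 0"
      using assms by (intro defect_null) auto
    then show ?thesis by (intro expands_perturb[OF *]) (simp add: defect_def)
  qed
qed

text \<open>With a single word there are no merging terms. The loop equation then says that an
  expandable sequence is 0, and uniqueness of coefficients makes both of its orders vanish; the
  transposed terms, divided by N, appear only in the second.\<close>

lemma loop_limit:
  assumes "okw w" "invt j"
  shows "(\<Sum>i<length w. of_bool (fam (w ! i) = j) *
           (t (take i w) * t (drop i w) - t (take (Suc i) w) * t (drop (Suc i) w))) = 0" (is "?T = 0")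
    and "(\<Sum>i<length w. of_bool (fam (w ! i) = j) *
           ((t' (take i w) * t (drop i w) + t (take i w) * t' (drop i w) - t (take i w @ tpw (drop i w)))
          - (t' (take (Suc i) w) * t (drop (Suc i) w) + t (take (Suc i) w) * t' (drop (Suc i) w)
             - t (take (Suc i) w @ tpw (drop (Suc i) w))))) = 0" (is "?T' = 0")
proof -
  have ok: "okw (take i w)" "okw (drop i w)" "okw (take i w @ tpw (drop i w))" for i
    using assms(1) ok_tp by (auto dest: in_set_takeD in_set_dropD)
  have g: "expands (\<lambda>N. E N [take i w, drop i w] - E N [take i w @ tpw (drop i w)] / of_nat N)
     (t (take i w) * t (drop i w) - 0)
     (t' (take i w) * t (drop i w) + t (take i w) * t' (drop i w) - t (take i w @ tpw (drop i w)))" for i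
    by (intro expands_diff t_expands_pair ok expands_over_N expands_tendsto[OF t_expands])
  let ?f = "\<lambda>N. \<Sum>i<length w. of_bool (fam (w ! i) = j) *
      ((E N [take i w, drop i w] - E N [take i w @ tpw (drop i w)] / of_nat N)
      - (E N [take (Suc i) w, drop (Suc i) w] - E N [take (Suc i) w @ tpw (drop (Suc i) w)] / of_nat N))"
  have "expands ?f (\<Sum>i<length w. of_bool (fam (w ! i) = j) *
      ((t (take i w) * t (drop i w) - 0) - (t (take (Suc i) w) * t (drop (Suc i) w) - 0))) ?T'"
    by (rule expands_sum, rule expands_cmult, rule expands_diff[OF g g])
  then have "expands ?f ?T ?T'" by simp
  moreover have "expands ?f 0 0"
    by (rule expands_cong[OF expands_const]) (use E_loop[OF _ assms(2,1), of _ "[]"] in simp)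
  ultimately show "?T = 0" "?T' = 0" using expands_unique by blast+
qed

section \<open>Vanishing of the limiting trace on alternating centred words\<close>

abbreviation alt :: "'b list \<Rightarrow> bool" where
  "alt w \<equiv> successively (\<lambda>a b. fam a \<noteq> fam b) w"

definition centred :: "'b list \<Rightarrow> bool" where
  "centred w \<longleftrightarrow> (\<forall>b\<in>set w. ok b \<and> t [b] = 0)"

lemma centred_okw: "centred w \<Longrightarrow> okw w"
  by (auto simp: centred_def)

lemma centred_append [simp]: "centred (u @ v) \<longleftrightarrow> centred u \<and> centred v"
  by (auto simp: centred_def)

lemma centred_Cons [simp]: "centred (b # v) \<longleftrightarrow> ok b \<and> t [b] = 0 \<and> centred v"
  by (auto simp: centred_def)

lemma centred_tpw: "centred w \<Longrightarrow> centred (tpw w)"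
  using t_tpw(1)[of "[_]"] ok_tp by (auto simp: centred_def)

lemma alt_tpw: "alt (tpw w) \<longleftrightarrow> alt w"
  by (simp add: successively_map eq_commute)

lemma centred_take_drop: "centred w \<Longrightarrow> centred (take i w) \<and> centred (drop i w)"
  by (metis append_take_drop_id centred_append)

lemma alt_take_drop: "alt w \<Longrightarrow> alt (take i w) \<and> alt (drop i w)"
  by (metis append_take_drop_id successively_append_iff)

lemma loopable_length: "loopable w \<Longrightarrow> length w \<ge> 2"
  by (cases w; cases "tl w") (auto simp: loopable_def)

text \<open>At a proper cut both pieces are shorter alternating centred words, so each product
  vanishes by induction. Only the cut at 0 is left, and it is \<open>t w\<close> itself.\<close>

lemma t_loopable_zero:
  assumes w: "loopable w" "alt w" "centred w"
    and IH: "\<And>v. length v < length w \<Longrightarrow> v \<noteq> [] \<Longrightarrow> alt v \<Longrightarrow> centred v \<Longrightarrow> t v = 0"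
  shows "t w = 0"
proof -
  let ?j = "fam (hd w)"
  have n: "length w \<ge> 2" by (rule loopable_length[OF w(1)])
  have z: "t (take p w) = 0" "t (drop p w) = 0" if "0 < p" "p < length w" for p
    using that alt_take_drop[OF w(2)] centred_take_drop[OF w(3)] by (auto intro!: IH)
  have "of_bool (fam (w ! i) = ?j) *
      (t (take i w) * t (drop i w) - t (take (Suc i) w) * t (drop (Suc i) w)) = (if i = 0 then t w else 0)"
    if i: "i < length w" for i
  proof (cases "i = 0")
    case True
    then show ?thesis using z(1)[of 1] n w(1) by (simp add: hd_conv_nth loopable_def)
  next
    case False
    show ?thesis
    proof (cases "Suc i = length w")
      \<comment> \<open>The cut after the whole word would bring \<open>t w\<close> back with the
        opposite sign, but the last block is not in the family of the first.\<close>
      case True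
      then have "fam (w ! i) \<noteq> ?j" using w(1)
        by (metis diff_Suc_1 last_conv_nth loopable_def)
      then show ?thesis using False by simp
    next
      case F: False
      then show ?thesis using False z(1)[of i] z(1)[of "Suc i"] i by simp
    qed
  qed
  then have "(\<Sum>i<length w. of_bool (fam (w ! i) = ?j) *
      (t (take i w) * t (drop i w) - t (take (Suc i) w) * t (drop (Suc i) w)))
      = (\<Sum>i<length w. if i = 0 then t w else 0)" by (intro sum.cong) auto
  then show ?thesis
    using loop_limit(1)[of w ?j] w n by (simp add: loopable_def centred_okw split: if_splits)
qed

text \<open>Ends of different families cannot both be exceptional. If only the last block is
  invariant, one cyclic step brings it to the front, and alternation puts the new last block in
  another family.\<close>

lemma rotate_to_invariant:
  assumes "alt w" "centred w" "length w \<ge> 2" "fam (hd w) \<noteq> fam (last w)"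
  shows "loopable w \<or> loopable (last w # butlast w)"
proof -
  obtain a m z where w: "w = a # m @ [z]"
    using assms(3) by (cases w; cases "tl w" rule: rev_cases) auto
  have "invt (fam a) \<or> invt (fam z)" using invt[of a z] assms w by auto
  moreover have "fam (last (a # m)) \<noteq> fam z"
    using assms(1) w successively_append_iff[of _ "a # m" "[z]"] by auto
  ultimately show ?thesis using assms w centred_okw[OF assms(2)]
    by (auto simp: loopable_def butlast_append split: if_splits)
qed

lemma alt_rotate:
  assumes "alt w" "w \<noteq> []" "fam (hd w) \<noteq> fam (last w)"
  shows "alt (last w # butlast w)"
proof -
  obtain u z where w: "w = u @ [z]" using assms(2) by (cases w rule: rev_cases) auto
  then have "alt u" using assms(1) by (simp add: successively_append_iff)
  then show ?thesis using assms(3) w by (cases u) auto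
qed

lemma rotate_last:
  assumes "okw w" "w \<noteq> []"
  shows "t (last w # butlast w) = t w" "t' (last w # butlast w) = t' w"
  using t_rot[of "butlast w" "[last w]"] assms by auto

text \<open>Different ends are handled by the loop equation. Equal ends are neighbours on the
  circle: joining them gives a shorter alternating centred word, plus a mean times the inner word,
  and both vanish by induction.\<close>

lemma alt_zero:
  assumes "w \<noteq> []" "alt w" "centred w"
  shows "t w = 0"
  using assms
proof (induction "length w" arbitrary: w rule: less_induct)
  case (less w)
  note ok = centred_okw[OF less.prems(3)]
  show ?case
  proof (cases "length w \<ge> 2")
    case False
    then obtain b where "w = [b]" using less.prems(1) by (cases w; cases "tl w") auto
    then show ?thesis using less.prems by simp
  next
    case True
    then obtain a m z where w: "w = a # m @ [z]"
      by (cases w; cases "tl w" rule: rev_cases) auto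
    show ?thesis
    proof (cases "fam a = fam z")
      case True
      \<comment> \<open>Two adjacent blocks of an alternating word cannot share a family, so equal
        ends force something between them.\<close>
      have m: "m \<noteq> []" using less.prems True w by auto
      have am: "alt m" "fam a \<noteq> fam (hd m)"
        using less.prems(2) m unfolding w by (auto simp: successively_Cons successively_append_iff)
      have okz: "okw (z # a # m)" using ok w by auto
      note j = joined[OF okz True[symmetric]]
      have "t w = t (z # a # m)" using rotate_last(1)[OF ok less.prems(1)] w by (simp add: butlast_append)
      also have "\<dots> = t (joined z a # m) + t [z, a] * t m" by (rule j(1))
      also have "t (joined z a # m) = 0"
        by (rule less.hyps) (use w am j(3-5) less.prems True in \<open>auto simp: successively_Cons\<close>)
      also have "t m = 0" by (rule less.hyps) (use w am m less.prems in auto)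
      finally show ?thesis by simp
    next
      case False
      then have d: "fam (hd w) \<noteq> fam (last w)" using w by simp
      let ?v = "last w # butlast w"
      have lv: "length ?v = length w" using less.prems(1) by simp
      have cv: "centred ?v" using less.prems(3) w by (simp add: butlast_append)
      from rotate_to_invariant[OF less.prems(2,3) True d] show ?thesis
      proof
        assume "loopable w"
        then show ?thesis by (rule t_loopable_zero) (use less in auto)
      next
        assume "loopable ?v"
        then have "t ?v = 0"
          by (rule t_loopable_zero[OF _ alt_rotate[OF less.prems(2,1) d] cv]) (use less.hyps lv in auto)
        then show ?thesis using rotate_last(1)[OF ok less.prems(1)] by simp
      qed
    qed
  qed
qed

lemma t_pair_zero:
  assumes "centred [x, y]" "fam x \<noteq> fam y"
  shows "t [x, y] = 0"
  using alt_zero[of "[x, y]"] assms by simp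

text \<open>The last blocks \<open>x\<close> of \<open>u\<close> and \<open>y\<close> of
  \<open>v\<close> meet as x y^t. Subtracting the mean of this product leaves an alternating centred
  word, of trace 0, so only the factor \<open>t [x, tp y]\<close> times the same expression for
  shorter words survives. A leftover of unequal lengths is itself alternating and centred.\<close>

lemma t_pairing:
  assumes "alt u" "centred u" "alt v" "centred v"
  shows "t (u @ tpw v) = (if length u = length v then \<Prod>l<length u. t [u ! l, tp (v ! l)] else 0)"
  using assms
proof (induction u arbitrary: v rule: rev_induct)
  case Nil
  then show ?case
    using alt_zero[of "tpw v"] centred_tpw[of v] alt_tpw[of v] by (cases "v = []") auto
next
  case (snoc x u)
  show ?case
  proof (cases v rule: rev_cases)
    case Nil
    then show ?thesis using alt_zero[of "u @ [x]"] snoc by simp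
  next
    case (snoc v' y)
    note pr = snoc.prems
    have ctp: "centred [tp y]" using centred_tpw[of "[y]"] pr snoc by simp
    have cv': "centred (tpw v')" "alt (tpw v')"
      using centred_tpw[of v'] pr snoc alt_tpw[of v'] by (auto simp: successively_append_iff)
    have okall: "okw (x # tp y # tpw v' @ u)"
      using centred_okw[of "u @ [x]"] centred_okw[OF ctp] centred_okw[OF cv'(1)] pr by auto
    have rot: "t ((u @ [x]) @ tpw v) = t (x # tp y # tpw v' @ u)"
      using t_rot(1)[of u "x # tp y # tpw v'"] okall snoc by auto
    have prodeq: "(\<Prod>l<length (u @ [x]). t [(u @ [x]) ! l, tp (v ! l)])
       = (\<Prod>l<length u. t [u ! l, tp (v' ! l)]) * t [x, tp y]" if "length u = length v'"
      using that snoc by (auto simp: nth_append intro!: prod.cong)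
    have altu: "alt u" "u \<noteq> [] \<Longrightarrow> fam (last u) \<noteq> fam x"
      using pr(1) by (auto simp: successively_append_iff)
    have altv: "v' \<noteq> [] \<Longrightarrow> fam (last v') \<noteq> fam y"
      using pr(3) snoc by (auto simp: successively_append_iff)
    have hdtp: "v' \<noteq> [] \<Longrightarrow> fam (hd (tpw v')) = fam (last v')"
      by (simp add: hd_map hd_rev)
    show ?thesis
    proof (cases "fam x = fam y")
      case False
      have "alt (u @ [x] @ tp y # tpw v')"
        using False altu altv cv' hdtp by (auto simp: successively_append_iff successively_Cons)
      then have "t (u @ [x] @ tp y # tpw v') = 0"
        using alt_zero[of "u @ [x] @ tp y # tpw v'"] cv' ctp pr by auto
      \<comment> \<open>The right-hand side must vanish as well: for equal lengths this is one of
        its factors.\<close>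
      moreover have "t [x, tp y] = 0"
        by (rule t_pair_zero) (use pr ctp False in auto)
      ultimately show ?thesis using snoc prodeq by auto
    next
      case True
      have fxy: "fam x = fam (tp y)" using True by simp
      note j = joined[OF okall fxy]
      have "alt (u @ joined x (tp y) # tpw v')"
        using True altu altv cv' hdtp j(5) by (auto simp: successively_append_iff successively_Cons)
      then have "t (u @ joined x (tp y) # tpw v') = 0"
        using alt_zero[of "u @ joined x (tp y) # tpw v'"] cv' j(3,4) pr by auto
      moreover have "t (u @ joined x (tp y) # tpw v') = t (joined x (tp y) # tpw v' @ u)"
        using t_rot(1)[of u "joined x (tp y) # tpw v'"] okall j(4) by auto
      moreover have "t (tpw v' @ u) = t (u @ tpw v')"
        using t_rot(1)[of "tpw v'" u] okall by auto
      moreover have "t (u @ tpw v') = (if length u = length v' then \<Prod>l<length u. t [u ! l, tp (v' ! l)] else 0)"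
        by (rule snoc.IH) (use pr snoc altu in \<open>auto simp: successively_append_iff\<close>)
      ultimately have "t ((u @ [x]) @ tpw v) = t [x, tp y] *
          (if length u = length v' then \<Prod>l<length u. t [u ! l, tp (v' ! l)] else 0)"
        using rot j(1) by simp
      then show ?thesis using prodeq snoc by auto
    qed
  qed
qed

text \<open>At proper cuts the terms with \<tau>' carry a vanishing trace of an alternating centred
  piece, and the cut at 0 contributes \<open>t' w\<close>. Of the transposed terms, those at the
  exits from the family vanish and those at its entrances remain.\<close>

lemma t'_loopable:
  assumes w: "loopable w" "alt w" "centred w"
  shows "t' w = (\<Sum>i\<in>{1..<length w}. of_bool (fam (w ! i) = fam (hd w)) * t (take i w @ tpw (drop i w)))"
proof -
  let ?j = "fam (hd w)"
  have n: "length w \<ge> 2" by (rule loopable_length[OF w(1)])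
  have z: "t (take p w) = 0" "t (drop p w) = 0" if "0 < p" "p < length w" for p
    using that alt_take_drop[OF w(2)] centred_take_drop[OF w(3)] by (auto intro!: alt_zero)
  have "w \<noteq> []" using n by auto
  \<comment> \<open>The transposed term of the cut at 0 is the trace of the whole transposed word,
    which also vanishes.\<close>
  then have tw: "t w = 0" "t (tpw w) = 0"
    using alt_zero[OF _ w(2,3)] t_tpw(1)[OF centred_okw[OF w(3)]] by auto
  have last: "fam (w ! i) \<noteq> ?j" if "Suc i = length w" for i
    using w(1) that by (metis diff_Suc_1 last_conv_nth loopable_def)
  \<comment> \<open>After an exit the left piece ends in the family of \<open>hd w\<close>, while
    the transposed right piece begins with the family of \<open>last w\<close>; these differ, so the
    concatenation still alternates.\<close>
  have cut: "t (take (Suc i) w @ tpw (drop (Suc i) w)) = 0" if i: "Suc i < length w" "fam (w ! i) = ?j" for i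
  proof (rule alt_zero)
    have "fam (last (take (Suc i) w)) = ?j" using i by (simp add: take_Suc_conv_app_nth)
    moreover have "fam (hd (tpw (drop (Suc i) w))) = fam (last w)"
      using i by (simp add: hd_map hd_rev)
    ultimately show "alt (take (Suc i) w @ tpw (drop (Suc i) w))"
      unfolding successively_append_iff
      using alt_take_drop[OF w(2), of "Suc i"] alt_tpw[of "drop (Suc i) w"] w(1)
      by (auto simp: loopable_def)
    show "centred (take (Suc i) w @ tpw (drop (Suc i) w))"
      using centred_take_drop[OF w(3), of "Suc i"] centred_tpw by auto
  qed (use n in auto)
  have "of_bool (fam (w ! i) = ?j) *
       ((t' (take i w) * t (drop i w) + t (take i w) * t' (drop i w) - t (take i w @ tpw (drop i w)))
      - (t' (take (Suc i) w) * t (drop (Suc i) w) + t (take (Suc i) w) * t' (drop (Suc i) w)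
         - t (take (Suc i) w @ tpw (drop (Suc i) w))))
      = (if i = 0 then t' w else - (of_bool (fam (w ! i) = ?j) * t (take i w @ tpw (drop i w))))"
    if i: "i < length w" for i
  proof (cases "fam (w ! i) = ?j")
    case True
    then have Si: "Suc i < length w" using last i by (meson Suc_lessI)
    show ?thesis
      using True Si z[of i] z[of "Suc i"] cut[OF Si True] tw by (cases "i = 0") simp_all
  next
    case False
    then have "i \<noteq> 0" using \<open>w \<noteq> []\<close> by (metis hd_conv_nth)
    then show ?thesis using False by simp
  qed
  then have "0 = (\<Sum>i<length w. if i = 0 then t' w else - (of_bool (fam (w ! i) = ?j) * t (take i w @ tpw (drop i w))))"
    using loop_limit(2)[of w ?j] w(1) by (simp add: loopable_def)
  also have "{..<length w} = insert 0 {1..<length w}" using n by auto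
  also have "(\<Sum>i\<in>insert 0 {1..<length w}. if i = 0 then t' w else - (of_bool (fam (w ! i) = ?j) * t (take i w @ tpw (drop i w))))
     = t' w + (\<Sum>i\<in>{1..<length w}. - (of_bool (fam (w ! i) = ?j) * t (take i w @ tpw (drop i w))))"
    by (subst sum.insert) (auto intro!: sum.cong)
  finally show ?thesis unfolding sum_negf by simp
qed

text \<open>On the circle formed by the word, each block is paired with the transpose of the
  antipodal one; an odd number of blocks admits no such pairing.\<close>

definition pairprod :: "'b list \<Rightarrow> complex" where
  "pairprod w = (if even (length w)
     then \<Prod>l<length w div 2. t [w ! l, tp (w ! (length w div 2 + l))] else 0)"

text \<open>By \<open>t_pairing\<close> a transposed cut contributes only if both pieces have equal
  length, which singles out the middle cut.\<close>

lemma t'_loopable_pairprod: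
  assumes w: "loopable w" "alt w" "centred w"
  shows "t' w = pairprod w"
proof -
  let ?j = "fam (hd w)" and ?n = "length w" and ?k = "length w div 2"
  have n: "?n \<ge> 2" by (rule loopable_length[OF w(1)])
  then have "w \<noteq> []" by auto
  have *: "t (take i w @ tpw (drop i w)) = (if 2 * i = ?n then \<Prod>l<i. t [w ! l, tp (w ! (i + l))] else 0)"
    if "i \<in> {1..<?n}" for i
  proof -
    have "t (take i w @ tpw (drop i w)) = (if length (take i w) = length (drop i w)
        then \<Prod>l<length (take i w). t [take i w ! l, tp (drop i w ! l)] else 0)"
      by (rule t_pairing) (use alt_take_drop[OF w(2)] centred_take_drop[OF w(3)] in auto)
    moreover have "length (take i w) = length (drop i w) \<longleftrightarrow> 2 * i = ?n" "length (take i w) = i"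
      using that by auto
    ultimately show ?thesis using that by (auto intro!: prod.cong)
  qed
  have "t' w = (\<Sum>i\<in>{1..<?n}. if 2 * i = ?n then of_bool (fam (w ! i) = ?j) * (\<Prod>l<i. t [w ! l, tp (w ! (i + l))]) else 0)"
    unfolding t'_loopable[OF w] by (rule sum.cong) (use * in auto)
  also have "\<dots> = pairprod w"
  proof (cases "even ?n")
    case False
    then have "2 * i \<noteq> ?n" for i by (metis dvd_triv_left)
    then show ?thesis using False by (simp add: pairprod_def)
  next
    case True
    then have "2 * i = ?n \<longleftrightarrow> i = ?k" for i by auto
    moreover have "?k \<in> {1..<?n}" using n by auto
    ultimately have "(\<Sum>i\<in>{1..<?n}. if 2 * i = ?n then of_bool (fam (w ! i) = ?j) * (\<Prod>l<i. t [w ! l, tp (w ! (i + l))]) else 0)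
       = of_bool (fam (w ! ?k) = ?j) * (\<Prod>l<?k. t [w ! l, tp (w ! (?k + l))])"
      by (simp only: sum.delta finite_atLeastLessThan if_True)
    also have "\<dots> = (\<Prod>l<?k. t [w ! l, tp (w ! (?k + l))])"
    proof (cases "fam (w ! ?k) = ?j")
      case False
      have "w ! ?k \<in> set w" "w ! 0 \<in> set w" using n by (auto intro!: nth_mem)
      then have "ok (w ! 0)" "t [w ! 0] = 0" "centred [tp (w ! ?k)]"
        using w(3) centred_tpw[of "[w ! ?k]"] by (auto simp: centred_def)
      then have "t [w ! 0, tp (w ! (?k + 0))] = 0"
        using False \<open>w \<noteq> []\<close> by (intro t_pair_zero) (auto simp: hd_conv_nth)
      then have "(\<Prod>l<?k. t [w ! l, tp (w ! (?k + l))]) = 0"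
        using n by (intro prod_zero) (auto intro!: bexI[of _ 0])
      then show ?thesis by simp
    qed simp
    finally show ?thesis using True by (simp add: pairprod_def)
  qed
  finally show ?thesis .
qed

lemma t_pair_swap: "ok x \<Longrightarrow> ok y \<Longrightarrow> t [x, tp y] = t [y, tp x]"
  using t_tpw(1)[of "[x, tp y]"] ok_tp by simp

text \<open>A rotation by one block permutes the antipodal pairs and exchanges the two members of
  one of them, which is harmless since \<open>t [x, tp y] = t [y, tp x]\<close>. So the loopable
  case settles all words with ends of different families.\<close>

theorem t'_cyclic:
  assumes w: "alt w" "centred w" "length w \<ge> 2" "fam (hd w) \<noteq> fam (last w)"
  shows "t' w = pairprod w"
proof -
  have ne: "w \<noteq> []" using w by auto
  let ?v = "last w # butlast w"
  note ok = centred_okw[OF w(2)]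
  from rotate_to_invariant[OF w] show ?thesis
  proof
    assume "loopable w"
    then show ?thesis by (rule t'_loopable_pairprod[OF _ w(1,2)])
  next
    assume lv: "loopable ?v"
    have cv: "centred ?v" using w(2) ne by (metis append_butlast_last_id centred_append centred_Cons)
    have "t' w = t' ?v" using rotate_last(2)[OF ok ne] by simp
    also have "\<dots> = pairprod ?v" by (rule t'_loopable_pairprod[OF lv alt_rotate[OF w(1) ne w(4)] cv])
    also have "\<dots> = pairprod w"
    proof (cases "even (length w)")
      case True
      then obtain k where k: "length w = 2 * Suc k" using w(3)
        by (metis One_nat_def Suc_1 dvdE mult_is_0 not0_implies_Suc not_numeral_le_zero)
      have len: "length ?v = 2 * Suc k" using k ne by simp
      have "pairprod ?v = (\<Prod>l<Suc k. t [?v ! l, tp (?v ! (Suc k + l))])"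
        unfolding pairprod_def len by simp
      also have "\<dots> = t [last w, tp (w ! k)] * (\<Prod>l<k. t [w ! l, tp (w ! (Suc k + l))])"
        unfolding prod.lessThan_Suc_shift using k by (auto simp: nth_butlast intro!: prod.cong)
      also have "t [last w, tp (w ! k)] = t [w ! k, tp (w ! (Suc k + k))]"
      proof -
        have "last w = w ! (Suc k + k)" using ne k by (simp add: last_conv_nth mult_2)
        then show ?thesis using ok k by (simp add: t_pair_swap)
      qed
      also have "t [w ! k, tp (w ! (Suc k + k))] * (\<Prod>l<k. t [w ! l, tp (w ! (Suc k + l))])
          = (\<Prod>l<Suc k. t [w ! l, tp (w ! (Suc k + l))])" by simp
      also have "\<dots> = pairprod w" unfolding pairprod_def k by simp
      finally show ?thesis .
    qed (use ne in \<open>simp add: pairprod_def\<close>)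
    finally show ?thesis .
  qed
qed

text \<open>The antipodal pairing of two blocks pairs blocks of different families.\<close>

lemma t'_pair_zero:
  assumes "alt [x, y]" "centred [x, y]"
  shows "t' [x, y] = 0"
proof -
  have "centred [tp y]" using centred_tpw[of "[y]"] assms by simp
  then have "t [x, tp y] = 0" using assms by (intro t_pair_zero) auto
  then show ?thesis using t'_cyclic[of "[x, y]"] assms by (simp add: pairprod_def)
qed

text \<open>For ends of different families \<open>t [hd w, last w]\<close> vanishes and the cyclic
  formula applies. For equal families, joining the ends leaves an odd cyclic word, whose antipodal
  product is 0, and the product on the right-hand side vanishes for parity reasons of
  alternation.\<close>

theorem t'_even:
  assumes w: "alt w" "centred w" "length w = 2 * k" "k \<ge> 2"
  shows "t' w = t [hd w, last w] * t' (butlast (tl w)) + (\<Prod>l<k. t [w ! l, tp (w ! (k + l))])"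
proof -
  obtain a m z where wm: "w = a # m @ [z]"
    using assms(3,4) by (cases w; cases "tl w" rule: rev_cases) auto
  have P: "pairprod w = (\<Prod>l<k. t [w ! l, tp (w ! (k + l))])" by (simp add: pairprod_def w(3))
  show ?thesis
  proof (cases "fam a = fam z")
    case False
    then have "t [a, z] = 0" using w(2) wm by (intro t_pair_zero) auto
    then show ?thesis using t'_cyclic[of w] P w False wm by simp
  next
    case True
    have m: "m \<noteq> []" using w wm by auto
    have am: "alt m" "fam a \<noteq> fam (hd m)" "fam z \<noteq> fam (last m)"
      using w(1) m unfolding wm by (auto simp: successively_Cons successively_append_iff)
    have ok: "okw (z # a # m)" using centred_okw[OF w(2)] wm by auto
    note j = joined[OF ok True[symmetric]]
    have "t' w = t' (z # a # m)"
      using rotate_last(2)[OF centred_okw[OF w(2)]] wm by (simp add: butlast_append)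
    also have "\<dots> = t' (joined z a # m) + t [z, a] * t' m" by (rule j(2))
    also have "t' (joined z a # m) = pairprod (joined z a # m)"
      by (rule t'_cyclic) (use am m j(3-5) True w wm in \<open>auto simp: successively_Cons Suc_le_eq\<close>)
    also have "\<dots> = 0"
    proof -
      have "length (joined z a # m) = 2 * k - 1" using w(3) wm by simp
      moreover have "odd (2 * k - 1)" using w(4) by simp
      ultimately show ?thesis unfolding pairprod_def by simp
    qed
    finally have t': "t' w = t [z, a] * t' m" by simp
    have "t [z, a] = t [a, z]" using t_rot(1)[of "[z]" "[a]"] ok by simp
    moreover have "(\<Prod>l<k. t [w ! l, tp (w ! (k + l))]) = 0"
    proof -
      have c: "centred [w ! i]" "centred [tp (w ! i)]" if "i < 2 * k" for i
        using that w(2,3) centred_tpw[of "[w ! i]"] by (auto simp: centred_def)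
      have adj: "fam (w ! (k - 1)) \<noteq> fam (w ! k)"
      proof -
        have "Suc (k - 1) < length w" using w(3,4) by simp
        then have "fam (w ! (k - 1)) \<noteq> fam (w ! Suc (k - 1))"
          using w(1) unfolding successively_conv_nth by blast
        then show ?thesis using w(4) by simp
      qed
      have ends: "fam (w ! 0) = fam (w ! (2 * k - 1))"
      proof -
        have "w \<noteq> []" using wm by simp
        then have "w ! 0 = hd w" "w ! (2 * k - 1) = last w"
          using hd_conv_nth[of w] last_conv_nth[of w] w(3) by simp_all
        then show ?thesis using True wm by simp
      qed
      \<comment> \<open>The outer blocks share a family while the two middle blocks do not, so the
        first and the last pair cannot both match.\<close>
      have "fam (w ! 0) \<noteq> fam (w ! k) \<or> fam (w ! (k - 1)) \<noteq> fam (w ! (2 * k - 1))"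
        using adj ends by auto
      then have "t [w ! 0, tp (w ! (k + 0))] = 0 \<or> t [w ! (k - 1), tp (w ! (k + (k - 1)))] = 0"
      proof
        assume "fam (w ! 0) \<noteq> fam (w ! k)"
        then show ?thesis using c[of 0] c[of k] w(4) by (intro disjI1 t_pair_zero) auto
      next
        assume "fam (w ! (k - 1)) \<noteq> fam (w ! (2 * k - 1))"
        moreover have "2 * k - 1 = k + (k - 1)" using w(4) by simp
        ultimately show ?thesis using c[of "k - 1"] c[of "k + (k - 1)"] w(4)
          by (intro disjI2 t_pair_zero) auto
      qed
      then show ?thesis using w(4) by (intro prod_zero) (auto intro: bexI[of _ 0] bexI[of _ "k - 1"])
    qed
    ultimately show ?thesis using t' wm by (simp add: butlast_append)
  qed
qed

text \<open>The roles are reversed against even length. Different ends make every term 0, as an odd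
  word has no antipodal pairing. For equal ends the joined block turns the word into an even cyclic
  one; the partner of the joined block is the middle block of \<open>w\<close>, which gives the
  three-fold trace.\<close>

theorem t'_odd:
  assumes w: "alt w" "centred w" "length w = 2 * k - 1" "k \<ge> 2"
  shows "t' w = t [hd w, last w] * t' (butlast (tl w)) +
     t [hd w, tp (w ! (k - 1)), last w] * (\<Prod>l\<in>{1..k - 2}. t [w ! l, tp (w ! (k - 1 + l))])"
proof -
  obtain a m z where wm: "w = a # m @ [z]"
    using assms(3,4) by (cases w; cases "tl w" rule: rev_cases) auto
  have m: "m \<noteq> []" using w wm by auto
  define y where "y = w ! (k - 1)"
  have "y \<in> set w" unfolding y_def using w(3,4) by (intro nth_mem) auto
  then have cy: "centred [tp y]" "ok y" using w(2) centred_tpw[of "[y]"] by (auto simp: centred_def)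
  have caz: "centred [a, z]" using w wm by simp
  have ok3: "okw [z, a, tp y]" using centred_okw[OF caz] centred_okw[OF cy(1)] by auto
  have rot3: "t [a, tp y, z] = t [z, a, tp y]" using t_rot(1)[of "[a, tp y]" "[z]"] ok3 by auto
  have swap: "t [z, a] = t [a, z]" using t_rot(1)[of "[z]" "[a]"] ok3 by simp
  show ?thesis
  proof (cases "fam a = fam z")
    case False
    then have "t [a, z] = 0" using caz by (intro t_pair_zero) auto
    moreover have "t' w = 0"
    proof -
      have "odd (length w)" "length w \<ge> 2" using w(3,4) by auto
      then show ?thesis using t'_cyclic[OF w(1,2)] False wm unfolding pairprod_def by simp
    qed
    \<comment> \<open>The middle block can share its family with at most one of the ends; joining it
      there leaves two centred blocks of different families.\<close>
    moreover have "t [a, tp y, z] = 0"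
    proof -
      consider "fam y = fam a" | "fam y = fam z" | "fam y \<noteq> fam a" "fam y \<noteq> fam z" by blast
      then show ?thesis
      proof cases
        case 1
        note j = joined[of a "tp y" "[z]"]
        have "t [joined a (tp y), z] = 0"
          by (rule t_pair_zero) (use j ok3 1 caz False in auto)
        then show ?thesis using j(1) ok3 1 caz by auto
      next
        case 2
        note j = joined[of "tp y" z "[a]"]
        have "t [a, tp y, z] = t [tp y, z, a]" using t_rot(1)[of "[a]" "[tp y, z]"] ok3 by auto
        moreover have "t [joined (tp y) z, a] = 0"
          by (rule t_pair_zero) (use j ok3 2 caz False in auto)
        ultimately show ?thesis using j(1) ok3 2 caz by auto
      next
        case 3
        then show ?thesis using alt_zero[of "[a, tp y, z]"] caz cy by auto
      qed
    qed
    ultimately show ?thesis using wm y_def by simp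
  next
    case True
    have am: "alt m" "fam a \<noteq> fam (hd m)" "fam z \<noteq> fam (last m)"
      using w(1) m unfolding wm by (auto simp: successively_Cons successively_append_iff)
    have ok: "okw (z # a # m)" using centred_okw[OF w(2)] wm by auto
    note j = joined[OF ok True[symmetric]]
    let ?c = "joined z a"
    have "t' w = t' (z # a # m)"
      using rotate_last(2)[OF centred_okw[OF w(2)]] wm by (simp add: butlast_append)
    also have "\<dots> = t' (?c # m) + t [z, a] * t' m" by (rule j(2))
    also have "t' (?c # m) = pairprod (?c # m)"
      by (rule t'_cyclic) (use am m j(3-5) True w wm in \<open>auto simp: successively_Cons Suc_le_eq\<close>)
    \<comment> \<open>Away from position 0 the word \<open>?c # m\<close> agrees with
      \<open>w\<close>. It has \<open>2 * (k - 1)\<close> blocks, so the partner of position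
      \<open>l\<close> is at \<open>k - 1 + l\<close>, and that of \<open>?c\<close> is
      \<open>y\<close>.\<close>
    also have "\<dots> = t [?c, tp y] * (\<Prod>l\<in>{1..k - 2}. t [w ! l, tp (w ! (k - 1 + l))])"
    proof -
      have len: "length (?c # m) = 2 * (k - 1)" using w(3,4) wm by simp
      have nth: "(?c # m) ! Suc l = w ! Suc l" if "Suc l < 2 * (k - 1)" for l
        using that len wm by (simp add: nth_append)
      have "pairprod (?c # m) = (\<Prod>l<k - 1. t [(?c # m) ! l, tp ((?c # m) ! (k - 1 + l))])"
        unfolding pairprod_def len by simp
      also have "k - 1 = Suc (k - 2)" using w(4) by simp
      also have "(\<Prod>l<Suc (k - 2). t [(?c # m) ! l, tp ((?c # m) ! (Suc (k - 2) + l))])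
         = t [?c, tp ((?c # m) ! Suc (k - 2))] * (\<Prod>l<k - 2. t [(?c # m) ! Suc l, tp ((?c # m) ! Suc (k - 2 + Suc l))])"
        unfolding prod.lessThan_Suc_shift by simp
      also have "(?c # m) ! Suc (k - 2) = y"
      proof -
        have "Suc (k - 2) = k - 1" "Suc (k - 2) < 2 * (k - 1)" using w(4) by auto
        then show ?thesis unfolding y_def using nth[of "k - 2"] by (simp only:)
      qed
      also have "(\<Prod>l<k - 2. t [(?c # m) ! Suc l, tp ((?c # m) ! Suc (k - 2 + Suc l))])
         = (\<Prod>l<k - 2. t [w ! Suc l, tp (w ! (k - 1 + Suc l))])"
      proof (rule prod.cong[OF refl])
        fix l assume "l \<in> {..<k - 2}"
        then have l: "Suc l < 2 * (k - 1)" "Suc (k - 2 + Suc l) < 2 * (k - 1)"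
          "Suc (k - 2 + Suc l) = k - 1 + Suc l" using w(4) by auto
        note nth[OF l(1)] nth[OF l(2)] l(3)
        then show "t [(?c # m) ! Suc l, tp ((?c # m) ! Suc (k - 2 + Suc l))] = t [w ! Suc l, tp (w ! (k - 1 + Suc l))]"
          by (simp only:)
      qed
      also have "\<dots> = (\<Prod>l\<in>{1..k - 2}. t [w ! l, tp (w ! (k - 1 + l))])"
        by (rule prod.reindex_bij_witness[of _ "\<lambda>l. l - 1" Suc]) auto
      finally show ?thesis .
    qed
    \<comment> \<open>Replacing the centred product by the plain one changes the trace by a multiple
      of the trace of \<open>tp y\<close>, which is 0.\<close>
    also have "t [?c, tp y] = t [z, a, tp y]"
      using joined(1)[OF ok3 True[symmetric]] cy by simp
    finally show ?thesis using rot3 swap wm y_def by (simp add: butlast_append)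
  qed
qed

end

section \<open>Polynomials and matrices\<close>

definition letter_poly :: "letter \<Rightarrow> ncpoly" where
  "letter_poly l = (\<lambda>w. if w = [l] then 1 else 0)"

definition supp :: "ncpoly \<Rightarrow> word set" where
  "supp p = {w. p w \<noteq> 0}"

lemma poly_in_iff: "poly_in S p \<longleftrightarrow> finite (supp p) \<and> (\<forall>w\<in>supp p. set w \<subseteq> S)"
  by (auto simp: poly_in_def ncpoly_def supp_def)

lemma poly_in_subset:
  assumes "finite T" "supp p \<subseteq> T" "\<And>w. w \<in> T \<Longrightarrow> set w \<subseteq> S"
  shows "poly_in S p"
  unfolding poly_in_iff using assms finite_subset by blast

lemma poly_in_mono: "poly_in S p \<Longrightarrow> S \<subseteq> S' \<Longrightarrow> poly_in S' p"
  by (auto simp: poly_in_def)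

lemma poly_in_pone [simp]: "poly_in S pone"
  by (rule poly_in_subset[of "{[]}"]) (auto simp: supp_def pone_def)

lemma poly_in_letter_poly: "l \<in> S \<Longrightarrow> poly_in S (letter_poly l)"
  by (rule poly_in_subset[of "{[l]}"]) (auto simp: supp_def letter_poly_def)

lemma poly_in_padd: "poly_in S p \<Longrightarrow> poly_in S q \<Longrightarrow> poly_in S (padd p q)"
  by (rule poly_in_subset[of "supp p \<union> supp q"]) (auto simp: poly_in_iff supp_def padd_def)

lemma poly_in_psmult: "poly_in S p \<Longrightarrow> poly_in S (psmult c p)"
  by (rule poly_in_subset[of "supp p"]) (auto simp: poly_in_iff supp_def psmult_def)

lemma supp_pmul: "supp (pmul p q) \<subseteq> (\<lambda>(u, v). u @ v) ` (supp p \<times> supp q)"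
proof
  fix w assume "w \<in> supp (pmul p q)"
  then obtain m where "p (take m w) * q (drop m w) \<noteq> 0"
    unfolding supp_def pmul_def by (auto elim: sum.not_neutral_contains_not_neutral)
  then show "w \<in> (\<lambda>(u, v). u @ v) ` (supp p \<times> supp q)"
    unfolding supp_def by (intro image_eqI[of _ _ "(take m w, drop m w)"]) auto
qed

lemma poly_in_pmul: "poly_in S p \<Longrightarrow> poly_in S q \<Longrightarrow> poly_in S (pmul p q)"
  by (rule poly_in_subset[OF _ supp_pmul]) (simp add: poly_in_iff, fastforce simp: poly_in_iff)

lemma flipl_flipl [simp]: "flipl (flipl l) = l"
  by (cases l) auto

definition wflip :: "word \<Rightarrow> word" where
  "wflip w = rev (map flipl w)"

lemma wflip_simps [simp]: "wflip (wflip w) = w" "length (wflip w) = length w"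
  by (auto simp: wflip_def rev_map comp_def)

lemma ptr_wflip: "ptr p w = p (wflip w)"
  by (simp add: ptr_def wflip_def)

lemma bij_wflip: "bij_betw wflip (supp (ptr p)) (supp p)"
  by (rule bij_betw_byWitness[of _ wflip]) (auto simp: supp_def ptr_wflip)

lemma ptr_ptr [simp]: "ptr (ptr p) = p"
  by (rule ext) (simp add: ptr_wflip)

lemma ptr_padd: "ptr (padd p q) = padd (ptr p) (ptr q)"
  and ptr_psmult: "ptr (psmult c p) = psmult c (ptr p)"
  by (auto simp: ptr_def padd_def psmult_def)

lemma ptr_pmul: "ptr (pmul p q) = pmul (ptr q) (ptr p)"
proof
  fix w
  have "ptr (pmul p q) w = (\<Sum>m\<le>length w. p (take m (wflip w)) * q (drop m (wflip w)))"
    by (simp add: ptr_wflip pmul_def)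
  also have "\<dots> = (\<Sum>m\<le>length w. q (wflip (take m w)) * p (wflip (drop m w)))"
  proof (rule sum.reindex_bij_witness[of _ "\<lambda>m. length w - m" "\<lambda>m. length w - m"])
    fix m assume "m \<in> {..length w}"
    then show "q (wflip (take (length w - m) w)) * p (wflip (drop (length w - m) w)) =
       p (take m (wflip w)) * q (drop m (wflip w))"
      by (simp add: wflip_def take_rev drop_rev take_map drop_map)
  qed auto
  also have "\<dots> = pmul (ptr q) (ptr p) w" by (simp add: pmul_def ptr_wflip)
  finally show "ptr (pmul p q) w = pmul (ptr q) (ptr p) w" .
qed

lemma poly_in_ptr:
  assumes "poly_in S p" "flipl ` S \<subseteq> S"
  shows "poly_in S (ptr p)"
  unfolding poly_in_iff
proof
  show "finite (supp (ptr p))" using bij_betw_finite[OF bij_wflip, of p] assms(1) by (simp add: poly_in_iff)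
  show "\<forall>w\<in>supp (ptr p). set w \<subseteq> S"
  proof
    fix w assume "w \<in> supp (ptr p)"
    then have "set (wflip w) \<subseteq> S" using assms(1) by (auto simp: poly_in_iff supp_def ptr_wflip)
    then have "flipl ` set w \<subseteq> S" by (simp add: wflip_def)
    then have "flipl ` flipl ` set w \<subseteq> S" using assms(2) by blast
    then show "set w \<subseteq> S" by (simp add: image_image)
  qed
qed

lemma flipl_fam_letters: "flipl ` fam_letters k j \<subseteq> fam_letters k j"
  by (auto simp: fam_letters_def)

lemma flipl_all_letters: "flipl ` all_letters k s \<subseteq> all_letters k s"
  using flipl_fam_letters by (fastforce simp: all_letters_def)

text \<open>Matrices are total functions, and multiplication by \<open>idmat\<close> cuts off the
  row or column sums at N. Laws that involve the identity therefore hold only in the N x N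
  corner.\<close>

definition meq :: "nat \<Rightarrow> cmat \<Rightarrow> cmat \<Rightarrow> bool" where
  "meq N A B \<longleftrightarrow> (\<forall>r<N. \<forall>c<N. A r c = B r c)"

lemma meqD: "meq N A B \<Longrightarrow> r < N \<Longrightarrow> c < N \<Longrightarrow> A r c = B r c"
  by (simp add: meq_def)

lemma meq_refl [simp]: "meq N A A" and meq_sym: "meq N A B \<Longrightarrow> meq N B A"
  and meq_trans [trans]: "meq N A B \<Longrightarrow> meq N B C \<Longrightarrow> meq N A C"
  by (auto simp: meq_def)

lemma meq_matmul: "meq N A A' \<Longrightarrow> meq N B B' \<Longrightarrow> meq N (matmul N A B) (matmul N A' B')"
  by (simp add: meq_def matmul_def)

lemma meq_mTrace: "meq N A B \<Longrightarrow> mTrace N A = mTrace N B"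
  by (simp add: meq_def mTrace_def)

lemma matmul_assoc: "matmul N (matmul N A B) C = matmul N A (matmul N B C)"
proof (intro ext)
  fix r c
  have "matmul N (matmul N A B) C r c = (\<Sum>m<N. \<Sum>l<N. A r l * B l m * C m c)"
    by (simp add: matmul_def sum_distrib_right)
  also have "\<dots> = (\<Sum>l<N. \<Sum>m<N. A r l * B l m * C m c)" by (rule sum.swap)
  also have "\<dots> = matmul N A (matmul N B C) r c"
    by (simp add: matmul_def sum_distrib_left mult.assoc)
  finally show "matmul N (matmul N A B) C r c = matmul N A (matmul N B C) r c" .
qed

lemma matmul_idmat: "meq N (matmul N idmat A) A" "meq N (matmul N A idmat) A"
  by (auto simp: meq_def matmul_def idmat_def if_distrib if_distribR cong: if_cong)

lemma mTrace_matmul_comm: "mTrace N (matmul N A B) = mTrace N (matmul N B A)"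
  unfolding mTrace_def matmul_def by (subst sum.swap) (simp add: mult.commute)

lemma mtransp_matmul: "mtransp (matmul N A B) = matmul N (mtransp B) (mtransp A)"
  by (simp add: mtransp_def matmul_def mult.commute)

lemma mtransp_idmat [simp]: "mtransp idmat = idmat"
  by (intro ext) (auto simp: mtransp_def idmat_def)

lemma mtransp_simps [simp]: "mtransp (mtransp A) = A" "mTrace N (mtransp A) = mTrace N A"
  by (auto simp: mtransp_def mTrace_def)

definition mprod :: "nat \<Rightarrow> cmat list \<Rightarrow> cmat" where
  "mprod N As = foldr (matmul N) As idmat"

lemma mprod_simps [simp]: "mprod N [] = idmat" "mprod N (A # As) = matmul N A (mprod N As)"
  by (auto simp: mprod_def)

lemma mprod_append: "meq N (mprod N (As @ Bs)) (matmul N (mprod N As) (mprod N Bs))"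
proof (induction As)
  case Nil
  then show ?case using matmul_idmat(1) meq_sym by simp
next
  case (Cons A As)
  then show ?case by (simp add: matmul_assoc meq_matmul)
qed

lemma mprod_single: "meq N (mprod N [A]) A"
  by (simp add: matmul_idmat)

lemma mprod_rev_transp: "meq N (mprod N (map mtransp (rev As))) (mtransp (mprod N As))"
proof (induction As)
  case (Cons A As)
  have "meq N (mprod N (map mtransp (rev As) @ [mtransp A]))
      (matmul N (mprod N (map mtransp (rev As))) (mprod N [mtransp A]))" by (rule mprod_append)
  also have "meq N \<dots> (matmul N (mtransp (mprod N As)) (mtransp A))"
    by (intro meq_matmul Cons mprod_single)
  finally show ?case by (simp add: mtransp_matmul)
qed simp

lemma mprod_cong: "list_all2 (meq N) As Bs \<Longrightarrow> meq N (mprod N As) (mprod N Bs)"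
  by (induction rule: list_all2_induct) (auto intro: meq_matmul)

lemma mprod_map_cong: "(\<And>x. x \<in> set xs \<Longrightarrow> meq N (f x) (g x)) \<Longrightarrow> meq N (mprod N (map f xs)) (mprod N (map g xs))"
  by (rule mprod_cong) (simp add: list_all2_conv_all_nth)

lemma word_eval_mprod: "word_eval N G w = mprod N (map G w)"
  by (induction w) auto

lemma poly_eval_superset:
  assumes "finite T" "supp p \<subseteq> T"
  shows "poly_eval N G p r c = (\<Sum>w\<in>T. p w * word_eval N G w r c)"
  unfolding poly_eval_def using assms by (intro sum.mono_neutral_left) (auto simp: supp_def)

lemma poly_eval_padd:
  assumes "poly_in S p" "poly_in S q"
  shows "poly_eval N G (padd p q) r c = poly_eval N G p r c + poly_eval N G q r c"
proof -
  let ?T = "supp p \<union> supp q"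
  have T: "finite ?T" "supp p \<subseteq> ?T" "supp q \<subseteq> ?T" "supp (padd p q) \<subseteq> ?T"
    using assms by (auto simp: poly_in_iff supp_def padd_def)
  show ?thesis
    unfolding T(2-4)[THEN poly_eval_superset[OF T(1)]]
    by (simp add: padd_def distrib_right sum.distrib)
qed

lemma poly_eval_psmult:
  assumes "poly_in S p"
  shows "poly_eval N G (psmult c p) r d = c * poly_eval N G p r d"
proof -
  have T: "finite (supp p)" "supp (psmult c p) \<subseteq> supp p" "supp p \<subseteq> supp p"
    using assms by (auto simp: poly_in_iff supp_def psmult_def)
  show ?thesis
    unfolding T(2,3)[THEN poly_eval_superset[OF T(1)]]
    by (simp add: psmult_def sum_distrib_left mult.assoc)
qed

lemma poly_eval_pone: "poly_eval N G pone = idmat"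
proof (intro ext)
  fix r c show "poly_eval N G pone r c = idmat r c"
    by (subst poly_eval_superset[of "{[]}"]) (auto simp: supp_def pone_def)
qed

lemma poly_eval_letter_poly: "meq N (poly_eval N G (letter_poly l)) (G l)"
proof -
  have "poly_eval N G (letter_poly l) r c = word_eval N G [l] r c" for r c
    by (subst poly_eval_superset[of "{[l]}"]) (auto simp: supp_def letter_poly_def)
  then show ?thesis using matmul_idmat(2)[of N "G l"] by (simp add: meq_def)
qed

text \<open>A pair with concatenation \<open>w\<close> is determined by the position of the cut, so
  the convolution over cuts is a sum over a fibre of concatenation.\<close>

lemma sum_splittings:
  fixes h :: "word \<times> word \<Rightarrow> complex"
  assumes "finite T" "\<And>x. x \<notin> T \<Longrightarrow> h x = 0"
  shows "(\<Sum>m\<le>length w. h (take m w, drop m w)) = (\<Sum>x | x \<in> T \<and> (\<lambda>(u, v). u @ v) x = w. h x)"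
proof -
  let ?f = "\<lambda>m. (take m w, drop m w)"
  have inj: "inj_on ?f {..length w}"
    by (rule inj_onI) (metis atMost_iff length_take min.absorb2 prod.inject)
  have im: "?f ` {..length w} = {x. (\<lambda>(u, v). u @ v) x = w}"
  proof
    show "{x. (\<lambda>(u, v). u @ v) x = w} \<subseteq> ?f ` {..length w}"
    proof
      fix x assume "x \<in> {x. (\<lambda>(u, v). u @ v) x = w}"
      then obtain u v where "x = (u, v)" "w = u @ v" by (cases x) auto
      then show "x \<in> ?f ` {..length w}" by (intro image_eqI[of _ _ "length u"]) auto
    qed
  qed auto
  have fin: "finite {x. (\<lambda>(u, v). u @ v) x = w}" unfolding im[symmetric] by simp
  have "(\<Sum>m\<le>length w. h (take m w, drop m w)) = (\<Sum>x\<in>?f ` {..length w}. h x)"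
    by (simp add: sum.reindex[OF inj])
  also have "\<dots> = (\<Sum>x | x \<in> T \<and> (\<lambda>(u, v). u @ v) x = w. h x)"
    unfolding im by (intro sum.mono_neutral_right fin) (use assms in auto)
  finally show ?thesis .
qed

text \<open>Writing the coefficients of the product as sums over fibres of concatenation and
  regrouping gives a sum over pairs of words, where evaluation is multiplicative.\<close>

lemma poly_eval_pmul:
  assumes "poly_in S p" "poly_in S' q"
  shows "meq N (poly_eval N G (pmul p q)) (matmul N (poly_eval N G p) (poly_eval N G q))"
  unfolding meq_def
proof (intro allI impI)
  fix r c assume rc: "r < N" "c < N"
  let ?cat = "\<lambda>(u, v). u @ v :: word" and ?T = "supp p \<times> supp q"
  have fin: "finite ?T" using assms by (auto simp: poly_in_iff)
  have "poly_eval N G (pmul p q) r c = (\<Sum>w\<in>?cat ` ?T. pmul p q w * word_eval N G w r c)"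
    by (rule poly_eval_superset) (use fin supp_pmul in auto)
  also have "\<dots> = (\<Sum>w\<in>?cat ` ?T. \<Sum>x | x \<in> ?T \<and> ?cat x = w. p (fst x) * q (snd x) * word_eval N G (?cat x) r c)"
  proof (rule sum.cong[OF refl])
    fix w
    have "pmul p q w = (\<Sum>m\<le>length w. (\<lambda>x. p (fst x) * q (snd x)) (take m w, drop m w))"
      by (simp add: pmul_def)
    also have "\<dots> = (\<Sum>x | x \<in> ?T \<and> ?cat x = w. p (fst x) * q (snd x))"
      by (rule sum_splittings[OF fin]) (auto simp: supp_def)
    finally show "pmul p q w * word_eval N G w r c =
       (\<Sum>x | x \<in> ?T \<and> ?cat x = w. p (fst x) * q (snd x) * word_eval N G (?cat x) r c)"
      by (auto simp: sum_distrib_right intro!: sum.cong)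
  qed
  also have "\<dots> = (\<Sum>x\<in>?T. p (fst x) * q (snd x) * word_eval N G (?cat x) r c)"
    by (rule sum.group) (use fin in auto)
  also have "\<dots> = (\<Sum>u\<in>supp p. \<Sum>v\<in>supp q. p u * q v * word_eval N G (u @ v) r c)"
    by (simp add: sum.cartesian_product split_def)
  also have "\<dots> = (\<Sum>u\<in>supp p. \<Sum>v\<in>supp q. \<Sum>m<N. (p u * word_eval N G u r m) * (q v * word_eval N G v m c))"
  proof (intro sum.cong refl)
    fix u v
    have "word_eval N G (u @ v) r c = (\<Sum>m<N. word_eval N G u r m * word_eval N G v m c)"
      using meqD[OF mprod_append[of N "map G u" "map G v"] rc] by (simp add: word_eval_mprod matmul_def)
    then show "p u * q v * word_eval N G (u @ v) r c =
      (\<Sum>m<N. (p u * word_eval N G u r m) * (q v * word_eval N G v m c))"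
      by (simp add: sum_distrib_left mult_ac)
  qed
  also have "\<dots> = (\<Sum>u\<in>supp p. \<Sum>m<N. \<Sum>v\<in>supp q. (p u * word_eval N G u r m) * (q v * word_eval N G v m c))"
    by (intro sum.cong refl sum.swap)
  also have "\<dots> = (\<Sum>m<N. \<Sum>u\<in>supp p. \<Sum>v\<in>supp q. (p u * word_eval N G u r m) * (q v * word_eval N G v m c))"
    by (rule sum.swap)
  also have "\<dots> = matmul N (poly_eval N G p) (poly_eval N G q) r c"
    by (simp add: matmul_def poly_eval_def supp_def sum_product)
  finally show "poly_eval N G (pmul p q) r c = matmul N (poly_eval N G p) (poly_eval N G q) r c" .
qed

lemma poly_eval_ptr:
  assumes "\<And>l. G (flipl l) = mtransp (G l)"
  shows "meq N (poly_eval N G (ptr p)) (mtransp (poly_eval N G p))"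
  unfolding meq_def
proof (intro allI impI)
  fix r c assume rc: "r < N" "c < N"
  have ev: "word_eval N G (wflip w) c r = word_eval N G w r c" for w
  proof -
    have "map G (wflip w) = map mtransp (rev (map G w))"
      using assms by (simp add: wflip_def rev_map)
    then show ?thesis
      using meqD[OF mprod_rev_transp[of N "map G w"] rc(2,1)] by (simp add: word_eval_mprod mtransp_def)
  qed
  have "poly_eval N G (ptr p) r c = (\<Sum>w\<in>supp (ptr p). p (wflip w) * word_eval N G (wflip w) c r)"
    using ev by (simp add: poly_eval_def supp_def ptr_wflip)
  also have "\<dots> = (\<Sum>w\<in>supp p. p w * word_eval N G w c r)"
    by (rule sum.reindex_bij_betw[OF bij_wflip])
  finally show "poly_eval N G (ptr p) r c = mtransp (poly_eval N G p) r c"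
    by (simp add: poly_eval_def supp_def mtransp_def)
qed

text \<open>Version of gens for a single realisation of the generators, so that functions of the
  generators can be integrated against the joint law of their entries.\<close>
definition gen0 :: "(nat \<Rightarrow> nat \<Rightarrow> cmat) \<Rightarrow> letter \<Rightarrow> cmat" where
  "gen0 Z l = (case l of (j, i, b) \<Rightarrow> if b then mtransp (Z j i) else Z j i)"

lemma gens_gen0: "gens Y \<omega> = gen0 (\<lambda>j i. Y j i \<omega>)"
  by (rule ext) (simp add: gens_def gen0_def)

lemma gen0_flipl: "gen0 Z (flipl l) = mtransp (gen0 Z l)"
  by (cases l) (auto simp: gen0_def)

text \<open>The family index is stored because the polynomial need not determine it: constants lie
  in every subalgebra.\<close>

type_synonym block = "nat \<times> ncpoly"

definition bmat :: "nat \<Rightarrow> (nat \<Rightarrow> nat \<Rightarrow> cmat) \<Rightarrow> block list \<Rightarrow> cmat" where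
  "bmat N Z w = mprod N (map (\<lambda>b. poly_eval N (gen0 Z) (snd b)) w)"

definition btr :: "nat \<Rightarrow> (nat \<Rightarrow> nat \<Rightarrow> cmat) \<Rightarrow> block list \<Rightarrow> complex" where
  "btr N Z w = mTrace N (bmat N Z w)"

definition tpb :: "block \<Rightarrow> block" where
  "tpb b = (fst b, ptr (snd b))"

lemma bmat_append: "meq N (bmat N Z (u @ v)) (matmul N (bmat N Z u) (bmat N Z v))"
  unfolding bmat_def map_append by (rule mprod_append)

lemma bmat_tp: "meq N (bmat N Z (map tpb (rev w))) (mtransp (bmat N Z w))"
proof -
  have "meq N (bmat N Z (map tpb (rev w))) (mprod N (map mtransp (rev (map (\<lambda>b. poly_eval N (gen0 Z) (snd b)) w))))"
    unfolding bmat_def map_map rev_map comp_def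
    by (rule mprod_map_cong) (simp add: tpb_def poly_eval_ptr gen0_flipl)
  also have "meq N \<dots> (mtransp (bmat N Z w))" unfolding bmat_def by (rule mprod_rev_transp)
  finally show ?thesis .
qed

lemma btr_rot: "btr N Z (u @ v) = btr N Z (v @ u)"
  unfolding btr_def using mTrace_matmul_comm meq_mTrace[OF bmat_append] by metis

lemma btr_tp: "btr N Z (map tpb (rev w)) = btr N Z w"
  unfolding btr_def using meq_mTrace[OF bmat_tp] by simp

text \<open>The entrywise contraction of two matrices. It arises from the second half of the
  antisymmetric rotation generator, and it is how transposes enter the loop equation.\<close>

lemma btr_append_tp: "btr N Z (u @ map tpb (rev v)) = (\<Sum>a<N. \<Sum>b<N. bmat N Z u a b * bmat N Z v a b)"
proof -
  have "btr N Z (u @ map tpb (rev v)) = mTrace N (matmul N (bmat N Z u) (mtransp (bmat N Z v)))"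
    unfolding btr_def
    by (rule meq_mTrace) (blast intro: meq_trans[OF bmat_append] meq_matmul bmat_tp meq_refl)
  then show ?thesis by (simp add: mTrace_def matmul_def mtransp_def)
qed

lemma btr_append: "btr N Z (u @ v) = (\<Sum>a<N. \<Sum>b<N. bmat N Z u a b * bmat N Z v b a)"
  unfolding btr_def meq_mTrace[OF bmat_append] by (simp add: mTrace_def matmul_def)

lemma btr_nil: "btr N Z [] = of_nat N"
  by (simp add: btr_def bmat_def mTrace_def idmat_def)

lemma btr_merge:
  assumes "poly_in S p" "poly_in S' q"
  shows "btr N Z ((j, pmul p q) # u) = btr N Z ((j, p) # (j', q) # u)"
  unfolding btr_def bmat_def
  by (rule meq_mTrace) (auto simp: matmul_assoc[symmetric] intro!: meq_matmul poly_eval_pmul[OF assms])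

lemma btr_centre:
  assumes "poly_in S p"
  shows "btr N Z ((j, padd p (psmult (- c) pone)) # u) = btr N Z ((j, p) # u) - c * btr N Z u"
proof -
  let ?G = "gen0 Z" and ?B = "mprod N (map (\<lambda>b. poly_eval N (gen0 Z) (snd b)) u)"
  have "poly_eval N ?G (padd p (psmult (- c) pone)) r d = poly_eval N ?G p r d - c * idmat r d" for r d
    by (subst poly_eval_padd[OF assms poly_in_psmult[OF poly_in_pone]])
       (simp add: poly_eval_psmult[OF poly_in_pone] poly_eval_pone)
  then have "btr N Z ((j, padd p (psmult (- c) pone)) # u) =
      (\<Sum>r<N. matmul N (poly_eval N ?G p) ?B r r - c * matmul N idmat ?B r r)"
    by (simp add: btr_def bmat_def mTrace_def matmul_def left_diff_distrib sum_subtractf sum_distrib_left mult.assoc)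
  also have "\<dots> = btr N Z ((j, p) # u) - c * mTrace N (matmul N idmat ?B)"
    by (simp add: btr_def bmat_def mTrace_def sum_subtractf sum_distrib_left)
  also have "mTrace N (matmul N idmat ?B) = btr N Z u"
    unfolding btr_def bmat_def by (rule meq_mTrace[OF matmul_idmat(1)])
  finally show ?thesis .
qed

lemma btr_poly: "meq N (bmat N Y w) (poly_eval N (gen0 Y) p) \<Longrightarrow> btr N Y w = mTrace N (poly_eval N (gen0 Y) p)"
  unfolding btr_def by (rule meq_mTrace)

lemma bmat_single: "meq N (bmat N Y [b]) (poly_eval N (gen0 Y) (snd b))"
  unfolding bmat_def by (simp add: matmul_idmat)

section \<open>Random variables with finite moments\<close>

text \<open>The algebra of complex random variables with all moments finite; only powers of the
  modulus are tested, since mixed moments follow from closure under products.\<close>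

definition Lall :: "'a measure \<Rightarrow> ('a \<Rightarrow> complex) set" where
  "Lall M = {f. f \<in> borel_measurable M \<and> (\<forall>q. integrable M (\<lambda>\<omega>. norm (f \<omega>) ^ q))}"

lemma Lall_integrable: "f \<in> Lall M \<Longrightarrow> integrable M f"
  using integrable_norm_iff[of f M] unfolding Lall_def by (auto dest: spec[of _ 1])

lemma Lall_add:
  assumes "f \<in> Lall M" "g \<in> Lall M"
  shows "(\<lambda>\<omega>. f \<omega> + g \<omega>) \<in> Lall M"
  unfolding Lall_def
proof (safe)
  show m: "(\<lambda>\<omega>. f \<omega> + g \<omega>) \<in> borel_measurable M"
    using assms by (auto simp: Lall_def)
  fix q
  have le: "norm (f \<omega> + g \<omega>) ^ q \<le> 2 ^ q * (norm (f \<omega>) ^ q + norm (g \<omega>) ^ q)" for \<omega>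
  proof -
    let ?m = "max (norm (f \<omega>)) (norm (g \<omega>))"
    have "norm (f \<omega> + g \<omega>) \<le> 2 * ?m" using norm_triangle_ineq[of "f \<omega>" "g \<omega>"] by linarith
    then have "norm (f \<omega> + g \<omega>) ^ q \<le> (2 * ?m) ^ q" by (intro power_mono) auto
    also have "\<dots> = 2 ^ q * ?m ^ q" by (simp add: power_mult_distrib)
    also have "?m ^ q \<le> norm (f \<omega>) ^ q + norm (g \<omega>) ^ q" by (auto simp: max_def)
    finally show ?thesis by simp
  qed
  have "integrable M (\<lambda>\<omega>. 2 ^ q * (norm (f \<omega>) ^ q + norm (g \<omega>) ^ q))"
    using assms by (auto simp: Lall_def)
  then show "integrable M (\<lambda>\<omega>. norm (f \<omega> + g \<omega>) ^ q)"
  proof (rule Bochner_Integration.integrable_bound)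
    show "AE \<omega> in M. norm (norm (f \<omega> + g \<omega>) ^ q) \<le> norm (2 ^ q * (norm (f \<omega>) ^ q + norm (g \<omega>) ^ q))"
    proof (rule AE_I2)
      fix \<omega>
      have "norm (norm (f \<omega> + g \<omega>) ^ q) = norm (f \<omega> + g \<omega>) ^ q" by simp
      also note le[of \<omega>]
      also have "2 ^ q * (norm (f \<omega>) ^ q + norm (g \<omega>) ^ q) \<le> norm (2 ^ q * (norm (f \<omega>) ^ q + norm (g \<omega>) ^ q))"
        by simp
      finally show "norm (norm (f \<omega> + g \<omega>) ^ q) \<le> norm (2 ^ q * (norm (f \<omega>) ^ q + norm (g \<omega>) ^ q))" .
    qed
  qed (use m in measurable)
qed

lemma Lall_mult:
  assumes "f \<in> Lall M" "g \<in> Lall M"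
  shows "(\<lambda>\<omega>. f \<omega> * g \<omega>) \<in> Lall M"
  unfolding Lall_def
proof (safe)
  show m: "(\<lambda>\<omega>. f \<omega> * g \<omega>) \<in> borel_measurable M"
    using assms by (auto simp: Lall_def)
  fix q
  have "integrable M (\<lambda>\<omega>. norm (f \<omega>) ^ (2 * q) + norm (g \<omega>) ^ (2 * q))"
    using assms by (auto simp: Lall_def)
  then show "integrable M (\<lambda>\<omega>. norm (f \<omega> * g \<omega>) ^ q)"
  proof (rule Bochner_Integration.integrable_bound)
    show "AE \<omega> in M. norm (norm (f \<omega> * g \<omega>) ^ q) \<le> norm (norm (f \<omega>) ^ (2 * q) + norm (g \<omega>) ^ (2 * q))"
    proof (rule AE_I2)
      fix \<omega>
      let ?a = "norm (f \<omega>) ^ q" and ?b = "norm (g \<omega>) ^ q"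
      \<comment> \<open>This bounds the q-th moment of a product by moments of order 2q of the
        factors, so having all moments is stable under multiplication.\<close>
      have "?a * ?b \<le> ?a\<^sup>2 + ?b\<^sup>2"
      proof -
        have "0 \<le> ?a * ?b" by simp
        then show ?thesis using sum_squares_bound[of ?a ?b] by linarith
      qed
      then show "norm (norm (f \<omega> * g \<omega>) ^ q) \<le> norm (norm (f \<omega>) ^ (2 * q) + norm (g \<omega>) ^ (2 * q))"
        by (simp add: norm_mult power_mult_distrib power_mult mult.commute[of 2])
    qed
  qed (use m in measurable)
qed

context prob_space
begin

lemma Lall_const: "(\<lambda>_. c) \<in> Lall M"
  by (simp add: Lall_def)

lemma Lall_sum: "(\<And>i. i \<in> I \<Longrightarrow> f i \<in> Lall M) \<Longrightarrow> (\<lambda>\<omega>. \<Sum>i\<in>I. f i \<omega>) \<in> Lall M"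
  by (induction I rule: infinite_finite_induct) (auto intro: Lall_add Lall_const)

lemma Lall_prod_list: "(\<And>x. x \<in> set xs \<Longrightarrow> f x \<in> Lall M) \<Longrightarrow> (\<lambda>\<omega>. \<Prod>x\<leftarrow>xs. f x \<omega>) \<in> Lall M"
  by (induction xs) (auto intro: Lall_mult Lall_const)

text \<open>Differentiable families are restricted to finite sums of products of a deterministic
  function with a random variable, so that differentiating under the integral is trivial.\<close>
definition diffable :: "(real \<Rightarrow> 'a \<Rightarrow> complex) \<Rightarrow> ('a \<Rightarrow> complex) \<Rightarrow> bool" where
  "diffable F D \<longleftrightarrow> (\<exists>L :: ((real \<Rightarrow> complex) \<times> complex \<times> ('a \<Rightarrow> complex)) list.
     (\<forall>x\<in>set L. (fst x has_vector_derivative fst (snd x)) (at 0) \<and> snd (snd x) \<in> Lall M) \<and>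
     (\<forall>\<theta> \<omega>. F \<theta> \<omega> = (\<Sum>x\<leftarrow>L. fst x \<theta> * snd (snd x) \<omega>)) \<and>
     (\<forall>\<omega>. D \<omega> = (\<Sum>x\<leftarrow>L. fst (snd x) * snd (snd x) \<omega>)))"

lemma diffable_cong:
  "diffable F D \<Longrightarrow> (\<And>\<theta> \<omega>. F' \<theta> \<omega> = F \<theta> \<omega>) \<Longrightarrow> (\<And>\<omega>. D' \<omega> = D \<omega>) \<Longrightarrow> diffable F' D'"
  by (simp add: diffable_def)

lemma diffable_random: "h \<in> Lall M \<Longrightarrow> diffable (\<lambda>_. h) (\<lambda>_. 0)"
  unfolding diffable_def by (intro exI[of _ "[(\<lambda>_. 1, 0, h)]"]) auto

lemma diffable_const: "diffable (\<lambda>_ _. c) (\<lambda>_. 0)"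
  by (rule diffable_random[OF Lall_const])

lemma diffable_fun: "(\<phi> has_vector_derivative d) (at 0) \<Longrightarrow> diffable (\<lambda>\<theta> _. \<phi> \<theta>) (\<lambda>_. d)"
  unfolding diffable_def by (intro exI[of _ "[(\<phi>, d, \<lambda>_. 1)]"]) (auto simp: Lall_const)

lemma diffable_add:
  assumes "diffable F D" "diffable F' D'"
  shows "diffable (\<lambda>\<theta> \<omega>. F \<theta> \<omega> + F' \<theta> \<omega>) (\<lambda>\<omega>. D \<omega> + D' \<omega>)"
proof -
  from assms obtain L L' where
    "\<forall>x\<in>set L. (fst x has_vector_derivative fst (snd x)) (at 0) \<and> snd (snd x) \<in> Lall M"
     "\<forall>\<theta> \<omega>. F \<theta> \<omega> = (\<Sum>x\<leftarrow>L. fst x \<theta> * snd (snd x) \<omega>)"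
     "\<forall>\<omega>. D \<omega> = (\<Sum>x\<leftarrow>L. fst (snd x) * snd (snd x) \<omega>)"
    "\<forall>x\<in>set L'. (fst x has_vector_derivative fst (snd x)) (at 0) \<and> snd (snd x) \<in> Lall M"
     "\<forall>\<theta> \<omega>. F' \<theta> \<omega> = (\<Sum>x\<leftarrow>L'. fst x \<theta> * snd (snd x) \<omega>)"
     "\<forall>\<omega>. D' \<omega> = (\<Sum>x\<leftarrow>L'. fst (snd x) * snd (snd x) \<omega>)"
    unfolding diffable_def by blast
  then show ?thesis unfolding diffable_def by (intro exI[of _ "L @ L'"]) auto
qed

lemma diffable_mult:
  assumes "diffable F D" "diffable F' D'"
  shows "diffable (\<lambda>\<theta> \<omega>. F \<theta> \<omega> * F' \<theta> \<omega>) (\<lambda>\<omega>. D \<omega> * F' 0 \<omega> + F 0 \<omega> * D' \<omega>)"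
proof -
  from assms obtain L L' where L:
    "\<forall>x\<in>set L. (fst x has_vector_derivative fst (snd x)) (at 0) \<and> snd (snd x) \<in> Lall M"
     "\<forall>\<theta> \<omega>. F \<theta> \<omega> = (\<Sum>x\<leftarrow>L. fst x \<theta> * snd (snd x) \<omega>)"
     "\<forall>\<omega>. D \<omega> = (\<Sum>x\<leftarrow>L. fst (snd x) * snd (snd x) \<omega>)"
    and L': "\<forall>x\<in>set L'. (fst x has_vector_derivative fst (snd x)) (at 0) \<and> snd (snd x) \<in> Lall M"
     "\<forall>\<theta> \<omega>. F' \<theta> \<omega> = (\<Sum>x\<leftarrow>L'. fst x \<theta> * snd (snd x) \<omega>)"
     "\<forall>\<omega>. D' \<omega> = (\<Sum>x\<leftarrow>L'. fst (snd x) * snd (snd x) \<omega>)"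
    unfolding diffable_def by blast
  have prod: "(\<Sum>x\<leftarrow>L. f x) * (\<Sum>y\<leftarrow>L'. g y) = (\<Sum>(x, y)\<leftarrow>List.product L L'. f x * g y)"
    for f g :: "_ \<Rightarrow> complex"
    by (induction L) (auto simp: distrib_right sum_list_const_mult comp_def)
  \<comment> \<open>The product of two elementary terms is again elementary: the deterministic parts
    obey the product rule and the random parts multiply inside \<open>Lall\<close>.\<close>
  define pr where "pr = (\<lambda>(x :: (real \<Rightarrow> complex) \<times> complex \<times> ('a \<Rightarrow> complex), y :: (real \<Rightarrow> complex) \<times> complex \<times> ('a \<Rightarrow> complex)).
     (\<lambda>\<theta>. fst x \<theta> * fst y \<theta>, fst x 0 * fst (snd y) + fst (snd x) * fst y 0, \<lambda>\<omega>. snd (snd x) \<omega> * snd (snd y) \<omega>))"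
  show ?thesis unfolding diffable_def
  proof (intro exI[of _ "map pr (List.product L L')"] conjI ballI allI)
    fix z assume "z \<in> set (map pr (List.product L L'))"
    then obtain x y where z: "z = pr (x, y)" and "x \<in> set L" "y \<in> set L'" by auto
    then have d: "(fst x has_vector_derivative fst (snd x)) (at 0)" "snd (snd x) \<in> Lall M"
      "(fst y has_vector_derivative fst (snd y)) (at 0)" "snd (snd y) \<in> Lall M"
      using L(1) L'(1) by auto
    show "(fst z has_vector_derivative fst (snd z)) (at 0)"
      using has_vector_derivative_mult[OF d(1,3)] by (simp add: z pr_def)
    show "snd (snd z) \<in> Lall M" using Lall_mult[OF d(2,4)] by (simp add: z pr_def)
  next
    fix \<theta> \<omega>
    show "F \<theta> \<omega> * F' \<theta> \<omega> = (\<Sum>x\<leftarrow>map pr (List.product L L'). fst x \<theta> * snd (snd x) \<omega>)"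
      unfolding L(2)[rule_format] L'(2)[rule_format] prod
      by (auto simp: comp_def pr_def split_def mult_ac)
  next
    fix \<omega>
    have "D \<omega> * F' 0 \<omega> + F 0 \<omega> * D' \<omega> =
      (\<Sum>(x, y)\<leftarrow>List.product L L'. fst (snd x) * snd (snd x) \<omega> * (fst y 0 * snd (snd y) \<omega>)
         + fst x 0 * snd (snd x) \<omega> * (fst (snd y) * snd (snd y) \<omega>))"
      unfolding L(2,3)[rule_format] L'(2,3)[rule_format] prod
      by (simp add: split_def sum_list_addf)
    also have "\<dots> = (\<Sum>x\<leftarrow>map pr (List.product L L'). fst (snd x) * snd (snd x) \<omega>)"
      by (auto simp: comp_def pr_def split_def algebra_simps intro!: arg_cong[of _ _ sum_list])
    finally show "D \<omega> * F' 0 \<omega> + F 0 \<omega> * D' \<omega> = (\<Sum>x\<leftarrow>map pr (List.product L L'). fst (snd x) * snd (snd x) \<omega>)" .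
  qed
qed

lemma diffable_sum:
  "(\<And>i. i \<in> I \<Longrightarrow> diffable (F i) (D i)) \<Longrightarrow>
    diffable (\<lambda>\<theta> \<omega>. \<Sum>i\<in>I. F i \<theta> \<omega>) (\<lambda>\<omega>. \<Sum>i\<in>I. D i \<omega>)"
  by (induction I rule: infinite_finite_induct) (auto intro: diffable_add diffable_const)

lemma diffable_prod_list:
  assumes "\<And>x. x \<in> set xs \<Longrightarrow> diffable (F x) (D x)"
  shows "diffable (\<lambda>\<theta> \<omega>. \<Prod>x\<leftarrow>xs. F x \<theta> \<omega>)
     (\<lambda>\<omega>. \<Sum>m<length xs. D (xs ! m) \<omega> * (\<Prod>x\<leftarrow>take m xs @ drop (Suc m) xs. F x 0 \<omega>))"
  using assms
proof (induction xs)
  case Nil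
  then show ?case using diffable_const[of 1] by simp
next
  case (Cons x xs)
  have "diffable (\<lambda>\<theta> \<omega>. F x \<theta> \<omega> * (\<Prod>x\<leftarrow>xs. F x \<theta> \<omega>))
     (\<lambda>\<omega>. D x \<omega> * (\<Prod>x\<leftarrow>xs. F x 0 \<omega>) + F x 0 \<omega> *
        (\<Sum>m<length xs. D (xs ! m) \<omega> * (\<Prod>x\<leftarrow>take m xs @ drop (Suc m) xs. F x 0 \<omega>)))"
    using Cons by (intro diffable_mult) auto
  then show ?case
    by (rule diffable_cong) (auto simp del: sum.lessThan_Suc simp add: sum.lessThan_Suc_shift sum_distrib_left mult_ac)
qed

lemma diffable_integral:
  assumes "diffable F D"
  shows "((\<lambda>\<theta>. \<integral>\<omega>. F \<theta> \<omega> \<partial>M) has_vector_derivative (\<integral>\<omega>. D \<omega> \<partial>M)) (at 0)" and "D \<in> Lall M"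
proof -
  from assms obtain L where L:
    "\<And>x. x \<in> set L \<Longrightarrow> (fst x has_vector_derivative fst (snd x)) (at 0) \<and> snd (snd x) \<in> Lall M"
     "\<And>\<theta> \<omega>. F \<theta> \<omega> = (\<Sum>x\<leftarrow>L. fst x \<theta> * snd (snd x) \<omega>)"
     "\<And>\<omega>. D \<omega> = (\<Sum>x\<leftarrow>L. fst (snd x) * snd (snd x) \<omega>)"
    unfolding diffable_def by blast
  have "(\<integral>\<omega>. (\<Sum>x\<leftarrow>L. c x * snd (snd x) \<omega>) \<partial>M) = (\<Sum>x\<leftarrow>L. c x * (\<integral>\<omega>. snd (snd x) \<omega> \<partial>M))
      \<and> (\<lambda>\<omega>. \<Sum>x\<leftarrow>L. c x * snd (snd x) \<omega>) \<in> Lall M" for c :: "_ \<Rightarrow> complex"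
    using L(1)
  proof (induction L)
    case (Cons x L)
    have x: "(\<lambda>\<omega>. c x * snd (snd x) \<omega>) \<in> Lall M"
      using Cons.prems by (intro Lall_mult Lall_const) auto
    have xs: "(\<lambda>\<omega>. \<Sum>x\<leftarrow>L. c x * snd (snd x) \<omega>) \<in> Lall M" using Cons by auto
    show ?case
      using Lall_add[OF x xs] Lall_integrable[OF x] Lall_integrable[OF xs] Cons by auto
  qed (auto simp: Lall_const)
  then have int: "(\<integral>\<omega>. (\<Sum>x\<leftarrow>L. c x * snd (snd x) \<omega>) \<partial>M) = (\<Sum>x\<leftarrow>L. c x * (\<integral>\<omega>. snd (snd x) \<omega> \<partial>M))"
    and Ls: "(\<lambda>\<omega>. \<Sum>x\<leftarrow>L. c x * snd (snd x) \<omega>) \<in> Lall M" for c :: "_ \<Rightarrow> complex"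
    by blast+
  have "D = (\<lambda>\<omega>. \<Sum>x\<leftarrow>L. fst (snd x) * snd (snd x) \<omega>)" by (rule ext) (rule L(3))
  then show "D \<in> Lall M" using Ls by simp
  have "((\<lambda>\<theta>. \<Sum>x\<leftarrow>L. fst x \<theta> * (\<integral>\<omega>. snd (snd x) \<omega> \<partial>M)) has_vector_derivative
      (\<Sum>x\<leftarrow>L. fst (snd x) * (\<integral>\<omega>. snd (snd x) \<omega> \<partial>M))) (at 0)"
    using L(1)
  proof (induction L)
    case (Cons x L)
    have "((\<lambda>\<theta>. fst x \<theta> * (\<integral>\<omega>. snd (snd x) \<omega> \<partial>M)) has_vector_derivative
        fst (snd x) * (\<integral>\<omega>. snd (snd x) \<omega> \<partial>M)) (at 0)"
      using Cons.prems[of x] by (intro has_vector_derivative_mult_left) auto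
    then show ?case using Cons by (auto intro!: has_vector_derivative_add)
  qed auto
  then show "((\<lambda>\<theta>. \<integral>\<omega>. F \<theta> \<omega> \<partial>M) has_vector_derivative (\<integral>\<omega>. D \<omega> \<partial>M)) (at 0)"
    unfolding L(2,3) int .
qed

text \<open>The form in which invariance is exploited: an expectation that does not depend on the
  angle has derivative 0, and the derivative may be taken inside.\<close>

lemma diffable_stationary:
  assumes "diffable F D" "\<And>\<theta>. (\<integral>\<omega>. F \<theta> \<omega> \<partial>M) = c"
  shows "(\<integral>\<omega>. D \<omega> \<partial>M) = 0"
  using diffable_integral(1)[OF assms(1)] unfolding assms(2)
  by (rule vector_derivative_unique_at) (rule has_vector_derivative_const)

end

section \<open>Rotations\<close>

text \<open>For \<open>a = b\<close> this is the identity, so that sums over all pairs of indices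
  need no exception on the diagonal; the generator \<open>rotgen a a\<close> is 0
  accordingly.\<close>

definition rot :: "nat \<Rightarrow> nat \<Rightarrow> real \<Rightarrow> nat \<Rightarrow> nat \<Rightarrow> real" where
  "rot a b \<theta> r c = (if a \<noteq> b \<and> r = a then cos \<theta> * of_bool (c = a) + sin \<theta> * of_bool (c = b)
     else if a \<noteq> b \<and> r = b then cos \<theta> * of_bool (c = b) + - sin \<theta> * of_bool (c = a)
     else of_bool (c = r))"

definition rotgen :: "nat \<Rightarrow> nat \<Rightarrow> cmat" where
  "rotgen a b r c = of_bool (r = a \<and> c = b) - of_bool (r = b \<and> c = a)"

lemma rot_zero: "rot a b 0 r c = (if r = c then 1 else 0)"
  by (cases "r = a"; cases "r = b") (simp_all add: rot_def)

lemma rot_transp: "rot a b \<theta> c r = rot a b (- \<theta>) r c"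
  by (cases "r = a"; cases "r = b"; cases "c = a"; cases "c = b") (simp_all add: rot_def)

lemma rotgen_skew: "rotgen a b c r = - rotgen a b r c"
  by (simp add: rotgen_def conj_commute)

lemma rot_sum:
  assumes "a < N" "b < N" "r < N"
  shows "(\<Sum>m<N. rot a b \<theta> r m * x m) = (if a \<noteq> b \<and> r = a then cos \<theta> * x a + sin \<theta> * x b
     else if a \<noteq> b \<and> r = b then cos \<theta> * x b + - sin \<theta> * x a else x r)"
proof -
  have *: "(\<Sum>m<N. (p * of_bool (m = u) + q * of_bool (m = v)) * x m) = p * x u + q * x v"
    if "u < N" "v < N" for p q u v
  proof -
    have "(\<Sum>m<N. (p * of_bool (m = u) + q * of_bool (m = v)) * x m)
      = (\<Sum>m<N. if m = u then p * x u else 0) + (\<Sum>m<N. if m = v then q * x v else 0)"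
      unfolding sum.distrib[symmetric] by (rule sum.cong) (auto simp: distrib_right)
    then show ?thesis using that by simp
  qed
  have **: "(\<Sum>m<N. of_bool (m = r) * x m) = x r" using *[OF assms(3,3), of 1 0] by simp
  show ?thesis
  proof (cases "a \<noteq> b \<and> r = a")
    case True
    show ?thesis unfolding rot_def if_P[OF True] by (rule *[OF assms(1,2)])
  next
    case F: False
    show ?thesis
    proof (cases "a \<noteq> b \<and> r = b")
      case True
      show ?thesis unfolding rot_def if_not_P[OF F] if_P[OF True] by (rule *[OF assms(2,1)])
    next
      case False
      show ?thesis unfolding rot_def if_not_P[OF F] if_not_P[OF False] by (rule **)
    qed
  qed
qed

lemma rot_rows:
  assumes "a < N" "b < N" "r < N" "c < N"
  shows "(\<Sum>m<N. rot a b \<theta> r m * rot a b \<theta> c m) = (if r = c then 1 else 0)"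
proof -
  have "cos \<theta> * cos \<theta> + sin \<theta> * sin \<theta> = 1" using sin_cos_squared_add3 by simp
  then show ?thesis
    unfolding rot_sum[OF assms(1-3)]
    by (cases "r = a"; cases "r = b"; cases "c = a"; cases "c = b") (simp_all add: rot_def add.commute)
qed

lemma rot_cols:
  assumes "a < N" "b < N" "r < N" "c < N"
  shows "(\<Sum>m<N. rot a b \<theta> m r * rot a b \<theta> m c) = (if r = c then 1 else 0)"
  using rot_rows[OF assms, of "- \<theta>"] by (simp add: rot_transp[of a b \<theta>])

lemma rot_derivative:
  "((\<lambda>\<theta>. complex_of_real (rot a b \<theta> r c)) has_vector_derivative rotgen a b r c) (at 0)"
proof -
  have "((\<lambda>\<theta>. complex_of_real (cos \<theta>)) has_vector_derivative of_real (- sin 0)) (at 0)"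
    "((\<lambda>\<theta>. complex_of_real (sin \<theta>)) has_vector_derivative of_real (cos 0)) (at 0)"
    "((\<lambda>\<theta>. complex_of_real (- sin \<theta>)) has_vector_derivative of_real (- cos 0)) (at 0)"
    by (intro has_vector_derivative_of_real; auto intro!: derivative_eq_intros)+
  then show ?thesis
    unfolding rot_def rotgen_def
    by (cases "r = a"; cases "r = b"; cases "c = a"; cases "c = b") simp_all
qed

section \<open>Orthogonal conjugation of one family and its effect on polynomials\<close>

definition cof :: "(nat \<Rightarrow> nat \<Rightarrow> real) \<Rightarrow> cmat" where
  "cof Q = (\<lambda>r c. of_real (Q r c))"

lemma orth_conj_matmul: "orth_conj N Q A = matmul N (cof Q) (matmul N A (mtransp (cof Q)))"
  by (simp add: orth_conj_def matmul_def cof_def mtransp_def sum_distrib_left mult.assoc)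

lemma orth_conj_mtransp: "orth_conj N Q (mtransp A) = mtransp (orth_conj N Q A)"
  unfolding orth_conj_matmul by (simp add: mtransp_matmul matmul_assoc)

text \<open>Multiplicativity of conjugation needs Q^t Q = 1, while \<open>real_orthogonal\<close>
  speaks of Q Q^t. For rotations both are checked directly, with no appeal to one-sided inverses of
  square matrices.\<close>

definition bi_orthogonal :: "nat \<Rightarrow> (nat \<Rightarrow> nat \<Rightarrow> real) \<Rightarrow> bool" where
  "bi_orthogonal N Q \<longleftrightarrow> meq N (matmul N (cof Q) (mtransp (cof Q))) idmat \<and>
     meq N (matmul N (mtransp (cof Q)) (cof Q)) idmat"

lemma bi_orthogonal_rot:
  assumes "a < N" "b < N"
  shows "bi_orthogonal N (rot a b \<theta>)" "real_orthogonal N (rot a b \<theta>)"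
proof -
  show "bi_orthogonal N (rot a b \<theta>)"
    unfolding bi_orthogonal_def meq_def
  proof (intro conjI allI impI)
    fix r c assume rc: "r < N" "c < N"
    have "matmul N (cof (rot a b \<theta>)) (mtransp (cof (rot a b \<theta>))) r c
       = of_real (\<Sum>m<N. rot a b \<theta> r m * rot a b \<theta> c m)"
      by (simp add: matmul_def mtransp_def cof_def)
    then show "matmul N (cof (rot a b \<theta>)) (mtransp (cof (rot a b \<theta>))) r c = idmat r c"
      unfolding rot_rows[OF assms rc] by (simp add: idmat_def)
    have "matmul N (mtransp (cof (rot a b \<theta>))) (cof (rot a b \<theta>)) r c
       = of_real (\<Sum>m<N. rot a b \<theta> m r * rot a b \<theta> m c)"
      by (simp add: matmul_def mtransp_def cof_def)
    then show "matmul N (mtransp (cof (rot a b \<theta>))) (cof (rot a b \<theta>)) r c = idmat r c"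
      unfolding rot_cols[OF assms rc] by (simp add: idmat_def)
  qed
  show "real_orthogonal N (rot a b \<theta>)"
    by (simp add: real_orthogonal_def rot_rows[OF assms])
qed

lemma orth_conj_mult:
  assumes "bi_orthogonal N Q"
  shows "meq N (matmul N (orth_conj N Q A) (orth_conj N Q B)) (orth_conj N Q (matmul N A B))"
proof -
  let ?Q = "cof Q" and ?T = "mtransp (cof Q)"
  have 1: "matmul N (orth_conj N Q A) (orth_conj N Q B) =
      matmul N ?Q (matmul N A (matmul N (matmul N ?T ?Q) (matmul N B ?T)))"
    by (simp add: orth_conj_matmul matmul_assoc)
  have 2: "meq N (matmul N ?Q (matmul N A (matmul N (matmul N ?T ?Q) (matmul N B ?T))))
      (matmul N ?Q (matmul N A (matmul N idmat (matmul N B ?T))))"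
    by (rule meq_matmul[OF meq_refl meq_matmul[OF meq_refl meq_matmul[OF _ meq_refl]]])
       (use assms in \<open>simp add: bi_orthogonal_def\<close>)
  have 3: "meq N (matmul N ?Q (matmul N A (matmul N idmat (matmul N B ?T))))
      (matmul N ?Q (matmul N A (matmul N B ?T)))"
    by (rule meq_matmul[OF meq_refl meq_matmul[OF meq_refl matmul_idmat(1)]])
  show ?thesis
    unfolding 1 using meq_trans[OF 2 3] by (simp add: orth_conj_matmul matmul_assoc)
qed

lemma orth_conj_idmat:
  assumes "bi_orthogonal N Q"
  shows "meq N (orth_conj N Q idmat) idmat"
proof -
  have "meq N (orth_conj N Q idmat) (matmul N (cof Q) (mtransp (cof Q)))"
    unfolding orth_conj_matmul by (rule meq_matmul[OF meq_refl matmul_idmat(1)])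
  also have "meq N \<dots> idmat" using assms by (simp add: bi_orthogonal_def)
  finally show ?thesis .
qed

lemma orth_conj_cong: "meq N A B \<Longrightarrow> orth_conj N Q A = orth_conj N Q B"
  by (simp add: orth_conj_def meq_def)

definition conj_at :: "nat \<Rightarrow> (nat \<Rightarrow> nat \<Rightarrow> real) \<Rightarrow> nat \<Rightarrow> (nat \<Rightarrow> nat \<Rightarrow> cmat) \<Rightarrow> nat \<Rightarrow> nat \<Rightarrow> cmat" where
  "conj_at N Q j Z = Z(j := \<lambda>i. orth_conj N Q (Z j i))"

text \<open>Conjugation by a real orthogonal matrix is multiplicative and commutes with the
  transpose, so transposed letters behave like the others.\<close>

lemma word_eval_conj_at:
  assumes "bi_orthogonal N Q" "set w \<subseteq> fam_letters k j"
  shows "meq N (word_eval N (gen0 (conj_at N Q j Z)) w) (orth_conj N Q (word_eval N (gen0 Z) w))"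
  using assms(2)
proof (induction w)
  case Nil
  then show ?case using orth_conj_idmat[OF assms(1)] meq_sym by simp
next
  case (Cons l w)
  have l: "gen0 (conj_at N Q j Z) l = orth_conj N Q (gen0 Z l)"
    using Cons.prems by (auto simp: gen0_def conj_at_def fam_letters_def orth_conj_mtransp)
  have "meq N (word_eval N (gen0 (conj_at N Q j Z)) (l # w))
     (matmul N (orth_conj N Q (gen0 Z l)) (orth_conj N Q (word_eval N (gen0 Z) w)))"
    using Cons by (simp add: l meq_matmul)
  also have "meq N \<dots> (orth_conj N Q (word_eval N (gen0 Z) (l # w)))"
    using orth_conj_mult[OF assms(1)] by simp
  finally show ?case .
qed

lemma poly_eval_conj_at:
  assumes "bi_orthogonal N Q" "poly_in (fam_letters k j) p"
  shows "meq N (poly_eval N (gen0 (conj_at N Q j Z)) p) (orth_conj N Q (poly_eval N (gen0 Z) p))"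
  unfolding meq_def
proof (intro allI impI)
  fix r c assume rc: "r < N" "c < N"
  have "poly_eval N (gen0 (conj_at N Q j Z)) p r c = (\<Sum>w\<in>supp p. p w * orth_conj N Q (word_eval N (gen0 Z) w) r c)"
    unfolding poly_eval_def supp_def[symmetric] using assms(2)
    by (intro sum.cong refl arg_cong2[of _ _ _ _ "(*)"] meqD[OF word_eval_conj_at[OF assms(1)] rc])
       (auto simp: poly_in_iff)
  also have "\<dots> = (\<Sum>w\<in>supp p. \<Sum>a<N. \<Sum>b<N. of_real (Q r a) * (p w * word_eval N (gen0 Z) w a b) * of_real (Q c b))"
    by (simp add: orth_conj_def sum_distrib_left mult_ac)
  also have "\<dots> = (\<Sum>a<N. \<Sum>w\<in>supp p. \<Sum>b<N. of_real (Q r a) * (p w * word_eval N (gen0 Z) w a b) * of_real (Q c b))"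
    by (rule sum.swap)
  also have "\<dots> = (\<Sum>a<N. \<Sum>b<N. \<Sum>w\<in>supp p. of_real (Q r a) * (p w * word_eval N (gen0 Z) w a b) * of_real (Q c b))"
    by (intro sum.cong refl sum.swap)
  also have "\<dots> = orth_conj N Q (poly_eval N (gen0 Z) p) r c"
    by (simp add: orth_conj_def poly_eval_def supp_def sum_distrib_left sum_distrib_right)
  finally show "poly_eval N (gen0 (conj_at N Q j Z)) p r c = orth_conj N Q (poly_eval N (gen0 Z) p) r c" .
qed

lemma poly_eval_conj_at_other:
  assumes "poly_in (fam_letters k j') p" "j' \<noteq> j"
  shows "poly_eval N (gen0 (conj_at N Q j Z)) p = poly_eval N (gen0 Z) p"
proof -
  have "word_eval N (gen0 (conj_at N Q j Z)) w = word_eval N (gen0 Z) w" if "w \<in> supp p" for w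
  proof -
    have "set w \<subseteq> fam_letters k j'" using that assms by (auto simp: poly_in_iff)
    then show ?thesis unfolding word_eval_mprod
      by (intro arg_cong[of _ _ "mprod N"] map_cong)
         (use assms(2) in \<open>auto simp: gen0_def conj_at_def fam_letters_def\<close>)
  qed
  then show ?thesis unfolding poly_eval_def supp_def[symmetric] by simp
qed

text \<open>For \<open>r = a\<close> and \<open>c = b\<close> the right-hand side is P_aa S_bb -
  P_ab S_ab; its sum over a and b is Tr P Tr S - Tr(P S^t).\<close>

lemma matmul_rotgen:
  assumes "a < N" "b < N"
  shows "matmul N P (matmul N (rotgen a b) S) r c = P r a * S b c - P r b * S a c"
proof -
  have "matmul N (rotgen a b) S x c = of_bool (x = a) * S b c - of_bool (x = b) * S a c" for x
  proof -
    have "matmul N (rotgen a b) S x c =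
        (\<Sum>y<N. if y = b then of_bool (x = a) * S b c else 0) - (\<Sum>y<N. if y = a then of_bool (x = b) * S a c else 0)"
      unfolding matmul_def rotgen_def sum_subtractf[symmetric] by (rule sum.cong) auto
    then show ?thesis using assms by simp
  qed
  then have "matmul N P (matmul N (rotgen a b) S) r c =
     (\<Sum>x<N. if x = a then P r a * S b c else 0) - (\<Sum>x<N. if x = b then P r b * S a c else 0)"
    unfolding matmul_def[of N P] sum_subtractf[symmetric] by (intro sum.cong) auto
  then show ?thesis using assms by simp
qed

lemma orth_conj_rot_zero: "meq N (orth_conj N (rot a b 0) A) A"
proof -
  have "cof (rot a b 0) = idmat" by (intro ext) (simp add: cof_def idmat_def rot_zero)
  then show ?thesis
    unfolding orth_conj_matmul by (simp add: meq_trans[OF matmul_idmat(1) matmul_idmat(2)])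
qed

section \<open>Loop equation for a random matrix ensemble\<close>

locale ensemble = prob_space M for M :: "'a measure" +
  fixes N :: nat and X :: "nat \<Rightarrow> nat \<Rightarrow> 'a \<Rightarrow> cmat" and s :: nat and k :: "nat \<Rightarrow> nat"
  assumes meas: "\<And>j i r c. j < s \<Longrightarrow> i < k j \<Longrightarrow> r < N \<Longrightarrow> c < N \<Longrightarrow>
      (\<lambda>\<omega>. X j i \<omega> r c) \<in> borel_measurable M"
    and moments: "\<And>j i r c q. j < s \<Longrightarrow> i < k j \<Longrightarrow> r < N \<Longrightarrow> c < N \<Longrightarrow>
      integrable M (\<lambda>\<omega>. norm (X j i \<omega> r c) ^ q)"
    and indep: "indep_sets (\<lambda>j. entry_sigma M N (k j) (X j)) {..<s}"
begin

section \<open>Joint law of the entries and independence of the families\<close>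

abbreviation Z :: "'a \<Rightarrow> nat \<Rightarrow> nat \<Rightarrow> cmat" where
  "Z \<omega> \<equiv> (\<lambda>j i. X j i \<omega>)"

definition idx :: "nat \<Rightarrow> (nat \<times> nat \<times> nat) set" where
  "idx j = {..<k j} \<times> {..<N} \<times> {..<N}"

abbreviation vecM :: "nat \<Rightarrow> (nat \<times> nat \<times> nat \<Rightarrow> complex) measure" where
  "vecM j \<equiv> Pi\<^sub>M (idx j) (\<lambda>_. borel)"

definition vec :: "nat \<Rightarrow> (nat \<Rightarrow> cmat) \<Rightarrow> nat \<times> nat \<times> nat \<Rightarrow> complex" where
  "vec j Y = (\<lambda>t\<in>idx j. case t of (i, r, c) \<Rightarrow> Y i r c)"

text \<open>Laws live on product spaces indexed by the relevant entries only, whereas matrices are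
  total functions. Encoding forgets all other entries; a function depending on the relevant ones
  alone is recovered through \<open>dec\<close>.\<close>

definition enc :: "nat set \<Rightarrow> (nat \<Rightarrow> nat \<Rightarrow> cmat) \<Rightarrow> nat \<Rightarrow> nat \<times> nat \<times> nat \<Rightarrow> complex" where
  "enc J Y = (\<lambda>j\<in>J. vec j (Y j))"

definition dec :: "(nat \<Rightarrow> nat \<times> nat \<times> nat \<Rightarrow> complex) \<Rightarrow> nat \<Rightarrow> nat \<Rightarrow> cmat" where
  "dec v = (\<lambda>j i r c. v j (i, r, c))"

lemma vec_measurable:
  assumes "\<And>i r c. i < k j \<Longrightarrow> r < N \<Longrightarrow> c < N \<Longrightarrow> (\<lambda>\<omega>. Y \<omega> i r c) \<in> borel_measurable M'"
  shows "(\<lambda>\<omega>. vec j (Y \<omega>)) \<in> measurable M' (vecM j)"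
  unfolding vec_def
  by (rule measurable_restrict) (use assms in \<open>auto simp: idx_def\<close>)

lemma vec_cong: "(\<And>i. i < k j \<Longrightarrow> Y i = Y' i) \<Longrightarrow> vec j Y = vec j Y'"
  by (auto simp: vec_def idx_def restrict_def)

text \<open>The vector of entries is measurable for the sigma-algebra generated by the entries, so
  its preimages lie in \<open>entry_sigma\<close>, and independence passes to smaller set
  systems.\<close>

lemma indep_vec: "indep_vars vecM (\<lambda>j \<omega>. vec j (\<lambda>i. X j i \<omega>)) {..<s}"
  unfolding indep_vars_def2
proof (intro conjI ballI)
  fix j assume "j \<in> {..<s}"
  then show "random_variable (vecM j) (\<lambda>\<omega>. vec j (\<lambda>i. X j i \<omega>))"
    by (intro vec_measurable meas) auto
next
  show "indep_sets (\<lambda>j. {(\<lambda>\<omega>. vec j (\<lambda>i. X j i \<omega>)) -` A \<inter> space M |A. A \<in> sets (vecM j)}) {..<s}"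
  proof (rule indep_sets_mono_sets[OF indep], safe)
    fix j and A assume A: "A \<in> sets (vecM j)"
    define G where "G = (\<Union>i<k j. \<Union>r<N. \<Union>c<N. {(\<lambda>\<omega>. X j i \<omega> r c) -` B \<inter> space M | B. B \<in> sets (borel :: complex measure)})"
    have G: "G \<subseteq> Pow (space M)" unfolding G_def by blast
    have *: "(\<lambda>\<omega>. vec j (\<lambda>i. X j i \<omega>)) \<in> measurable (sigma (space M) G) (vecM j)"
    proof (rule vec_measurable)
      fix i r c assume "i < k j" "r < N" "c < N"
      then have "(\<lambda>\<omega>. X j i \<omega> r c) -` B \<inter> space M \<in> G" if "B \<in> sets borel" for B
        using that unfolding G_def by blast
      then show "(\<lambda>\<omega>. X j i \<omega> r c) \<in> borel_measurable (sigma (space M) G)"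
        by (intro measurableI) (auto simp: space_measure_of[OF G] sets_measure_of[OF G])
    qed
    have "(\<lambda>\<omega>. vec j (\<lambda>i. X j i \<omega>)) -` A \<inter> space M \<in> sets (sigma (space M) G)"
      using measurable_sets[OF * A] by (simp add: space_measure_of[OF G])
    then show "(\<lambda>\<omega>. vec j (\<lambda>i. X j i \<omega>)) -` A \<inter> space M \<in> entry_sigma M N (k j) (X j)"
      unfolding sets_measure_of[OF G] by (simp add: entry_sigma_def G_def)
  qed
qed

text \<open>F depends only on the entries of the families in J, measurably, and has finite moments.\<close>
definition nice :: "nat set \<Rightarrow> ((nat \<Rightarrow> nat \<Rightarrow> cmat) \<Rightarrow> complex) \<Rightarrow> bool" where
  "nice J F \<longleftrightarrow> (\<forall>Y. F (dec (enc J Y)) = F Y) \<and> (\<lambda>v. F (dec v)) \<in> borel_measurable (Pi\<^sub>M J vecM)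
     \<and> (\<lambda>\<omega>. F (Z \<omega>)) \<in> Lall M"

lemma nice_entry:
  assumes "j \<in> J" "j < s" "i < k j" "r < N" "c < N"
  shows "nice J (\<lambda>Y. Y j i r c)"
proof -
  have "(i, r, c) \<in> idx j" using assms by (auto simp: idx_def)
  then have "(\<lambda>v. v j (i, r, c)) \<in> borel_measurable (Pi\<^sub>M J vecM)"
    using assms(1) by (intro measurable_compose[OF measurable_component_singleton[of j J vecM]]
        measurable_component_singleton) auto
  then show ?thesis
    using assms meas moments by (auto simp: nice_def dec_def enc_def vec_def idx_def Lall_def)
qed

lemma nice_const: "nice J (\<lambda>_. c)"
  by (simp add: nice_def Lall_const)

lemma nice_add: "nice J F \<Longrightarrow> nice J G \<Longrightarrow> nice J (\<lambda>Y. F Y + G Y)"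
  by (auto simp: nice_def intro: Lall_add)

lemma nice_mult: "nice J F \<Longrightarrow> nice J G \<Longrightarrow> nice J (\<lambda>Y. F Y * G Y)"
  by (auto simp: nice_def intro: Lall_mult)

lemma nice_sum: "(\<And>i. i \<in> I \<Longrightarrow> nice J (F i)) \<Longrightarrow> nice J (\<lambda>Y. \<Sum>i\<in>I. F i Y)"
  by (induction I rule: infinite_finite_induct) (auto intro: nice_add nice_const)

lemma nice_prod_list: "(\<And>x. x \<in> set xs \<Longrightarrow> nice J (F x)) \<Longrightarrow> nice J (\<lambda>Y. \<Prod>x\<leftarrow>xs. F x Y)"
  by (induction xs) (auto intro: nice_mult nice_const)

lemma nice_Lall: "nice J F \<Longrightarrow> (\<lambda>\<omega>. F (Z \<omega>)) \<in> Lall M"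
  by (simp add: nice_def)

lemma nice_word_eval:
  assumes "set w \<subseteq> (\<Union>j\<in>J. fam_letters k j)" "J \<subseteq> {..<s}" "r < N" "c < N"
  shows "nice J (\<lambda>Y. word_eval N (gen0 Y) w r c)"
  using assms(1,3)
proof (induction w arbitrary: r)
  case Nil
  then show ?case by (simp add: nice_const)
next
  case (Cons l w)
  obtain j i b where l: "l = (j, i, b)" by (cases l) auto
  have j: "j \<in> J" "i < k j" "j < s" using Cons.prems assms(2) by (auto simp: l fam_letters_def)
  have "nice J (\<lambda>Y. gen0 Y l r m)" if "m < N" for m
    using j that Cons.prems by (cases b) (auto simp: l gen0_def mtransp_def intro!: nice_entry)
  then show ?case using Cons by (auto simp: matmul_def intro!: nice_sum nice_mult)
qed

lemma nice_poly_eval: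
  assumes "poly_in (\<Union>j\<in>J. fam_letters k j) p" "J \<subseteq> {..<s}" "r < N" "c < N"
  shows "nice J (\<lambda>Y. poly_eval N (gen0 Y) p r c)"
  unfolding poly_eval_def
  by (intro nice_sum nice_mult nice_const nice_word_eval) (use assms in \<open>auto simp: poly_in_def\<close>)

definition okb :: "block \<Rightarrow> bool" where
  "okb b \<longleftrightarrow> fst b < s \<and> poly_in (fam_letters k (fst b)) (snd b)"

lemma nice_block:
  assumes "okb b" "fst b \<in> J" "J \<subseteq> {..<s}" "r < N" "c < N"
  shows "nice J (\<lambda>Y. poly_eval N (gen0 Y) (snd b) r c)"
  by (rule nice_poly_eval) (use assms in \<open>auto simp: okb_def intro: poly_in_mono\<close>)

lemma nice_bmat:
  assumes "\<forall>b\<in>set w. okb b \<and> fst b \<in> J" "J \<subseteq> {..<s}" "r < N" "c < N"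
  shows "nice J (\<lambda>Y. bmat N Y w r c)"
  using assms(1,3)
proof (induction w arbitrary: r)
  case Nil
  then show ?case by (simp add: bmat_def nice_const)
next
  case (Cons b w)
  then show ?case using assms(2,4)
    by (auto simp: bmat_def matmul_def intro!: nice_sum nice_mult nice_block)
qed

lemma nice_btr:
  assumes "\<forall>b\<in>set w. okb b \<and> fst b \<in> J" "J \<subseteq> {..<s}"
  shows "nice J (\<lambda>Y. btr N Y w)"
  unfolding btr_def mTrace_def by (intro nice_sum nice_bmat assms) auto

lemma vec_conj_measurable:
  "(\<lambda>v. vec j (\<lambda>i. orth_conj N Q (\<lambda>r c. v (i, r, c)))) \<in> measurable (vecM j) (vecM j)"
proof (rule vec_measurable)
  fix i r c assume "i < k j" "r < N" "c < N"
  show "(\<lambda>v. orth_conj N Q (\<lambda>r c. v (i, r, c)) r c) \<in> borel_measurable (vecM j)"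
    unfolding orth_conj_def
    by (intro borel_measurable_sum borel_measurable_times borel_measurable_const measurable_component_singleton)
       (use \<open>i < k j\<close> in \<open>auto simp: idx_def\<close>)
qed

text \<open>By independence the joint law of all entries is the product of the laws of the families.
  Conjugation changes one factor only, and invariance says that this factor is unchanged.\<close>

lemma invariance:
  assumes F: "nice {..<s} F" and j0: "j0 < s" and inv: "orth_invariant M N (k j0) (X j0)"
    and Q: "real_orthogonal N Q"
  shows "(\<integral>\<omega>. F (conj_at N Q j0 (Z \<omega>)) \<partial>M) = (\<integral>\<omega>. F (Z \<omega>) \<partial>M)"
proof -
  let ?S = "{..<s}"
  let ?V = "\<lambda>j \<omega>. vec j (\<lambda>i. X j i \<omega>)"
  let ?V' = "\<lambda>j \<omega>. vec j (conj_at N Q j0 (Z \<omega>) j)"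
  \<comment> \<open>\<open>T\<close> acts on each family separately, so the conjugated vectors are
    functions of independent vectors and stay independent.\<close>
  define T where "T j = (if j = j0 then \<lambda>v. vec j (\<lambda>i. orth_conj N Q (\<lambda>r c. v (i, r, c))) else (\<lambda>v. v))" for j
  have TV: "?V' j = (\<lambda>\<omega>. T j (?V j \<omega>))" if "j < s" for j
  proof (rule ext)
    fix \<omega>
    show "?V' j \<omega> = T j (?V j \<omega>)"
    proof (cases "j = j0")
      case True
      have "orth_conj N Q (X j0 i \<omega>) = orth_conj N Q (\<lambda>r c. vec j0 (\<lambda>i. X j0 i \<omega>) (i, r, c))" if "i < k j0" for i
        by (rule orth_conj_cong) (use that in \<open>auto simp: meq_def vec_def idx_def\<close>)
      then show ?thesis
        by (simp add: True T_def conj_at_def) (rule vec_cong, simp)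
    qed (auto simp: T_def conj_at_def)
  qed
  have Tm: "T j \<in> measurable (vecM j) (vecM j)" for j
    using vec_conj_measurable by (auto simp: T_def)
  have rvV: "random_variable (vecM j) (?V j)" if "j \<in> ?S" for j
    using indep_vec that unfolding indep_vars_def2 by blast
  have rvV': "random_variable (vecM j) (?V' j)" if "j \<in> ?S" for j
    using TV[of j] measurable_compose[OF rvV[OF that] Tm] that by simp
  have "indep_vars vecM (\<lambda>j \<omega>. T j (?V j \<omega>)) ?S"
    by (rule indep_vars_compose2[OF indep_vec Tm])
  also have "indep_vars vecM (\<lambda>j \<omega>. T j (?V j \<omega>)) ?S \<longleftrightarrow> indep_vars vecM ?V' ?S"
    by (rule indep_vars_cong) (use TV in auto)
  finally have indV': "indep_vars vecM ?V' ?S" .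
  have ne: "?S \<noteq> {}" using j0 by auto
  have law: "distr M (vecM j) (?V' j) = distr M (vecM j) (?V j)" if "j \<in> ?S" for j
  proof (cases "j = j0")
    case True
    have "entries_law M N (k j0) (\<lambda>i \<omega>. orth_conj N Q (X j0 i \<omega>)) = entries_law M N (k j0) (X j0)"
      using inv Q by (simp add: orth_invariant_def)
    then show ?thesis unfolding entries_law_def True vec_def conj_at_def idx_def by simp
  qed (simp add: conj_at_def)
  have "distr M (Pi\<^sub>M ?S vecM) (\<lambda>\<omega>. \<lambda>j\<in>?S. ?V' j \<omega>) = (\<Pi>\<^sub>M j\<in>?S. distr M (vecM j) (?V' j))"
    by (rule iffD1[OF indep_vars_iff_distr_eq_PiM'[OF ne] indV']) (rule rvV')
  also have "\<dots> = (\<Pi>\<^sub>M j\<in>?S. distr M (vecM j) (?V j))"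
    by (rule PiM_cong) (use law in auto)
  also have "\<dots> = distr M (Pi\<^sub>M ?S vecM) (\<lambda>\<omega>. \<lambda>j\<in>?S. ?V j \<omega>)"
    by (rule sym, rule iffD1[OF indep_vars_iff_distr_eq_PiM'[OF ne] indep_vec]) (rule rvV)
  finally have dist: "distr M (Pi\<^sub>M ?S vecM) (\<lambda>\<omega>. enc ?S (conj_at N Q j0 (Z \<omega>))) =
      distr M (Pi\<^sub>M ?S vecM) (\<lambda>\<omega>. enc ?S (Z \<omega>))" by (simp add: enc_def)
  have m: "(\<lambda>\<omega>. enc ?S (conj_at N Q j0 (Z \<omega>))) \<in> measurable M (Pi\<^sub>M ?S vecM)"
    "(\<lambda>\<omega>. enc ?S (Z \<omega>)) \<in> measurable M (Pi\<^sub>M ?S vecM)"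
    unfolding enc_def by (intro measurable_restrict rvV rvV'; simp)+
  have Fm: "(\<lambda>v. F (dec v)) \<in> borel_measurable (Pi\<^sub>M ?S vecM)" and Fd: "\<And>Y. F (dec (enc ?S Y)) = F Y"
    using F by (auto simp: nice_def)
  have "(\<integral>\<omega>. F (conj_at N Q j0 (Z \<omega>)) \<partial>M) = (\<integral>v. F (dec v) \<partial>distr M (Pi\<^sub>M ?S vecM) (\<lambda>\<omega>. enc ?S (conj_at N Q j0 (Z \<omega>))))"
    using integral_distr[OF m(1) Fm] Fd by simp
  also have "\<dots> = (\<integral>\<omega>. F (Z \<omega>) \<partial>M)"
    unfolding dist using integral_distr[OF m(2) Fm] Fd by simp
  finally show ?thesis .
qed

lemma indep_families:
  assumes J: "J \<subseteq> {..<s}" and F: "\<And>j. j \<in> J \<Longrightarrow> nice {j} (F j)"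
  shows "(\<integral>\<omega>. (\<Prod>j\<in>J. F j (Z \<omega>)) \<partial>M) = (\<Prod>j\<in>J. \<integral>\<omega>. F j (Z \<omega>) \<partial>M)"
proof (rule indep_vars_lebesgue_integral)
  show "finite J" using J finite_subset by blast
  show "integrable M (\<lambda>\<omega>. F j (Z \<omega>))" if "j \<in> J" for j
    using F[OF that] by (intro Lall_integrable) (simp add: nice_def)
  have "indep_vars (\<lambda>_. borel) (\<lambda>j \<omega>. (\<lambda>v. F j (dec (\<lambda>_\<in>{j}. v))) (vec j (\<lambda>i. X j i \<omega>))) J"
  proof (rule indep_vars_compose2[OF indep_vars_subset[OF indep_vec J]])
    fix j assume j: "j \<in> J"
    have "(\<lambda>v. \<lambda>i\<in>{j}. v) \<in> measurable (vecM j) (Pi\<^sub>M {j} vecM)"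
      by (rule measurable_restrict) auto
    then show "(\<lambda>v. F j (dec (\<lambda>_\<in>{j}. v))) \<in> borel_measurable (vecM j)"
      by (rule measurable_compose) (use F[OF j] in \<open>simp add: nice_def\<close>)
  qed
  moreover have "F j (dec (\<lambda>_\<in>{j}. vec j (\<lambda>i. X j i \<omega>))) = F j (Z \<omega>)" if "j \<in> J" for j \<omega>
  proof -
    have "(\<lambda>_\<in>{j}. vec j (\<lambda>i. X j i \<omega>)) = enc {j} (Z \<omega>)" by (auto simp: enc_def restrict_def)
    then show ?thesis using F[OF that] by (simp add: nice_def)
  qed
  ultimately show "indep_vars (\<lambda>_. borel) (\<lambda>j \<omega>. F j (Z \<omega>)) J"
    by (subst indep_vars_cong[OF refl _ refl]) auto
qed

lemma nice_prod: "(\<And>i. i \<in> I \<Longrightarrow> nice J (F i)) \<Longrightarrow> nice J (\<lambda>Y. \<Prod>i\<in>I. F i Y)"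
  by (induction I rule: infinite_finite_induct) (auto intro: nice_mult nice_const)

lemma btr_integrable: "\<forall>b\<in>set w. okb b \<Longrightarrow> integrable M (\<lambda>\<omega>. btr N (Z \<omega>) w)"
  by (rule Lall_integrable[OF nice_Lall[OF nice_btr[of _ "{..<s}"]]]) (auto simp: okb_def)

lemma poly_eval_conj_zero:
  assumes "okb b" "a < N" "a' < N"
  shows "meq N (poly_eval N (gen0 (conj_at N (rot a a' 0) j (Z \<omega>))) (snd b)) (poly_eval N (gen0 (Z \<omega>)) (snd b))"
proof (cases "fst b = j")
  case True
  have "meq N (poly_eval N (gen0 (conj_at N (rot a a' 0) j (Z \<omega>))) (snd b))
      (orth_conj N (rot a a' 0) (poly_eval N (gen0 (Z \<omega>)) (snd b)))"
    by (rule poly_eval_conj_at[of _ _ k]) (use bi_orthogonal_rot assms True in \<open>auto simp: okb_def\<close>)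
  then show ?thesis using orth_conj_rot_zero meq_trans by blast
next
  case False
  then show ?thesis
    using assms(1) poly_eval_conj_at_other[of k "fst b" "snd b" j N "rot a a' 0" "Z \<omega>"] by (simp add: okb_def)
qed

lemma bmat_conj_zero:
  assumes "\<forall>b\<in>set w. okb b" "a < N" "a' < N"
  shows "meq N (bmat N (conj_at N (rot a a' 0) j (Z \<omega>)) w) (bmat N (Z \<omega>) w)"
  unfolding bmat_def by (rule mprod_map_cong) (rule poly_eval_conj_zero, use assms in auto)

text \<open>The derivative of Q A Q^t at the identity is K A + A K^t, which is the commutator of K
  and A because the generator K is skew.\<close>

lemma diffable_block:
  assumes b: "okb b" and N: "a < N" "a' < N" "r < N" "c < N"
  shows "diffable (\<lambda>\<theta> \<omega>. poly_eval N (gen0 (conj_at N (rot a a' \<theta>) j (Z \<omega>))) (snd b) r c)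
    (\<lambda>\<omega>. of_bool (fst b = j) *
       (matmul N (rotgen a a') (poly_eval N (gen0 (Z \<omega>)) (snd b)) r c
      - matmul N (poly_eval N (gen0 (Z \<omega>)) (snd b)) (rotgen a a') r c))"
proof (cases "fst b = j")
  case False
  have L: "(\<lambda>\<omega>. poly_eval N (gen0 (Z \<omega>)) (snd b) r c) \<in> Lall M"
    by (rule nice_Lall[OF nice_block[of _ "{..<s}"]]) (use b N in \<open>auto simp: okb_def\<close>)
  have "poly_eval N (gen0 (conj_at N Q j Y)) (snd b) = poly_eval N (gen0 Y) (snd b)" for Q Y
    by (rule poly_eval_conj_at_other[of k "fst b"]) (use b False in \<open>auto simp: okb_def\<close>)
  then show ?thesis by (intro diffable_cong[OF diffable_random[OF L]]) (auto simp: False)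
next
  case True
  define A where "A \<omega> = poly_eval N (gen0 (Z \<omega>)) (snd b)" for \<omega>
  have L: "(\<lambda>\<omega>. A \<omega> x y) \<in> Lall M" if "x < N" "y < N" for x y
    unfolding A_def by (rule nice_Lall[OF nice_block[of _ "{..<s}"]]) (use b that in \<open>auto simp: okb_def\<close>)
  let ?K = "rotgen a a'" and ?q = "\<lambda>\<theta> r c. complex_of_real (rot a a' \<theta> r c)"
  have d: "diffable (\<lambda>\<theta> \<omega>. \<Sum>x<N. \<Sum>y<N. ?q \<theta> r x * A \<omega> x y * ?q \<theta> c y)
     (\<lambda>\<omega>. \<Sum>x<N. \<Sum>y<N. (?K r x * A \<omega> x y + ?q 0 r x * 0) * ?q 0 c y + (?q 0 r x * A \<omega> x y) * ?K c y)"
    by (intro diffable_sum diffable_mult[OF diffable_mult[OF diffable_fun[OF rot_derivative] diffable_random] diffable_fun[OF rot_derivative]] L) auto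
  show ?thesis
  proof (rule diffable_cong[OF d])
    fix \<theta> \<omega>
    have "poly_eval N (gen0 (conj_at N (rot a a' \<theta>) j (Z \<omega>))) (snd b) r c = orth_conj N (rot a a' \<theta>) (A \<omega>) r c"
      unfolding A_def
      by (rule meqD[OF poly_eval_conj_at[of _ _ k]]) (use bi_orthogonal_rot b N True in \<open>auto simp: okb_def\<close>)
    then show "poly_eval N (gen0 (conj_at N (rot a a' \<theta>) j (Z \<omega>))) (snd b) r c =
      (\<Sum>x<N. \<Sum>y<N. ?q \<theta> r x * A \<omega> x y * ?q \<theta> c y)" by (simp add: orth_conj_def)
  next
    fix \<omega>
    have "(\<Sum>x<N. \<Sum>y<N. (?K r x * A \<omega> x y + ?q 0 r x * 0) * ?q 0 c y + (?q 0 r x * A \<omega> x y) * ?K c y)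
      = (\<Sum>x<N. \<Sum>y<N. if c = y then ?K r x * A \<omega> x y else 0) + (\<Sum>x<N. \<Sum>y<N. if r = x then A \<omega> x y * ?K c y else 0)"
      unfolding sum.distrib[symmetric] by (intro sum.cong refl) (simp add: rot_zero)
    also have "(\<Sum>x<N. \<Sum>y<N. if r = x then A \<omega> x y * ?K c y else 0) = (\<Sum>y<N. A \<omega> r y * ?K c y)"
      using N by (subst sum.swap) simp
    also have "(\<Sum>x<N. \<Sum>y<N. if c = y then ?K r x * A \<omega> x y else 0) = matmul N ?K (A \<omega>) r c"
      using N by (simp add: matmul_def)
    also have "(\<Sum>y<N. A \<omega> r y * ?K c y) = - matmul N (A \<omega>) ?K r c"
      by (simp add: matmul_def rotgen_skew[of a a' c] sum_negf)
    finally show "of_bool (fst b = j) * (matmul N ?K (poly_eval N (gen0 (Z \<omega>)) (snd b)) r c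
      - matmul N (poly_eval N (gen0 (Z \<omega>)) (snd b)) ?K r c) =
      (\<Sum>x<N. \<Sum>y<N. (?K r x * A \<omega> x y + ?q 0 r x * 0) * ?q 0 c y + (?q 0 r x * A \<omega> x y) * ?K c y)"
      using True by (simp add: A_def)
  qed
qed

section \<open>Derivative of a word of blocks along a rotation\<close>

definition cutK :: "cmat \<Rightarrow> 'a \<Rightarrow> block list \<Rightarrow> nat \<Rightarrow> cmat" where
  "cutK K \<omega> w i = matmul N (bmat N (Z \<omega>) (take i w)) (matmul N K (bmat N (Z \<omega>) (drop i w)))"

text \<open>The commutator at a block of family \<open>j\<close> inserts \<open>K\<close> before the
  block and subtracts the insertion after it. Thus the Leibniz rule becomes a sum of differences of
  neighbouring cuts.\<close>

definition dbmat :: "nat \<Rightarrow> cmat \<Rightarrow> 'a \<Rightarrow> block list \<Rightarrow> cmat" where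
  "dbmat j K \<omega> w = (\<lambda>r c. \<Sum>i<length w. of_bool (fst (w ! i) = j) * (cutK K \<omega> w i r c - cutK K \<omega> w (Suc i) r c))"

lemma cutK_Cons:
  fixes b \<omega>
  defines "A \<equiv> poly_eval N (gen0 (Z \<omega>)) (snd b)"
  shows "cutK K \<omega> (b # w) (Suc i) = matmul N A (cutK K \<omega> w i)"
    and "meq N (cutK K \<omega> (b # w) 0) (matmul N (matmul N K A) (bmat N (Z \<omega>) w))"
    and "meq N (cutK K \<omega> (b # w) (Suc 0)) (matmul N (matmul N A K) (bmat N (Z \<omega>) w))"
proof -
  show "cutK K \<omega> (b # w) (Suc i) = matmul N A (cutK K \<omega> w i)"
    by (simp add: cutK_def bmat_def A_def matmul_assoc)
  show "meq N (cutK K \<omega> (b # w) 0) (matmul N (matmul N K A) (bmat N (Z \<omega>) w))"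
    using matmul_idmat(1) by (simp add: cutK_def bmat_def A_def matmul_assoc)
  have "meq N (matmul N (matmul N A idmat) (matmul N K (bmat N (Z \<omega>) w))) (matmul N A (matmul N K (bmat N (Z \<omega>) w)))"
    by (rule meq_matmul[OF matmul_idmat(2) meq_refl])
  then show "meq N (cutK K \<omega> (b # w) (Suc 0)) (matmul N (matmul N A K) (bmat N (Z \<omega>) w))"
    by (simp add: cutK_def bmat_def A_def matmul_assoc)
qed

lemma dbmat_Cons:
  assumes "r < N" "c < N"
  defines "A \<equiv> \<lambda>\<omega> b. poly_eval N (gen0 (Z \<omega>)) (snd b)"
  shows "dbmat j K \<omega> (b # w) r c =
     (\<Sum>m<N. of_bool (fst b = j) * (matmul N K (A \<omega> b) r m - matmul N (A \<omega> b) K r m) * bmat N (Z \<omega>) w m c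
        + A \<omega> b r m * dbmat j K \<omega> w m c)"
proof -
  have 1: "(\<Sum>m<N. of_bool (fst b = j) * (matmul N K (A \<omega> b) r m - matmul N (A \<omega> b) K r m) * bmat N (Z \<omega>) w m c)
     = of_bool (fst b = j) * (cutK K \<omega> (b # w) 0 r c - cutK K \<omega> (b # w) (Suc 0) r c)"
    using meqD[OF cutK_Cons(2) assms(1,2)] meqD[OF cutK_Cons(3) assms(1,2)]
    by (simp add: A_def matmul_def[of N "matmul _ _ _"] sum_subtractf[symmetric] left_diff_distrib)
  have "(\<Sum>m<N. A \<omega> b r m * dbmat j K \<omega> w m c) =
      (\<Sum>m<N. \<Sum>i<length w. of_bool (fst (w ! i) = j) * (A \<omega> b r m * cutK K \<omega> w i m c - A \<omega> b r m * cutK K \<omega> w (Suc i) m c))"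
    unfolding dbmat_def sum_distrib_left by (intro sum.cong refl) (simp add: algebra_simps)
  also have "\<dots> = (\<Sum>i<length w. \<Sum>m<N. of_bool (fst (w ! i) = j) * (A \<omega> b r m * cutK K \<omega> w i m c - A \<omega> b r m * cutK K \<omega> w (Suc i) m c))"
    by (rule sum.swap)
  also have "\<dots> = (\<Sum>i<length w. of_bool (fst (w ! i) = j) *
      (cutK K \<omega> (b # w) (Suc i) r c - cutK K \<omega> (b # w) (Suc (Suc i)) r c))"
    unfolding cutK_Cons(1) matmul_def[of N "poly_eval _ _ _"] A_def
    by (intro sum.cong refl) (simp add: sum_subtractf sum_distrib_left[symmetric])
  finally show ?thesis
    unfolding sum.distrib 1 by (simp add: dbmat_def sum.lessThan_Suc_shift del: sum.lessThan_Suc)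
qed

lemma diffable_bmat:
  assumes w: "\<forall>b\<in>set w. okb b" and N: "a < N" "a' < N" "r < N" "c < N"
  shows "diffable (\<lambda>\<theta> \<omega>. bmat N (conj_at N (rot a a' \<theta>) j (Z \<omega>)) w r c) (\<lambda>\<omega>. dbmat j (rotgen a a') \<omega> w r c)"
  using w N(3)
proof (induction w arbitrary: r)
  case Nil
  then show ?case by (simp add: bmat_def dbmat_def diffable_const)
next
  case (Cons b w)
  let ?c = "\<lambda>\<theta> \<omega>. conj_at N (rot a a' \<theta>) j (Z \<omega>)"
  let ?A = "\<lambda>\<omega>. poly_eval N (gen0 (Z \<omega>)) (snd b)" and ?K = "rotgen a a'"
  have d: "diffable (\<lambda>\<theta> \<omega>. \<Sum>m<N. poly_eval N (gen0 (?c \<theta> \<omega>)) (snd b) r m * bmat N (?c \<theta> \<omega>) w m c)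
    (\<lambda>\<omega>. \<Sum>m<N. (of_bool (fst b = j) * (matmul N ?K (?A \<omega>) r m - matmul N (?A \<omega>) ?K r m)) * bmat N (?c 0 \<omega>) w m c
       + poly_eval N (gen0 (?c 0 \<omega>)) (snd b) r m * dbmat j ?K \<omega> w m c)"
    by (intro diffable_sum diffable_mult diffable_block Cons.IH) (use Cons.prems N in auto)
  show ?case
  proof (rule diffable_cong[OF d])
    show "bmat N (?c \<theta> \<omega>) (b # w) r c = (\<Sum>m<N. poly_eval N (gen0 (?c \<theta> \<omega>)) (snd b) r m * bmat N (?c \<theta> \<omega>) w m c)" for \<theta> \<omega>
      by (simp add: bmat_def matmul_def)
    fix \<omega>
    have "meq N (bmat N (?c 0 \<omega>) w) (bmat N (Z \<omega>) w)" "meq N (poly_eval N (gen0 (?c 0 \<omega>)) (snd b)) (?A \<omega>)"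
      by (intro bmat_conj_zero poly_eval_conj_zero; use Cons.prems N in simp)+
    then show "dbmat j ?K \<omega> (b # w) r c = (\<Sum>m<N. (of_bool (fst b = j) * (matmul N ?K (?A \<omega>) r m - matmul N (?A \<omega>) ?K r m)) * bmat N (?c 0 \<omega>) w m c
       + poly_eval N (gen0 (?c 0 \<omega>)) (snd b) r m * dbmat j ?K \<omega> w m c)"
      unfolding dbmat_Cons[OF Cons.prems(2) N(4)]
      by (intro sum.cong refl) (use Cons.prems N in \<open>simp add: meq_def\<close>)
  qed
qed

text \<open>Differentiating the entry (a, a') along the plane (a, a') is what makes the contraction
  close: each insertion of the generator becomes a product of two traces minus one trace with a
  transpose.\<close>

lemma sum_dbmat:
  "(\<Sum>a<N. \<Sum>a'<N. dbmat j (rotgen a a') \<omega> w a a') =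
    (\<Sum>i<length w. of_bool (fst (w ! i) = j) *
       ((btr N (Z \<omega>) (take i w) * btr N (Z \<omega>) (drop i w) - btr N (Z \<omega>) (take i w @ map tpb (rev (drop i w))))
      - (btr N (Z \<omega>) (take (Suc i) w) * btr N (Z \<omega>) (drop (Suc i) w)
          - btr N (Z \<omega>) (take (Suc i) w @ map tpb (rev (drop (Suc i) w))))))"
proof -
  have g: "(\<Sum>a<N. \<Sum>a'<N. cutK (rotgen a a') \<omega> w i a a') =
      btr N (Z \<omega>) (take i w) * btr N (Z \<omega>) (drop i w) - btr N (Z \<omega>) (take i w @ map tpb (rev (drop i w)))" for i
  proof -
    let ?P = "bmat N (Z \<omega>) (take i w)" and ?S = "bmat N (Z \<omega>) (drop i w)"
    have "(\<Sum>a<N. \<Sum>a'<N. cutK (rotgen a a') \<omega> w i a a') =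
        (\<Sum>a<N. \<Sum>a'<N. ?P a a * ?S a' a' - ?P a a' * ?S a a')"
      by (intro sum.cong refl) (simp add: cutK_def matmul_rotgen)
    then show ?thesis
      unfolding btr_append_tp by (simp add: btr_def mTrace_def sum_subtractf sum_product)
  qed
  have "(\<Sum>a<N. \<Sum>a'<N. dbmat j (rotgen a a') \<omega> w a a') =
    (\<Sum>i<length w. \<Sum>a<N. \<Sum>a'<N. of_bool (fst (w ! i) = j) *
       (cutK (rotgen a a') \<omega> w i a a' - cutK (rotgen a a') \<omega> w (Suc i) a a'))"
    unfolding dbmat_def by (subst sum.swap, subst sum.swap[of _ "{..<length w}" "{..<N}"], subst sum.swap) 
       (intro sum.cong refl sum.swap)
  also have "\<dots> = (\<Sum>i<length w. of_bool (fst (w ! i) = j) *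
     ((\<Sum>a<N. \<Sum>a'<N. cutK (rotgen a a') \<omega> w i a a') - (\<Sum>a<N. \<Sum>a'<N. cutK (rotgen a a') \<omega> w (Suc i) a a')))"
    by (simp only: sum_distrib_left[symmetric] sum_subtractf)
  finally show ?thesis unfolding g .
qed

text \<open>By cyclicity the trace of a cut is an antisymmetrised entry of the word read from the
  cut onwards, \<open>drop i v @ take i v\<close>. Contracting it with \<open>w\<close> glues the
  two words into one trace, once directly and once transposed.\<close>

lemma sum_dtrace:
  "(\<Sum>a<N. \<Sum>a'<N. bmat N (Z \<omega>) w a a' * (\<Sum>r<N. dbmat j (rotgen a a') \<omega> v r r)) =
    (\<Sum>i<length v. of_bool (fst (v ! i) = j) *
       ((btr N (Z \<omega>) (w @ drop i v @ take i v) - btr N (Z \<omega>) (w @ map tpb (rev (drop i v @ take i v))))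
      - (btr N (Z \<omega>) (w @ drop (Suc i) v @ take (Suc i) v)
          - btr N (Z \<omega>) (w @ map tpb (rev (drop (Suc i) v @ take (Suc i) v))))))"
proof -
  let ?W = "bmat N (Z \<omega>) w"
  have tr: "(\<Sum>r<N. cutK (rotgen a a') \<omega> v i r r) =
      bmat N (Z \<omega>) (drop i v @ take i v) a' a - bmat N (Z \<omega>) (drop i v @ take i v) a a'"
    if "a < N" "a' < N" for i a a'
    unfolding cutK_def matmul_rotgen[OF that] meqD[OF bmat_append that(2,1)] meqD[OF bmat_append that]
    by (simp add: matmul_def sum_subtractf mult.commute)
  have h: "(\<Sum>a<N. \<Sum>a'<N. ?W a a' * (\<Sum>r<N. cutK (rotgen a a') \<omega> v i r r)) =
     btr N (Z \<omega>) (w @ drop i v @ take i v) - btr N (Z \<omega>) (w @ map tpb (rev (drop i v @ take i v)))" for i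
    unfolding btr_append_tp
    unfolding btr_append[of N "Z \<omega>" w "drop i v @ take i v"] sum_subtractf[symmetric]
    by (intro sum.cong refl) (simp add: tr right_diff_distrib)
  have "(\<Sum>a<N. \<Sum>a'<N. ?W a a' * (\<Sum>r<N. dbmat j (rotgen a a') \<omega> v r r)) =
    (\<Sum>a<N. \<Sum>a'<N. \<Sum>i<length v. of_bool (fst (v ! i) = j) *
       (?W a a' * (\<Sum>r<N. cutK (rotgen a a') \<omega> v i r r) - ?W a a' * (\<Sum>r<N. cutK (rotgen a a') \<omega> v (Suc i) r r)))"
    unfolding dbmat_def
    by (intro sum.cong refl, subst sum.swap)
       (simp add: sum_distrib_left sum_subtractf[symmetric] algebra_simps)
  also have "\<dots> = (\<Sum>a<N. \<Sum>i<length v. \<Sum>a'<N. of_bool (fst (v ! i) = j) *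
       (?W a a' * (\<Sum>r<N. cutK (rotgen a a') \<omega> v i r r) - ?W a a' * (\<Sum>r<N. cutK (rotgen a a') \<omega> v (Suc i) r r)))"
    by (intro sum.cong refl sum.swap)
  also have "\<dots> = (\<Sum>i<length v. \<Sum>a<N. \<Sum>a'<N. of_bool (fst (v ! i) = j) *
       (?W a a' * (\<Sum>r<N. cutK (rotgen a a') \<omega> v i r r) - ?W a a' * (\<Sum>r<N. cutK (rotgen a a') \<omega> v (Suc i) r r)))"
    by (rule sum.swap)
  also have "\<dots> = (\<Sum>i<length v. of_bool (fst (v ! i) = j) *
       ((\<Sum>a<N. \<Sum>a'<N. ?W a a' * (\<Sum>r<N. cutK (rotgen a a') \<omega> v i r r))
       - (\<Sum>a<N. \<Sum>a'<N. ?W a a' * (\<Sum>r<N. cutK (rotgen a a') \<omega> v (Suc i) r r))))"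
    by (simp only: sum_distrib_left[symmetric] sum_subtractf)
  finally show ?thesis unfolding h .
qed

definition trprod :: "block list list \<Rightarrow> 'a \<Rightarrow> complex" where
  "trprod ws \<omega> = (\<Prod>w\<leftarrow>ws. btr N (Z \<omega>) w)"

lemma trprod_Lall:
  assumes "\<forall>w\<in>set ws. \<forall>b\<in>set w. okb b"
  shows "trprod ws \<in> Lall M"
proof -
  have "(\<lambda>\<omega>. \<Prod>w\<leftarrow>ws. btr N (Z \<omega>) w) \<in> Lall M"
    by (intro Lall_prod_list nice_Lall[OF nice_btr[of _ "{..<s}"]]) (use assms in \<open>auto simp: okb_def\<close>)
  then show ?thesis by (simp add: trprod_def[abs_def])
qed

text \<open>The matrix entry and the rotation plane carry the same indices \<open>a\<close> and
  \<open>a'\<close>. The second conclusion provides the integrability needed to sum the first one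
  over all planes.\<close>

lemma loop_pointwise:
  assumes j: "j < s" "orth_invariant M N (k j) (X j)"
    and w: "\<forall>b\<in>set w. okb b" and R: "\<forall>v\<in>set R. \<forall>b\<in>set v. okb b"
    and N: "a < N" "a' < N"
  shows "(\<integral>\<omega>. dbmat j (rotgen a a') \<omega> w a a' * trprod R \<omega> + bmat N (Z \<omega>) w a a' *
      (\<Sum>m<length R. (\<Sum>r<N. dbmat j (rotgen a a') \<omega> (R ! m) r r) * trprod (take m R @ drop (Suc m) R) \<omega>) \<partial>M) = 0"
    and "(\<lambda>\<omega>. dbmat j (rotgen a a') \<omega> w a a' * trprod R \<omega> + bmat N (Z \<omega>) w a a' *
      (\<Sum>m<length R. (\<Sum>r<N. dbmat j (rotgen a a') \<omega> (R ! m) r r) * trprod (take m R @ drop (Suc m) R) \<omega>)) \<in> Lall M"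
proof -
  let ?c = "\<lambda>\<theta> \<omega>. conj_at N (rot a a' \<theta>) j (Z \<omega>)"
  define F where "F Y = bmat N Y w a a' * (\<Prod>v\<leftarrow>R. btr N Y v)" for Y
  have nF: "nice {..<s} F" unfolding F_def
    by (intro nice_mult nice_bmat nice_prod_list nice_btr) (use w R N in \<open>auto simp: okb_def\<close>)
  have dtr: "diffable (\<lambda>\<theta> \<omega>. btr N (?c \<theta> \<omega>) v) (\<lambda>\<omega>. \<Sum>r<N. dbmat j (rotgen a a') \<omega> v r r)" if "v \<in> set R" for v
    unfolding btr_def mTrace_def by (intro diffable_sum diffable_bmat) (use that R N in auto)
  have d: "diffable (\<lambda>\<theta> \<omega>. bmat N (?c \<theta> \<omega>) w a a' * (\<Prod>v\<leftarrow>R. btr N (?c \<theta> \<omega>) v))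
     (\<lambda>\<omega>. dbmat j (rotgen a a') \<omega> w a a' * (\<Prod>v\<leftarrow>R. btr N (?c 0 \<omega>) v) + bmat N (?c 0 \<omega>) w a a' *
        (\<Sum>m<length R. (\<Sum>r<N. dbmat j (rotgen a a') \<omega> (R ! m) r r) * (\<Prod>v\<leftarrow>take m R @ drop (Suc m) R. btr N (?c 0 \<omega>) v)))"
    by (intro diffable_mult diffable_bmat diffable_prod_list dtr w N)
  have btr0: "btr N (?c 0 \<omega>) v = btr N (Z \<omega>) v" if "v \<in> set R" for v \<omega>
    unfolding btr_def by (rule meq_mTrace, rule bmat_conj_zero) (use that R N in auto)
  have tp0: "(\<Prod>v\<leftarrow>R'. btr N (?c 0 \<omega>) v) = trprod R' \<omega>" if "set R' \<subseteq> set R" for R' \<omega>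
    unfolding trprod_def by (intro arg_cong[of _ _ prod_list] map_cong refl btr0) (use that in auto)
  have sub: "set (take m R @ drop (Suc m) R) \<subseteq> set R" for m
    by (auto dest: in_set_takeD in_set_dropD)
  have b0: "bmat N (?c 0 \<omega>) w a a' = bmat N (Z \<omega>) w a a'" for \<omega>
    by (rule meqD[OF bmat_conj_zero[OF w N] N])
  have D: "diffable (\<lambda>\<theta> \<omega>. F (?c \<theta> \<omega>)) (\<lambda>\<omega>. dbmat j (rotgen a a') \<omega> w a a' * trprod R \<omega> + bmat N (Z \<omega>) w a a' *
      (\<Sum>m<length R. (\<Sum>r<N. dbmat j (rotgen a a') \<omega> (R ! m) r r) * trprod (take m R @ drop (Suc m) R) \<omega>))"
    by (rule diffable_cong[OF d]) (simp_all only: F_def tp0[OF sub] tp0[OF subset_refl] b0)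
  then show "(\<integral>\<omega>. dbmat j (rotgen a a') \<omega> w a a' * trprod R \<omega> + bmat N (Z \<omega>) w a a' *
      (\<Sum>m<length R. (\<Sum>r<N. dbmat j (rotgen a a') \<omega> (R ! m) r r) * trprod (take m R @ drop (Suc m) R) \<omega>) \<partial>M) = 0"
    by (rule diffable_stationary) (rule invariance[OF nF j bi_orthogonal_rot(2)[OF N]])
  show "(\<lambda>\<omega>. dbmat j (rotgen a a') \<omega> w a a' * trprod R \<omega> + bmat N (Z \<omega>) w a a' *
      (\<Sum>m<length R. (\<Sum>r<N. dbmat j (rotgen a a') \<omega> (R ! m) r r) * trprod (take m R @ drop (Suc m) R) \<omega>)) \<in> Lall M"
    by (rule diffable_integral(2)[OF D])
qed

section \<open>Loop equation for unnormalised traces by summation over all planes\<close>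

definition Tr :: "block list list \<Rightarrow> complex" where
  "Tr ws = (\<integral>\<omega>. trprod ws \<omega> \<partial>M)"

lemma trprod_simps [simp]: "trprod [] \<omega> = 1" "trprod (w # ws) \<omega> = btr N (Z \<omega>) w * trprod ws \<omega>"
  by (auto simp: trprod_def)

lemma has_Tr:
  assumes "\<forall>w\<in>set ws. \<forall>b\<in>set w. okb b"
  shows "has_bochner_integral M (\<lambda>\<omega>. trprod ws \<omega>) (Tr ws)"
  unfolding Tr_def using Lall_integrable[OF trprod_Lall[OF assms]] by (rule has_bochner_integral_integrable)

lemma okb_tpb: "okb b \<Longrightarrow> okb (tpb b)"
  by (simp add: okb_def tpb_def poly_in_ptr[OF _ flipl_fam_letters])

theorem loop_Tr:
  assumes j: "j < s" "orth_invariant M N (k j) (X j)"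
    and w: "\<forall>b\<in>set w. okb b" and R: "\<forall>v\<in>set R. \<forall>b\<in>set v. okb b"
  shows "(\<Sum>i<length w. of_bool (fst (w ! i) = j) *
       ((Tr (take i w # drop i w # R) - Tr ((take i w @ map tpb (rev (drop i w))) # R))
      - (Tr (take (Suc i) w # drop (Suc i) w # R) - Tr ((take (Suc i) w @ map tpb (rev (drop (Suc i) w))) # R))))
    + (\<Sum>m<length R. \<Sum>i<length (R ! m). of_bool (fst (R ! m ! i) = j) *
       ((Tr ((w @ drop i (R ! m) @ take i (R ! m)) # take m R @ drop (Suc m) R)
          - Tr ((w @ map tpb (rev (drop i (R ! m) @ take i (R ! m)))) # take m R @ drop (Suc m) R))
      - (Tr ((w @ drop (Suc i) (R ! m) @ take (Suc i) (R ! m)) # take m R @ drop (Suc m) R)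
          - Tr ((w @ map tpb (rev (drop (Suc i) (R ! m) @ take (Suc i) (R ! m)))) # take m R @ drop (Suc m) R)))) = 0"
    (is "?L = 0")
proof -
  \<comment> \<open>The claimed expression before taking expectations: integrating it term by term
    gives the left-hand side, and pointwise it equals the sum over planes of the derivatives
    \<open>D\<close>.\<close>
  define \<Phi> where "\<Phi> \<omega> = (\<Sum>i<length w. of_bool (fst (w ! i) = j) *
       ((trprod (take i w # drop i w # R) \<omega> - trprod ((take i w @ map tpb (rev (drop i w))) # R) \<omega>)
      - (trprod (take (Suc i) w # drop (Suc i) w # R) \<omega> - trprod ((take (Suc i) w @ map tpb (rev (drop (Suc i) w))) # R) \<omega>)))
    + (\<Sum>m<length R. \<Sum>i<length (R ! m). of_bool (fst (R ! m ! i) = j) *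
       ((trprod ((w @ drop i (R ! m) @ take i (R ! m)) # take m R @ drop (Suc m) R) \<omega>
          - trprod ((w @ map tpb (rev (drop i (R ! m) @ take i (R ! m)))) # take m R @ drop (Suc m) R) \<omega>)
      - (trprod ((w @ drop (Suc i) (R ! m) @ take (Suc i) (R ! m)) # take m R @ drop (Suc m) R) \<omega>
          - trprod ((w @ map tpb (rev (drop (Suc i) (R ! m) @ take (Suc i) (R ! m)))) # take m R @ drop (Suc m) R) \<omega>)))" for \<omega>
  define D where "D a a' \<omega> = dbmat j (rotgen a a') \<omega> w a a' * trprod R \<omega> + bmat N (Z \<omega>) w a a' *
      (\<Sum>m<length R. (\<Sum>r<N. dbmat j (rotgen a a') \<omega> (R ! m) r r) * trprod (take m R @ drop (Suc m) R) \<omega>)" for a a' \<omega>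
  have ok1: "\<forall>v\<in>set (take i w # drop i w # R). \<forall>b\<in>set v. okb b" for i
    using w R by (auto dest: in_set_takeD in_set_dropD)
  have ok2: "\<forall>v\<in>set ((take i w @ map tpb (rev (drop i w))) # R). \<forall>b\<in>set v. okb b" for i
    using w R okb_tpb by (auto dest: in_set_takeD in_set_dropD)
  have okR: "\<forall>v\<in>set (take m R @ drop (Suc m) R). \<forall>b\<in>set v. okb b" for m
    using R by (auto dest: in_set_takeD in_set_dropD)
  have okm: "\<forall>b\<in>set (drop i (R ! m) @ take i (R ! m)). okb b" if "m < length R" for i m
    using R nth_mem[OF that] by (auto dest: in_set_takeD in_set_dropD)
  have ok3: "\<forall>v\<in>set ((w @ drop i (R ! m) @ take i (R ! m)) # take m R @ drop (Suc m) R). \<forall>b\<in>set v. okb b"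
    if "m \<in> {..<length R}" for i m
    using okm[of m i] okR[of m] w that by (auto simp: ball_Un)
  have ok4: "\<forall>v\<in>set ((w @ map tpb (rev (drop i (R ! m) @ take i (R ! m)))) # take m R @ drop (Suc m) R). \<forall>b\<in>set v. okb b"
    if "m \<in> {..<length R}" for i m
    using okm[of m i] okR[of m] w that okb_tpb by (auto simp: ball_Un)
  have "has_bochner_integral M \<Phi> ?L"
    unfolding \<Phi>_def
    by (intro has_bochner_integral_add has_bochner_integral_sum has_bochner_integral_mult_right
        has_bochner_integral_diff has_Tr ok1 ok2 ok3 ok4)
  then have "(\<integral>\<omega>. \<Phi> \<omega> \<partial>M) = ?L" by (rule has_bochner_integral_integral_eq)
  moreover have "\<Phi> \<omega> = (\<Sum>a<N. \<Sum>a'<N. D a a' \<omega>)" for \<omega>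
  proof -
    have 1: "(\<Sum>a<N. \<Sum>a'<N. dbmat j (rotgen a a') \<omega> w a a' * trprod R \<omega>) =
        (\<Sum>a<N. \<Sum>a'<N. dbmat j (rotgen a a') \<omega> w a a') * trprod R \<omega>"
      by (simp add: sum_distrib_right)
    have "(\<Sum>a<N. \<Sum>a'<N. bmat N (Z \<omega>) w a a' *
        (\<Sum>m<length R. (\<Sum>r<N. dbmat j (rotgen a a') \<omega> (R ! m) r r) * trprod (take m R @ drop (Suc m) R) \<omega>))
      = (\<Sum>a<N. \<Sum>a'<N. \<Sum>m<length R. bmat N (Z \<omega>) w a a' *
        (\<Sum>r<N. dbmat j (rotgen a a') \<omega> (R ! m) r r) * trprod (take m R @ drop (Suc m) R) \<omega>)"
      by (simp only: sum_distrib_left[where A = "{..<length R}"] mult.assoc)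
    also have "\<dots> = (\<Sum>a<N. \<Sum>m<length R. \<Sum>a'<N. bmat N (Z \<omega>) w a a' *
        (\<Sum>r<N. dbmat j (rotgen a a') \<omega> (R ! m) r r) * trprod (take m R @ drop (Suc m) R) \<omega>)"
      by (intro sum.cong refl sum.swap)
    also have "\<dots> = (\<Sum>m<length R. \<Sum>a<N. \<Sum>a'<N. bmat N (Z \<omega>) w a a' *
        (\<Sum>r<N. dbmat j (rotgen a a') \<omega> (R ! m) r r) * trprod (take m R @ drop (Suc m) R) \<omega>)"
      by (rule sum.swap)
    also have "\<dots> = (\<Sum>m<length R. (\<Sum>a<N. \<Sum>a'<N. bmat N (Z \<omega>) w a a' *
        (\<Sum>r<N. dbmat j (rotgen a a') \<omega> (R ! m) r r)) * trprod (take m R @ drop (Suc m) R) \<omega>)"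
      by (simp only: sum_distrib_right)
    finally have 2: "(\<Sum>a<N. \<Sum>a'<N. bmat N (Z \<omega>) w a a' *
        (\<Sum>m<length R. (\<Sum>r<N. dbmat j (rotgen a a') \<omega> (R ! m) r r) * trprod (take m R @ drop (Suc m) R) \<omega>))
      = (\<Sum>m<length R. (\<Sum>a<N. \<Sum>a'<N. bmat N (Z \<omega>) w a a' *
        (\<Sum>r<N. dbmat j (rotgen a a') \<omega> (R ! m) r r)) * trprod (take m R @ drop (Suc m) R) \<omega>)" .
    show ?thesis
      unfolding D_def sum.distrib 1 2 sum_dbmat sum_dtrace \<Phi>_def
      by (intro arg_cong2[of _ _ _ _ "(+)"])
         (simp only: sum_distrib_right trprod_simps mult.assoc left_diff_distrib)+
  qed
  moreover have "(\<integral>\<omega>. (\<Sum>a<N. \<Sum>a'<N. D a a' \<omega>) \<partial>M) = 0"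
  proof -
    have "has_bochner_integral M (D a a') 0" if "a < N" "a' < N" for a a'
      using loop_pointwise[OF j w R that] Lall_integrable has_bochner_integral_iff
      unfolding D_def[abs_def] by blast
    then have "has_bochner_integral M (\<lambda>\<omega>. \<Sum>a<N. \<Sum>a'<N. D a a' \<omega>) (\<Sum>a<N. \<Sum>a'<N. 0)"
      by (intro has_bochner_integral_sum) auto
    then show ?thesis by (simp add: has_bochner_integral_integral_eq)
  qed
  ultimately show ?thesis by simp
qed

end

section \<open>Factorisation within one family\<close>

definition mrgb :: "block \<Rightarrow> block \<Rightarrow> block" where
  "mrgb a b = (fst a, pmul (snd a) (snd b))"

definition cenb :: "block \<Rightarrow> complex \<Rightarrow> block" where
  "cenb a c = (fst a, padd (snd a) (psmult (- c) pone))"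

lemma partition_on_top:
  assumes "partition_on A \<pi>" "A \<in> \<pi>"
  shows "\<pi> = {A}"
proof -
  have "B = A" if "B \<in> \<pi>" for B
  proof (rule ccontr)
    assume "B \<noteq> A"
    then have "B \<inter> A = {}"
      using partition_onD2[OF assms(1)] assms(2) that unfolding disjoint_def by blast
    moreover have "B \<subseteq> A" "B \<noteq> {}" using assms(1) that by (auto dest: partition_onD1 partition_onD3)
    ultimately show False by blast
  qed
  then show ?thesis using assms(2) by blast
qed

text \<open>\<open>j0\<close> is the family exempt from invariance; a value outside
  \<open>{..<s}\<close> describes the case where all families are invariant.\<close>

locale ensemble_seq =
  fixes M :: "nat \<Rightarrow> 'a measure" and X :: "nat \<Rightarrow> nat \<Rightarrow> nat \<Rightarrow> 'a \<Rightarrow> cmat"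
    and s :: nat and k :: "nat \<Rightarrow> nat" and j0 :: nat
  assumes ens: "\<And>N. ensemble (M N) N (X N) s k"
    and inv: "\<And>N j. j < s \<Longrightarrow> j \<noteq> j0 \<Longrightarrow> orth_invariant (M N) N (k j) (X N j)"
    and P1: "\<And>j. j < s \<Longrightarrow> \<exists>\<tau> \<tau>' :: ncpoly \<Rightarrow> complex. \<forall>p. poly_in (fam_letters k j) p \<longrightarrow>
                 (\<lambda>N. of_nat N * (Etr (M N) N (X N) p - \<tau> p) - \<tau>' p) \<longlonglongrightarrow> 0"
    and P2: "\<And>j p1 p2. j < s \<Longrightarrow> poly_in (fam_letters k j) p1 \<Longrightarrow> poly_in (fam_letters k j) p2 \<Longrightarrow>
                 convergent (\<lambda>N. cumulant (M N) (\<lambda>m. TrP N (X N) ([p1, p2] ! m)) 2)"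
    and P3: "\<And>j r ps. j < s \<Longrightarrow> r \<ge> 3 \<Longrightarrow> (\<forall>m<r. poly_in (fam_letters k j) (ps m)) \<Longrightarrow>
                 (\<lambda>N. of_nat N ^ (r - 3) * cumulant (M N) (\<lambda>m. TrP N (X N) (ps m)) r) \<longlonglongrightarrow> 0"
begin

section \<open>Moments and cumulants of normalised traces of one family\<close>

definition mom :: "nat \<Rightarrow> (nat \<Rightarrow> ncpoly) \<Rightarrow> nat set \<Rightarrow> complex" where
  "mom N ps I = (\<integral>\<omega>. (\<Prod>i\<in>I. TrP N (X N) (ps i) \<omega> / of_nat N) \<partial>M N)"

text \<open>The Moebius function of the partition lattice between \<open>\<pi>\<close> and the
  one-block partition.\<close>

definition moebius :: "nat set set \<Rightarrow> complex" where
  "moebius \<pi> = (-1) ^ (card \<pi> - 1) * of_nat (fact (card \<pi> - 1))"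

lemma mom_single: "mom N ps {i} = Etr (M N) N (X N) (ps i)"
  by (simp add: mom_def Etr_def)

lemma expandable_Etr: "j < s \<Longrightarrow> poly_in (fam_letters k j) p \<Longrightarrow> expandable (\<lambda>N. Etr (M N) N (X N) p)"
proof -
  assume "j < s" "poly_in (fam_letters k j) p"
  then obtain a b where "(\<lambda>N. of_nat N * (Etr (M N) N (X N) p - a) - b) \<longlonglongrightarrow> 0"
    using P1[of j] by blast
  then have "expands (\<lambda>N. Etr (M N) N (X N) p) a b"
    unfolding expands_def by (rule LIM_zero_cancel)
  then show ?thesis unfolding expandable_def by blast
qed

text \<open>The block sizes of a partition add up to \<open>r\<close>, so normalising the
  \<open>r\<close> traces extracts the same power of N from every term.\<close>

lemma cumulant_mom:
  assumes "N > 0"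
  shows "cumulant (M N) (\<lambda>m. TrP N (X N) (ps m)) r / of_nat N ^ r =
    (\<Sum>\<pi> | partition_on {..<r} \<pi>. moebius \<pi> * (\<Prod>B\<in>\<pi>. mom N ps B))"
proof -
  have "(\<Prod>B\<in>\<pi>. \<integral>\<omega>. (\<Prod>i\<in>B. TrP N (X N) (ps i) \<omega>) \<partial>M N) = of_nat N ^ r * (\<Prod>B\<in>\<pi>. mom N ps B)"
    if \<pi>: "partition_on {..<r} \<pi>" for \<pi>
  proof -
    have "(\<Prod>i\<in>B. TrP N (X N) (ps i) \<omega>) = of_nat N ^ card B * (\<Prod>i\<in>B. TrP N (X N) (ps i) \<omega> / of_nat N)" for B \<omega>
      using assms by (simp add: prod_dividef)
    then have "(\<Prod>B\<in>\<pi>. \<integral>\<omega>. (\<Prod>i\<in>B. TrP N (X N) (ps i) \<omega>) \<partial>M N) =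
        (\<Prod>B\<in>\<pi>. of_nat N ^ card B * mom N ps B)"
      by (simp add: mom_def)
    also have "\<dots> = of_nat N ^ (\<Sum>B\<in>\<pi>. card B) * (\<Prod>B\<in>\<pi>. mom N ps B)"
      by (simp add: prod.distrib power_sum)
    also have "(\<Sum>B\<in>\<pi>. card B) = r"
      using product_partition[OF \<pi>] \<pi> finite_elements[OF _ \<pi>] by (metis card_lessThan finite_lessThan finite_subset partition_onD1 Union_upper)
    finally show ?thesis .
  qed
  then have "cumulant (M N) (\<lambda>m. TrP N (X N) (ps m)) r =
     (\<Sum>\<pi> | partition_on {..<r} \<pi>. of_nat N ^ r * (moebius \<pi> * (\<Prod>B\<in>\<pi>. mom N ps B)))"
    unfolding cumulant_def moebius_def by (intro sum.cong refl) (simp add: mult_ac)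
  then show ?thesis using assms by (simp add: sum_distrib_left[symmetric])
qed

text \<open>The normalised cumulants are o(1/N): for \<open>r = 2\<close> a convergent covariance is
  divided by N^2, and for \<open>r >= 3\<close> one has N * k_r / N^r = N^(r-3) k_r /
  N^(2r-4).\<close>

lemma cumulant_null:
  assumes "j < s" "r \<ge> 2" and ps: "\<And>m. m < r \<Longrightarrow> poly_in (fam_letters k j) (ps m)"
  shows "(\<lambda>N. of_nat N * (\<Sum>\<pi> | partition_on {..<r} \<pi>. moebius \<pi> * (\<Prod>B\<in>\<pi>. mom N ps B))) \<longlonglongrightarrow> 0"
proof -
  let ?c = "\<lambda>N. cumulant (M N) (\<lambda>m. TrP N (X N) (ps m)) r"
  have "(\<lambda>N. of_nat N * (?c N / of_nat N ^ r)) \<longlonglongrightarrow> 0"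
  proof (cases "r = 2")
    case True
    have eq: "?c N = cumulant (M N) (\<lambda>m. TrP N (X N) ([ps 0, ps 1] ! m)) 2" for N
    proof -
      have "TrP N (X N) (ps i) \<omega> = TrP N (X N) ([ps 0, ps 1] ! i) \<omega>"
        if "partition_on {..<2} \<pi>" "B \<in> \<pi>" "i \<in> B" for \<pi> B i \<omega>
      proof -
        have "i \<in> {..<2}" using that by (auto dest!: partition_onD1)
        then have "i = 0 \<or> i = 1" by auto
        then show ?thesis by auto
      qed
      then show ?thesis unfolding cumulant_def True
        by (intro sum.cong prod.cong arg_cong2[of _ _ _ _ "(*)"] refl Bochner_Integration.integral_cong) auto
    qed
    have "convergent ?c" unfolding eq by (rule P2) (use assms True in auto)
    then obtain l where "?c \<longlonglongrightarrow> l" by (auto simp: convergent_def)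
    then have "(\<lambda>N. 1 / of_nat N * ?c N) \<longlonglongrightarrow> 0 * l" by (intro tendsto_mult tendsto_inverse_nat)
    then have *: "(\<lambda>N. 1 / of_nat N * ?c N) \<longlonglongrightarrow> 0" by simp
    show ?thesis
      by (rule Lim_transform_eventually[OF *], rule eventually_pos_nat) (simp add: True power2_eq_square)
  next
    case False
    then have r: "r \<ge> 3" using assms by simp
    have "(\<lambda>N. of_nat N ^ (r - 3) * ?c N) \<longlonglongrightarrow> 0" by (rule P3) (use assms r in auto)
    moreover have "Bseq (\<lambda>N. 1 / of_nat N ^ (2 * r - 4) :: complex)"
    proof (rule BfunI[of _ 1], rule eventually_pos_nat)
      fix N :: nat assume "N > 0"
      then have "1 \<le> real N ^ (2 * r - 4)" by simp
      then show "norm (1 / of_nat N ^ (2 * r - 4) :: complex) \<le> 1"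
        by (auto simp: norm_divide norm_power divide_le_eq_1)
    qed
    ultimately have *: "(\<lambda>N. of_nat N ^ (r - 3) * ?c N * (1 / of_nat N ^ (2 * r - 4))) \<longlonglongrightarrow> 0"
      by (rule null_mult_Bseq)
    show ?thesis
    proof (rule Lim_transform_eventually[OF *], rule eventually_pos_nat)
      fix N :: nat assume N: "N > 0"
      have "of_nat N ^ (r - 3) * of_nat N ^ r = (of_nat N * of_nat N ^ (2 * r - 4) :: complex)"
        unfolding power_add[symmetric] power_Suc[symmetric] using r by (intro arg_cong[of _ _ "\<lambda>e. of_nat N ^ e"]) simp
      then show "of_nat N ^ (r - 3) * ?c N * (1 / of_nat N ^ (2 * r - 4)) = of_nat N * (?c N / of_nat N ^ r)"
        using N by (simp add: field_simps)
    qed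
  qed
  then show ?thesis
    by (rule Lim_transform_eventually) (rule eventually_pos_nat, simp add: cumulant_mom)
qed

text \<open>The hypotheses on cumulants, applied to constant polynomials, already force this identity.\<close>
lemma sum_moebius:
  assumes "j < s" "r \<ge> 2"
  shows "(\<Sum>\<pi> | partition_on {..<r} \<pi>. moebius \<pi>) = 0" (is "?c = 0")
proof -
  have one: "mom N (\<lambda>_. pone) B = 1" if "N > 0" for N B
  proof -
    interpret ensemble "M N" N "X N" s k by (rule ens)
    have "TrP N (X N) pone \<omega> = of_nat N" for \<omega>
      by (simp add: TrP_def poly_eval_pone mTrace_def idmat_def)
    then show ?thesis using that by (simp add: mom_def prob_space)
  qed
  have "(\<lambda>N. of_nat N * (\<Sum>\<pi> | partition_on {..<r} \<pi>. moebius \<pi> * (\<Prod>B\<in>\<pi>. mom N (\<lambda>_. pone) B))) \<longlonglongrightarrow> 0"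
    by (rule cumulant_null[OF assms]) simp
  then have "(\<lambda>N. of_nat N * ?c) \<longlonglongrightarrow> 0"
    by (rule Lim_transform_eventually) (rule eventually_pos_nat, simp add: one)
  then have "(\<lambda>N. ?c) \<longlonglongrightarrow> 0" by (rule null_of_scaled_null)
  then show ?thesis by (simp add: LIMSEQ_const_iff)
qed

definition mom_fac :: "(nat \<Rightarrow> ncpoly) \<Rightarrow> nat set \<Rightarrow> bool" where
  "mom_fac ps I \<longleftrightarrow> (\<lambda>N. of_nat N * (mom N ps I - (\<Prod>i\<in>I. mom N ps {i}))) \<longlonglongrightarrow> 0"

lemma mom_reindex:
  assumes "bij_betw h {..<r} I"
  shows "mom_fac ps I \<longleftrightarrow> mom_fac (\<lambda>l. ps (h l)) {..<r}"
proof -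
  have "(\<Prod>i\<in>I. f i) = (\<Prod>l<r. f (h l))" for f :: "nat \<Rightarrow> complex"
    using prod.reindex_bij_betw[OF assms, of f] by simp
  then show ?thesis by (simp add: mom_fac_def mom_def)
qed

text \<open>In the moment-cumulant sum every partition except the one-block one has smaller blocks,
  whose moments factorise by induction. All these terms agree with the full product up to o(1/N),
  and since the cumulant is negligible, so does the remaining joint moment.\<close>

lemma mom_fac_lessThan:
  assumes "j < s" "\<And>m. m < r \<Longrightarrow> poly_in (fam_letters k j) (ps m)"
  shows "mom_fac ps {..<r}"
  using assms(2)
proof (induction r arbitrary: ps rule: less_induct)
  case (less r)
  consider "r = 0" | "r = 1" | "r \<ge> 2" by linarith
  then show ?case
  proof cases
    case 1
    have "mom N ps {} = 1" for N
    proof -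
      interpret ensemble "M N" N "X N" s k by (rule ens)
      show ?thesis by (simp add: mom_def prob_space)
    qed
    then show ?thesis using 1 by (simp add: mom_fac_def lessThan_0)
  next
    case 2
    then have "{..<r} = {0}" by auto
    then show ?thesis by (simp add: mom_fac_def)
  next
    case 3
    let ?P = "{\<pi>. partition_on {..<r} \<pi>}" and ?top = "{{..<r}}"
    let ?e = "\<lambda>N. \<Prod>i<r. mom N ps {i}"
    have fin: "finite ?P" by (rule finitely_many_partition_on) simp
    have "0 \<in> {..<r}" using 3 by simp
    then have top: "?top \<in> ?P" using partition_on_space[of "{..<r}"] by blast
    have ex: "expandable (\<lambda>N. mom N ps {i})" if "i < r" for i
      unfolding mom_single using expandable_Etr[OF assms(1) less.prems[OF that]] .
    \<comment> \<open>Blocks of a nontrivial partition are proper subsets; after renumbering their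
      elements the induction hypothesis applies to each, and the products over blocks recombine to
      the product over all indices.\<close>
    have blocks: "(\<lambda>N. of_nat N * ((\<Prod>B\<in>\<pi>. mom N ps B) - ?e N)) \<longlonglongrightarrow> 0"
      if \<pi>: "\<pi> \<in> ?P" "\<pi> \<noteq> ?top" for \<pi>
    proof -
      have p: "partition_on {..<r} \<pi>" using \<pi> by simp
      have fin\<pi>: "finite \<pi>" using finite_elements[OF _ p] by simp
      have sub: "B \<subset> {..<r}" if "B \<in> \<pi>" for B
        using that p \<pi>(2) partition_on_top[OF p] by (auto dest!: partition_onD1)
      have finB: "finite B" if "B \<in> \<pi>" for B using sub[OF that] finite_subset by blast
      have "(\<lambda>N. of_nat N * ((\<Prod>B\<in>\<pi>. mom N ps B) - (\<Prod>B\<in>\<pi>. \<Prod>i\<in>B. mom N ps {i}))) \<longlonglongrightarrow> 0"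
      proof (rule prod_null[OF fin\<pi>])
        fix B assume B: "B \<in> \<pi>"
        obtain h where h: "bij_betw h {..<card B} B"
          using ex_bij_betw_nat_finite[OF finB[OF B]] by (auto simp: lessThan_atLeast0)
        have "card B < r" using psubset_card_mono[OF _ sub[OF B]] by simp
        then have "mom_fac (\<lambda>l. ps (h l)) {..<card B}"
        proof (rule less.IH)
          fix m assume "m < card B"
          then have "h m \<in> B" using h by (auto simp: bij_betw_def)
          then show "poly_in (fam_letters k j) (ps (h m))" using sub[OF B] by (intro less.prems) auto
        qed
        then show "(\<lambda>N. of_nat N * (mom N ps B - (\<Prod>i\<in>B. mom N ps {i}))) \<longlonglongrightarrow> 0"
          using mom_reindex[OF h] by (simp add: mom_fac_def)
        show "expandable (\<lambda>N. \<Prod>i\<in>B. mom N ps {i})"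
          by (rule expandable_prod[OF finB[OF B]]) (use ex sub[OF B] in auto)
      qed
      moreover have "(\<Prod>B\<in>\<pi>. \<Prod>i\<in>B. mom N ps {i}) = ?e N" for N
      proof -
        have "(\<Prod>B\<in>\<pi>. \<Prod>i\<in>B. mom N ps {i}) = (\<Prod>i\<in>\<Union>\<pi>. mom N ps {i})"
          using prod.Union_disjoint[of \<pi> "\<lambda>i. mom N ps {i}"] finB p
          by (auto dest!: partition_onD2 simp: disjoint_def)
        then show ?thesis using p by (simp add: partition_onD1[symmetric])
      qed
      ultimately show ?thesis by simp
    qed
    have null: "(\<lambda>N. of_nat N * (\<Sum>\<pi>\<in>?P. moebius \<pi> * (\<Prod>B\<in>\<pi>. mom N ps B))
        - (\<Sum>\<pi>\<in>?P - {?top}. moebius \<pi> * (of_nat N * ((\<Prod>B\<in>\<pi>. mom N ps B) - ?e N)))) \<longlonglongrightarrow> 0 - (\<Sum>\<pi>\<in>?P - {?top}. moebius \<pi> * 0)"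
      by (intro tendsto_diff tendsto_sum tendsto_mult tendsto_const cumulant_null[OF assms(1) 3] less.prems blocks) auto
    have "of_nat N * (\<Sum>\<pi>\<in>?P. moebius \<pi> * (\<Prod>B\<in>\<pi>. mom N ps B))
        - (\<Sum>\<pi>\<in>?P - {?top}. moebius \<pi> * (of_nat N * ((\<Prod>B\<in>\<pi>. mom N ps B) - ?e N)))
        = of_nat N * (mom N ps {..<r} - ?e N)" for N
    proof -
      have m1: "moebius ?top = 1" by (simp add: moebius_def)
      have "(\<Sum>\<pi>\<in>?P. moebius \<pi>) = moebius ?top + (\<Sum>\<pi>\<in>?P - {?top}. moebius \<pi>)"
        by (rule sum.remove[OF fin top])
      \<comment> \<open>The nontrivial partitions carry total weight -1, exactly what turns the
        cumulant into the joint moment minus the product of the single moments.\<close>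
      then have m2: "(\<Sum>\<pi>\<in>?P - {?top}. moebius \<pi>) = - 1"
        using sum_moebius[OF assms(1) 3] m1 by (simp add: add_eq_0_iff)
      have s1: "(\<Sum>\<pi>\<in>?P. moebius \<pi> * (\<Prod>B\<in>\<pi>. mom N ps B)) = mom N ps {..<r} +
          (\<Sum>\<pi>\<in>?P - {?top}. moebius \<pi> * (\<Prod>B\<in>\<pi>. mom N ps B))"
        using sum.remove[OF fin top, of "\<lambda>\<pi>. moebius \<pi> * (\<Prod>B\<in>\<pi>. mom N ps B)"] m1 by simp
      have s2: "(\<Sum>\<pi>\<in>?P - {?top}. moebius \<pi> * (of_nat N * ((\<Prod>B\<in>\<pi>. mom N ps B) - ?e N))) =
         of_nat N * ((\<Sum>\<pi>\<in>?P - {?top}. moebius \<pi> * (\<Prod>B\<in>\<pi>. mom N ps B)) - (\<Sum>\<pi>\<in>?P - {?top}. moebius \<pi>) * ?e N)"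
        unfolding sum_distrib_right sum_subtractf[symmetric] sum_distrib_left
        by (intro sum.cong refl) (simp add: algebra_simps)
      show ?thesis unfolding s1 s2 m2 by (simp add: algebra_simps)
    qed
    with null show ?thesis unfolding mom_fac_def by simp
  qed
qed

lemma mom_fac_family:
  assumes "j < s" "finite I" "\<And>i. i \<in> I \<Longrightarrow> poly_in (fam_letters k j) (ps i)"
  shows "mom_fac ps I"
proof -
  obtain h where h: "bij_betw h {..<card I} I"
    using ex_bij_betw_nat_finite[OF assms(2)] by (auto simp: lessThan_atLeast0)
  show ?thesis unfolding mom_reindex[OF h]
    by (rule mom_fac_lessThan[OF assms(1)]) (use h assms(3) in \<open>auto simp: bij_betw_def\<close>)
qed

subsection \<open>Several families\<close>

definition okB :: "block \<Rightarrow> bool" where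
  "okB b \<longleftrightarrow> fst b < s \<and> poly_in (fam_letters k (fst b)) (snd b)"

lemma okb_okB: "ensemble.okb s k = okB"
proof -
  interpret ensemble "M 0" 0 "X 0" s k by (rule ens)
  show ?thesis by (rule ext) (simp add: okb_def okB_def)
qed

definition EE :: "nat \<Rightarrow> block list list \<Rightarrow> complex" where
  "EE N ws = ensemble.Tr (M N) N (X N) ws / of_nat N ^ length ws"

lemma EE_alt: "EE N ws = (\<integral>\<omega>. (\<Prod>w\<leftarrow>ws. btr N (\<lambda>j i. X N j i \<omega>) w) \<partial>M N) / of_nat N ^ length ws"
proof -
  interpret ensemble "M N" N "X N" s k by (rule ens)
  show ?thesis by (simp add: EE_def Tr_def trprod_def)
qed

lemma EE_cong:
  assumes "\<And>\<omega>. btr N (\<lambda>j i. X N j i \<omega>) u = btr N (\<lambda>j i. X N j i \<omega>) v"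
  shows "EE N (u # R) = EE N (v # R)"
  unfolding EE_alt using assms by simp

lemma EE_Etr:
  assumes "\<And>Y. meq N (bmat N Y w) (poly_eval N (gen0 Y) p)"
  shows "EE N [w] = Etr (M N) N (X N) p"
  unfolding EE_alt Etr_def TrP_def gens_gen0 using btr_poly[OF assms] by simp

text \<open>Grouping the traces by family, independence factorises the expectation exactly over the
  families; inside each family the cumulant conditions factorise it up to o(1/N).\<close>

lemma EE_base:
  assumes "\<forall>b\<in>set bs. okB b"
  shows "(\<lambda>N. of_nat N * (EE N (map (\<lambda>b. [b]) bs) - (\<Prod>b\<leftarrow>bs. EE N [[b]]))) \<longlonglongrightarrow> 0"
proof -
  let ?ps = "\<lambda>m. snd (bs ! m)"
  define I where "I j = {m. m < length bs \<and> fst (bs ! m) = j}" for j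
  have I: "finite (I j)" for j unfolding I_def by simp
  have okI: "j < s \<Longrightarrow> m \<in> I j \<Longrightarrow> poly_in (fam_letters k j) (?ps m)" for j m
    using assms nth_mem[of m bs] unfolding I_def okB_def by auto
  have lst: "(\<Prod>b\<leftarrow>bs. f b) = (\<Prod>j<s. \<Prod>m\<in>I j. f (bs ! m))" for f :: "block \<Rightarrow> complex"
  proof -
    have "(\<Prod>b\<leftarrow>bs. f b) = (\<Prod>m<length bs. f (bs ! m))"
      by (induction bs rule: rev_induct) (auto simp: nth_append)
    also have "\<dots> = (\<Prod>j<s. \<Prod>m | m \<in> {..<length bs} \<and> fst (bs ! m) = j. f (bs ! m))"
      by (rule prod.group[symmetric]) (use assms in \<open>auto simp: okB_def\<close>)
    finally show ?thesis by (simp add: I_def)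
  qed
  have single: "EE N [[b]] = Etr (M N) N (X N) (snd b)" for N b
    by (rule EE_Etr) (rule bmat_single)
  have joint: "EE N (map (\<lambda>b. [b]) bs) = (\<Prod>j<s. mom N ?ps (I j))" for N
  proof -
    interpret ensemble "M N" N "X N" s k by (rule ens)
    have tr: "btr N (Z \<omega>) [b] = TrP N (X N) (snd b) \<omega>" for b \<omega>
      unfolding TrP_def gens_gen0 by (rule btr_poly) (rule bmat_single)
    have "EE N (map (\<lambda>b. [b]) bs) = (\<integral>\<omega>. (\<Prod>b\<leftarrow>bs. btr N (Z \<omega>) [b]) \<partial>M N) / of_nat N ^ length bs"
      unfolding EE_alt by (simp add: comp_def)
    also have "\<dots> = (\<integral>\<omega>. (\<Prod>b\<leftarrow>bs. btr N (Z \<omega>) [b] / of_nat N) \<partial>M N)"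
    proof -
      have "(\<Prod>b\<leftarrow>xs. g b / c) = (\<Prod>b\<leftarrow>xs. g b) / c ^ length xs" for g :: "block \<Rightarrow> complex" and c xs
        by (induction xs) auto
      then show ?thesis by simp
    qed
    also have "\<dots> = (\<integral>\<omega>. (\<Prod>j<s. \<Prod>m\<in>I j. btr N (Z \<omega>) [bs ! m] / of_nat N) \<partial>M N)"
      unfolding lst ..
    also have "\<dots> = (\<Prod>j<s. \<integral>\<omega>. (\<Prod>m\<in>I j. btr N (Z \<omega>) [bs ! m] / of_nat N) \<partial>M N)"
    proof (rule indep_families[of "{..<s}" "\<lambda>j Y. \<Prod>m\<in>I j. btr N Y [bs ! m] / of_nat N"])
      fix j assume "j \<in> {..<s}"
      have "nice {j} (\<lambda>Y. btr N Y [bs ! m] * (1 / of_nat N))" if "m \<in> I j" for m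
        by (intro nice_mult nice_const nice_btr)
           (use that \<open>j \<in> {..<s}\<close> okI[of j m] in \<open>auto simp: okb_def I_def\<close>)
      then show "nice {j} (\<lambda>Y. \<Prod>m\<in>I j. btr N Y [bs ! m] / of_nat N)"
        by (intro nice_prod) simp
    qed simp
    finally show ?thesis unfolding mom_def tr .
  qed
  have "(\<lambda>N. of_nat N * ((\<Prod>j<s. mom N ?ps (I j)) - (\<Prod>j<s. \<Prod>m\<in>I j. mom N ?ps {m}))) \<longlonglongrightarrow> 0"
  proof (rule prod_null)
    fix j assume "j \<in> {..<s}"
    then have j: "j < s" by simp
    show "(\<lambda>N. of_nat N * (mom N ?ps (I j) - (\<Prod>m\<in>I j. mom N ?ps {m}))) \<longlonglongrightarrow> 0"
      by (rule mom_fac_family[OF j I, unfolded mom_fac_def]) (rule okI[OF j])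
    show "expandable (\<lambda>N. \<Prod>m\<in>I j. mom N ?ps {m})"
      unfolding mom_single by (rule expandable_prod[OF I expandable_Etr[OF j okI[OF j]]])
  qed simp
  then show ?thesis unfolding joint lst single mom_single .
qed

sublocale loop_system okB fst mrgb tpb cenb "\<lambda>j. j < s \<and> j \<noteq> j0" EE
proof
  fix a b :: block and c :: complex
  show "okB a \<Longrightarrow> okB b \<Longrightarrow> fst a = fst b \<Longrightarrow> okB (mrgb a b)"
    by (auto simp: okB_def mrgb_def intro: poly_in_pmul)
  show "fst a = fst b \<Longrightarrow> fst (mrgb a b) = fst a" by (simp add: mrgb_def)
  show "okB a \<Longrightarrow> okB (tpb a)"
    by (simp add: okB_def tpb_def poly_in_ptr[OF _ flipl_fam_letters])
  show "fst (tpb a) = fst a" "tpb (tpb a) = a" by (auto simp: tpb_def)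
  show "okB a \<Longrightarrow> okB (cenb a c)"
    by (auto simp: okB_def cenb_def intro!: poly_in_padd poly_in_psmult)
  show "fst (cenb a c) = fst a" by (simp add: cenb_def)
  show "okB a \<Longrightarrow> okB b \<Longrightarrow> fst a \<noteq> fst b \<Longrightarrow> (fst a < s \<and> fst a \<noteq> j0) \<or> (fst b < s \<and> fst b \<noteq> j0)"
    by (auto simp: okB_def)
next
  fix ws ws' :: "block list list" and N :: nat
  assume m: "mset ws = mset ws'"
  have "(\<Prod>w\<leftarrow>ws. f w) = (\<Prod>w\<leftarrow>ws'. f w)" for f :: "block list \<Rightarrow> complex"
    using m by (metis mset_map prod_mset_prod_list)
  moreover have "length ws = length ws'" using m by (metis size_mset)
  ultimately show "EE N ws = EE N ws'" unfolding EE_alt by simp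
next
  fix N :: nat and R :: "block list list" assume N: "N > 0"
  show "EE N ([] # R) = EE N R" unfolding EE_alt using N by (simp add: btr_nil)
  interpret ensemble "M N" N "X N" s k by (rule ens)
  show "EE N [] = 1" unfolding EE_alt by (simp add: prob_space)
  fix u v w :: "block list"
  show "EE N ((u @ v) # R) = EE N ((v @ u) # R)" by (rule EE_cong) (rule btr_rot)
  show "EE N (map tpb (rev w) # R) = EE N (w # R)" by (rule EE_cong) (rule btr_tp)
next
  fix N :: nat and a b :: block and u :: "block list" and R
  assume "okB a" "okB b"
  then have "btr N Y (mrgb a b # u) = btr N Y (a # b # u)" for Y
    using btr_merge[of "fam_letters k (fst a)" "snd a" "fam_letters k (fst b)" "snd b" N Y "fst a" u "fst b"]
    by (simp add: okB_def mrgb_def)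
  then show "EE N ((a # b # u) # R) = EE N ((mrgb a b # u) # R)" by (intro EE_cong) simp
next
  fix N :: nat and a :: block and u :: "block list" and c
  assume ok: "okB a" "\<forall>b\<in>set u. okB b"
  interpret ensemble "M N" N "X N" s k by (rule ens)
  have "btr N Y (cenb a c # u) = btr N Y (a # u) - c * btr N Y u" for Y
    using btr_centre[of "fam_letters k (fst a)" "snd a" N Y "fst a" c u] ok by (simp add: okB_def cenb_def)
  moreover have "integrable (M N) (\<lambda>\<omega>. btr N (Z \<omega>) (a # u))" "integrable (M N) (\<lambda>\<omega>. btr N (Z \<omega>) u)"
    by (rule btr_integrable; use ok in \<open>simp add: okb_okB\<close>)+
  ultimately show "EE N [cenb a c # u] = EE N [a # u] - c * EE N [u]"
    unfolding EE_alt by (simp add: diff_divide_distrib)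
next
  fix N :: nat and j :: nat and w :: "block list" and R :: "block list list"
  assume N: "N > 0" and j: "j < s \<and> j \<noteq> j0" and w: "\<forall>b\<in>set w. okB b" and R: "\<forall>v\<in>set R. \<forall>b\<in>set v. okB b"
  interpret ensemble "M N" N "X N" s k by (rule ens)
  \<comment> \<open>The common power of N: a cut leaves \<open>length R + 2\<close> traces; a
    transposed term has one fewer, hence the factor 1/N; a merged term has two fewer, hence the
    factor 1/N^2.\<close>
  define D where "D = (of_nat N :: complex) ^ (length R + 2)"
  have 1: "EE N (x # y # R) = Tr (x # y # R) / D" for x y
    by (simp add: EE_def D_def)
  have 2: "EE N (x # R) / of_nat N = Tr (x # R) / D" for x
    by (simp add: EE_def D_def)
  have 3: "EE N (x # take m R @ drop (Suc m) R) = Tr (x # take m R @ drop (Suc m) R) * (of_nat N)\<^sup>2 / D"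
    if "m \<in> {..<length R}" for x m
  proof -
    have "length (x # take m R @ drop (Suc m) R) = length R" using that by simp
    then show ?thesis unfolding EE_def D_def power_add using N by (simp only:) simp
  qed
  have s1: "(\<Sum>i<length w. of_bool (fst (w ! i) = j) *
           ((EE N (take i w # drop i w # R) - EE N ((take i w @ map tpb (rev (drop i w))) # R) / of_nat N)
          - (EE N (take (Suc i) w # drop (Suc i) w # R) - EE N ((take (Suc i) w @ map tpb (rev (drop (Suc i) w))) # R) / of_nat N)))
      = (\<Sum>i<length w. of_bool (fst (w ! i) = j) *
       ((Tr (take i w # drop i w # R) - Tr ((take i w @ map tpb (rev (drop i w))) # R))
      - (Tr (take (Suc i) w # drop (Suc i) w # R) - Tr ((take (Suc i) w @ map tpb (rev (drop (Suc i) w))) # R)))) / D"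
    unfolding 1 2 sum_divide_distrib diff_divide_distrib[symmetric] times_divide_eq_right ..
  have s2: "(\<Sum>m<length R. \<Sum>i<length (R ! m). of_bool (fst (R ! m ! i) = j) *
       ((EE N ((w @ drop i (R ! m) @ take i (R ! m)) # take m R @ drop (Suc m) R)
          - EE N ((w @ map tpb (rev (drop i (R ! m) @ take i (R ! m)))) # take m R @ drop (Suc m) R))
      - (EE N ((w @ drop (Suc i) (R ! m) @ take (Suc i) (R ! m)) # take m R @ drop (Suc m) R)
          - EE N ((w @ map tpb (rev (drop (Suc i) (R ! m) @ take (Suc i) (R ! m)))) # take m R @ drop (Suc m) R))))
      = (\<Sum>m<length R. \<Sum>i<length (R ! m). of_bool (fst (R ! m ! i) = j) *
       ((Tr ((w @ drop i (R ! m) @ take i (R ! m)) # take m R @ drop (Suc m) R)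
          - Tr ((w @ map tpb (rev (drop i (R ! m) @ take i (R ! m)))) # take m R @ drop (Suc m) R))
      - (Tr ((w @ drop (Suc i) (R ! m) @ take (Suc i) (R ! m)) # take m R @ drop (Suc m) R)
          - Tr ((w @ map tpb (rev (drop (Suc i) (R ! m) @ take (Suc i) (R ! m)))) # take m R @ drop (Suc m) R)))) * ((of_nat N)\<^sup>2 / D)"
    unfolding sum_distrib_right
    by (intro sum.cong refl) (simp only: 3 times_divide_eq_right[symmetric] left_diff_distrib[symmetric] mult.assoc)
  note loop = loop_Tr[OF conjunct1[OF j] inv[OF conjunct1[OF j] conjunct2[OF j]], of w R, unfolded okb_okB, OF w R]
  have alg: "x / D + y * ((of_nat N)\<^sup>2 / D) / (of_nat N)\<^sup>2 = 0" if "x + y = 0" for x y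
  proof -
    have "x / D + y * ((of_nat N)\<^sup>2 / D) / (of_nat N)\<^sup>2 = (x + y) / D"
      using N by (simp add: add_divide_distrib)
    then show ?thesis using that by simp
  qed
  show "(\<Sum>i<length w. of_bool (fst (w ! i) = j) *
           ((EE N (take i w # drop i w # R) - EE N ((take i w @ map tpb (rev (drop i w))) # R) / of_nat N)
          - (EE N (take (Suc i) w # drop (Suc i) w # R) - EE N ((take (Suc i) w @ map tpb (rev (drop (Suc i) w))) # R) / of_nat N)))
     + (\<Sum>m<length R. \<Sum>i<length (R ! m). of_bool (fst (R ! m ! i) = j) *
       ((EE N ((w @ drop i (R ! m) @ take i (R ! m)) # take m R @ drop (Suc m) R)
          - EE N ((w @ map tpb (rev (drop i (R ! m) @ take i (R ! m)))) # take m R @ drop (Suc m) R))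
      - (EE N ((w @ drop (Suc i) (R ! m) @ take (Suc i) (R ! m)) # take m R @ drop (Suc m) R)
          - EE N ((w @ map tpb (rev (drop (Suc i) (R ! m) @ take (Suc i) (R ! m)))) # take m R @ drop (Suc m) R)))) / (of_nat N)\<^sup>2 = 0"
    unfolding s1 s2 by (rule alg[OF loop])
next
  fix bs :: "block list" assume "\<forall>b\<in>set bs. okB b"
  then show "(\<lambda>N. of_nat N * (EE N (map (\<lambda>b. [b]) bs) - (\<Prod>b\<leftarrow>bs. EE N [[b]]))) \<longlonglongrightarrow> 0"
    by (rule EE_base)
next
  fix b :: block assume "okB b"
  then have "expandable (\<lambda>N. Etr (M N) N (X N) (snd b))"
    by (intro expandable_Etr[of "fst b"]) (auto simp: okB_def)
  then show "expandable (\<lambda>N. EE N [[b]])"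
    by (rule expandable_cong) (rule EE_Etr, rule bmat_single)
qed

section \<open>From words of blocks back to polynomials in all generators\<close>

definition lb :: "letter \<Rightarrow> block" where
  "lb l = (fst l, letter_poly l)"

lemma okB_lb: "l \<in> all_letters k s \<Longrightarrow> okB (lb l)"
  by (auto simp: all_letters_def okB_def lb_def fam_letters_def intro!: poly_in_letter_poly)

lemma okB_word:
  assumes "poly_in (all_letters k s) p" "w \<in> supp p"
  shows "\<forall>b\<in>set (map lb w). okB b"
proof -
  have "set w \<subseteq> all_letters k s" using assms by (simp add: poly_in_iff)
  then show ?thesis using okB_lb by auto
qed

lemma bmat_lb: "meq N (bmat N Y (map lb w)) (word_eval N (gen0 Y) w)"
  unfolding bmat_def word_eval_mprod map_map comp_def
  by (rule mprod_map_cong) (simp add: lb_def poly_eval_letter_poly)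

lemma fam_subset_all: "j < s \<Longrightarrow> poly_in (fam_letters k j) p \<Longrightarrow> poly_in (all_letters k s) p"
  by (rule poly_in_mono) (auto simp: all_letters_def)

lemma TrP_integrable:
  assumes "poly_in (all_letters k s) p"
  shows "integrable (M N) (\<lambda>\<omega>. TrP N (X N) p \<omega>)"
proof -
  interpret ensemble "M N" N "X N" s k by (rule ens)
  have "(\<lambda>\<omega>. \<Sum>r<N. poly_eval N (gen0 (Z \<omega>)) p r r) \<in> Lall (M N)"
    using assms by (intro Lall_sum nice_Lall[OF nice_poly_eval[of "{..<s}"]]) (auto simp: all_letters_def)
  then show ?thesis
    unfolding TrP_def gens_gen0 mTrace_def by (rule Lall_integrable)
qed

lemma Etr_words:
  assumes "poly_in (all_letters k s) p"
  shows "Etr (M N) N (X N) p = (\<Sum>w\<in>supp p. p w * EE N [map lb w])"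
proof -
  interpret ensemble "M N" N "X N" s k by (rule ens)
  have "TrP N (X N) p \<omega> = (\<Sum>w\<in>supp p. p w * btr N (Z \<omega>) (map lb w))" for \<omega>
  proof -
    have "TrP N (X N) p \<omega> = (\<Sum>w\<in>supp p. \<Sum>r<N. p w * word_eval N (gen0 (Z \<omega>)) w r r)"
      unfolding TrP_def gens_gen0 mTrace_def poly_eval_def supp_def by (rule sum.swap)
    also have "\<dots> = (\<Sum>w\<in>supp p. p w * btr N (Z \<omega>) (map lb w))"
      unfolding btr_def meq_mTrace[OF bmat_lb] by (simp add: mTrace_def sum_distrib_left)
    finally show ?thesis .
  qed
  moreover have "integrable (M N) (\<lambda>\<omega>. btr N (Z \<omega>) (map lb w))" if "w \<in> supp p" for w
    by (rule btr_integrable) (unfold okb_okB, rule okB_word[OF assms that])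
  ultimately show ?thesis
    unfolding Etr_def EE_alt by (simp add: sum_divide_distrib)
qed

definition \<tau> :: "ncpoly \<Rightarrow> complex" where
  "\<tau> p = lim (\<lambda>N. Etr (M N) N (X N) p)"

definition \<tau>' :: "ncpoly \<Rightarrow> complex" where
  "\<tau>' p = lim (\<lambda>N. of_nat N * (Etr (M N) N (X N) p - \<tau> p))"

lemma Etr_expands:
  assumes "poly_in (all_letters k s) p"
  shows "expands (\<lambda>N. Etr (M N) N (X N) p) (\<tau> p) (\<tau>' p)"
proof -
  have "expandable (\<lambda>N. \<Sum>w\<in>supp p. p w * EE N [map lb w])"
    by (intro expandable_lin_comb expandable_word okB_word[OF assms])
  then obtain a b where ab: "expands (\<lambda>N. Etr (M N) N (X N) p) a b"
    unfolding Etr_words[OF assms] expandable_def by blast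
  have "\<tau> p = a" unfolding \<tau>_def by (rule limI) (rule expands_tendsto[OF ab])
  moreover from this have "\<tau>' p = b" using ab unfolding \<tau>'_def expands_def by (simp add: limI)
  ultimately show ?thesis using ab by simp
qed

lemma \<tau>_eqI:
  assumes "poly_in (all_letters k s) p" "expands (\<lambda>N. Etr (M N) N (X N) p) a b"
  shows "\<tau> p = a" "\<tau>' p = b"
  using expands_unique[OF Etr_expands[OF assms(1)] assms(2)] by auto

text \<open>A word of blocks and a polynomial with the same matrix evaluation have the same expected
  trace for each N, and the coefficients of an expansion are unique.\<close>

lemma t_\<tau>:
  assumes "\<forall>b\<in>set w. okB b" "poly_in (all_letters k s) p"
    "\<And>N Y. meq N (bmat N Y w) (poly_eval N (gen0 Y) p)"
  shows "t w = \<tau> p" "t' w = \<tau>' p"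
  using \<tau>_eqI[OF assms(2), of "t w" "t' w"] t_expands[OF assms(1)] EE_Etr[OF assms(3)] by auto

lemma real_inf_prob_space: "real_inf_prob_space (poly_in (all_letters k s)) \<tau> \<tau>'"
proof -
  let ?A = "poly_in (all_letters k s)"
  have add: "\<tau> (padd p q) = \<tau> p + \<tau> q \<and> \<tau>' (padd p q) = \<tau>' p + \<tau>' q" if "?A p" "?A q" for p q
  proof -
    have "Etr (M N) N (X N) (padd p q) = Etr (M N) N (X N) p + Etr (M N) N (X N) q" for N
    proof -
      have "TrP N (X N) (padd p q) \<omega> = TrP N (X N) p \<omega> + TrP N (X N) q \<omega>" for \<omega>
        by (simp add: TrP_def mTrace_def poly_eval_padd[OF that] sum.distrib)
      then show ?thesis
        unfolding Etr_def by (simp add: TrP_integrable[OF that(1)] TrP_integrable[OF that(2)] add_divide_distrib)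
    qed
    then have "expands (\<lambda>N. Etr (M N) N (X N) (padd p q)) (\<tau> p + \<tau> q) (\<tau>' p + \<tau>' q)"
      using expands_add[OF Etr_expands[OF that(1)] Etr_expands[OF that(2)]] by simp
    then show ?thesis using \<tau>_eqI[OF poly_in_padd[OF that]] by blast
  qed
  have smult: "\<tau> (psmult c p) = c * \<tau> p \<and> \<tau>' (psmult c p) = c * \<tau>' p" if "?A p" for c p
  proof -
    have "Etr (M N) N (X N) (psmult c p) = c * Etr (M N) N (X N) p" for N
      unfolding Etr_def
      by (simp add: TrP_def mTrace_def poly_eval_psmult[OF that] sum_distrib_left[symmetric])
    then have "expands (\<lambda>N. Etr (M N) N (X N) (psmult c p)) (c * \<tau> p) (c * \<tau>' p)"
      using expands_cmult[OF Etr_expands[OF that]] by simp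
    then show ?thesis using \<tau>_eqI[OF poly_in_psmult[OF that]] by blast
  qed
  have one: "\<tau> pone = 1 \<and> \<tau>' pone = 0"
    using t_\<tau>[of "[]" pone] by (simp add: bmat_def poly_eval_pone)
  have tr: "\<tau> (ptr p) = \<tau> p" if "?A p" for p
  proof -
    have "TrP N (X N) (ptr p) \<omega> = TrP N (X N) p \<omega>" for N \<omega>
      unfolding TrP_def gens_gen0 using meq_mTrace[OF poly_eval_ptr[of "gen0 (\<lambda>j i. X N j i \<omega>)", OF gen0_flipl]] by simp
    then have "Etr (M N) N (X N) (ptr p) = Etr (M N) N (X N) p" for N by (simp add: Etr_def)
    then show ?thesis by (simp add: \<tau>_def)
  qed
  show ?thesis
    unfolding real_inf_prob_space_def
    using add smult one tr poly_in_padd poly_in_pmul poly_in_psmult poly_in_ptr[OF _ flipl_all_letters]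
    by (auto simp: ptr_pmul ptr_padd ptr_psmult)
qed

lemma bmat_pprod:
  assumes "\<And>m. lo \<le> m \<Longrightarrow> m < hi \<Longrightarrow> poly_in (all_letters k s) (a m)"
  shows "meq N (bmat N Y (map (\<lambda>m. (js m, a m)) [lo..<hi])) (poly_eval N (gen0 Y) (pprod a lo hi)) \<and>
     poly_in (all_letters k s) (pprod a lo hi)"
proof -
  have "meq N (bmat N Y (map (\<lambda>m. (js m, a m)) ms)) (poly_eval N (gen0 Y) (foldr (\<lambda>m acc. pmul (a m) acc) ms pone)) \<and>
     poly_in (all_letters k s) (foldr (\<lambda>m acc. pmul (a m) acc) ms pone)"
    if "\<forall>m\<in>set ms. poly_in (all_letters k s) (a m)" for ms
    using that
  proof (induction ms)
    case (Cons m ms)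
    let ?q = "foldr (\<lambda>m acc. pmul (a m) acc) ms pone"
    have q: "poly_in (all_letters k s) ?q" "meq N (bmat N Y (map (\<lambda>m. (js m, a m)) ms)) (poly_eval N (gen0 Y) ?q)"
      and m: "poly_in (all_letters k s) (a m)" using Cons by auto
    have "meq N (bmat N Y (map (\<lambda>m. (js m, a m)) (m # ms))) (matmul N (poly_eval N (gen0 Y) (a m)) (poly_eval N (gen0 Y) ?q))"
      using meq_matmul[OF meq_refl q(2)] by (simp add: bmat_def)
    also have "meq N \<dots> (poly_eval N (gen0 Y) (pmul (a m) ?q))"
      by (rule meq_sym[OF poly_eval_pmul[OF m q(1)]])
    finally show ?case using poly_in_pmul[OF m q(1)] by simp
  qed (simp add: bmat_def poly_eval_pone)
  from this[of "[lo..<hi]"] show ?thesis using assms by (simp add: pprod_def)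
qed

lemma t_pprod:
  assumes "\<And>m. lo \<le> m \<Longrightarrow> m < hi \<Longrightarrow> okB (js m, a m)"
  shows "t (map (\<lambda>m. (js m, a m)) [lo..<hi]) = \<tau> (pprod a lo hi)"
    "t' (map (\<lambda>m. (js m, a m)) [lo..<hi]) = \<tau>' (pprod a lo hi)"
proof -
  have "poly_in (all_letters k s) (a m)" if "lo \<le> m" "m < hi" for m
    using assms[OF that] fam_subset_all by (auto simp: okB_def)
  note * = bmat_pprod[OF this]
  show "t (map (\<lambda>m. (js m, a m)) [lo..<hi]) = \<tau> (pprod a lo hi)"
    "t' (map (\<lambda>m. (js m, a m)) [lo..<hi]) = \<tau>' (pprod a lo hi)"
    by (rule t_\<tau>; use assms * in auto)+
qed

lemma okB_all: "okB b \<Longrightarrow> poly_in (all_letters k s) (snd b)"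
  using fam_subset_all by (auto simp: okB_def)

lemma t_single: "okB b \<Longrightarrow> t [b] = \<tau> (snd b)"
  by (rule t_\<tau>(1)) (auto simp: okB_all bmat_single)

lemma t_pair:
  assumes "okB b" "okB c"
  shows "t [b, c] = \<tau> (pmul (snd b) (snd c))"
proof (rule t_\<tau>(1))
  fix N Y
  have "meq N (bmat N Y [b, c]) (matmul N (poly_eval N (gen0 Y) (snd b)) (poly_eval N (gen0 Y) (snd c)))"
    using meq_matmul[OF meq_refl bmat_single] by (simp add: bmat_def)
  also have "meq N \<dots> (poly_eval N (gen0 Y) (pmul (snd b) (snd c)))"
    by (rule meq_sym[OF poly_eval_pmul[OF okB_all[OF assms(1)] okB_all[OF assms(2)]]])
  finally show "meq N (bmat N Y [b, c]) (poly_eval N (gen0 Y) (pmul (snd b) (snd c)))" .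
qed (use assms okB_all poly_in_pmul in auto)

lemma t_triple:
  assumes "okB b" "okB c" "okB d"
  shows "t [b, c, d] = \<tau> (pmul (snd b) (pmul (snd c) (snd d)))"
proof (rule t_\<tau>(1))
  fix N Y
  have *: "meq N (bmat N Y [c, d]) (matmul N (poly_eval N (gen0 Y) (snd c)) (poly_eval N (gen0 Y) (snd d)))"
    using meq_matmul[OF meq_refl bmat_single] by (simp add: bmat_def)
  have "meq N (bmat N Y [c, d]) (poly_eval N (gen0 Y) (pmul (snd c) (snd d)))"
    using meq_trans[OF * meq_sym[OF poly_eval_pmul[OF okB_all[OF assms(2)] okB_all[OF assms(3)]]]] .
  then have "meq N (bmat N Y [b, c, d]) (matmul N (poly_eval N (gen0 Y) (snd b)) (poly_eval N (gen0 Y) (pmul (snd c) (snd d))))"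
    using meq_matmul[OF meq_refl] by (simp add: bmat_def)
  also have "meq N \<dots> (poly_eval N (gen0 Y) (pmul (snd b) (pmul (snd c) (snd d))))"
    by (rule meq_sym[OF poly_eval_pmul[OF okB_all[OF assms(1)] poly_in_pmul[OF okB_all[OF assms(2)] okB_all[OF assms(3)]]]])
  finally show "meq N (bmat N Y [b, c, d]) (poly_eval N (gen0 Y) (pmul (snd b) (pmul (snd c) (snd d))))" .
qed (use assms okB_all poly_in_pmul in auto)

text \<open>The elements a_i become centred blocks tagged with their subalgebra, so the conditions
  translate into the vanishing theorem and the even and odd formulas for alternating words.\<close>

lemma real_inf_free: "real_inf_free \<tau> \<tau>' (\<lambda>j. poly_in (fam_letters k j)) s"
  unfolding real_inf_free_def
proof (intro allI impI)
  fix n :: nat and a :: "nat \<Rightarrow> ncpoly" and js :: "nat \<Rightarrow> nat"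
  assume asm: "n \<ge> 1 \<and> (\<forall>m<n. js m < s \<and> poly_in (fam_letters k (js m)) (a m) \<and> \<tau> (a m) = 0)
        \<and> (\<forall>m. Suc m < n \<longrightarrow> js m \<noteq> js (Suc m))"
  define b where "b m = (js m, a m)" for m
  define w where "w = map b [0..<n]"
  have len: "length w = n" and nth: "\<And>m. m < n \<Longrightarrow> w ! m = b m" by (auto simp: w_def)
  have ok: "okB (b m)" "okB (tpb (b m))" if "m < n" for m
    using asm that ok_tp[of "b m"] by (auto simp: okB_def b_def)
  have ne: "w \<noteq> []" using asm by (auto simp: w_def)
  have cent: "centred w"
    using ok asm by (auto simp: centred_def w_def t_single) (simp add: b_def)
  have alt: "alt w"
    unfolding successively_conv_nth len using asm by (auto simp: nth b_def)
  have hd: "hd w = b 0" and last: "last w = b (n - 1)"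
    using ne len nth by (auto simp: hd_conv_nth last_conv_nth)
  have mid: "butlast (tl w) = map b [1..<n - 1]"
  proof -
    obtain n' where n': "n = Suc n'" using asm by (cases n) auto
    have "tl [0..<n] = [1..<Suc n']" unfolding n' by (simp add: tl_upt)
    then have "butlast (tl [0..<n]) = [1..<n - 1]" unfolding n' by (cases n') auto
    then show ?thesis unfolding w_def map_tl[symmetric] map_butlast[symmetric] by simp
  qed
  have tw: "t w = \<tau> (pprod a 0 n)" "t' w = \<tau>' (pprod a 0 n)"
    unfolding w_def b_def by (rule t_pprod; use ok in \<open>simp add: b_def\<close>)+
  have tm: "t' (butlast (tl w)) = \<tau>' (pprod a 1 (n - 1))"
    unfolding mid b_def by (rule t_pprod) (use ok in \<open>simp add: b_def\<close>)
  have pair: "t [b i, b m] = \<tau> (pmul (a i) (a m))" if "i < n" "m < n" for i m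
    using t_pair[OF ok(1)[OF that(1)] ok(1)[OF that(2)]] by (simp add: b_def)
  have pairt: "t [b i, tpb (b m)] = \<tau> (pmul (a i) (ptr (a m)))" if "i < n" "m < n" for i m
    using t_pair[OF ok(1)[OF that(1)] ok(2)[OF that(2)]] by (simp add: b_def tpb_def)
  show "\<tau> (pprod a 0 n) = 0 \<and>
      (n = 2 \<longrightarrow> \<tau>' (pprod a 0 n) = 0) \<and>
      (\<forall>k. k \<ge> 2 \<and> n = 2 * k - 1 \<longrightarrow>
         \<tau>' (pprod a 0 n) =
           \<tau> (pmul (a 0) (a (n - 1))) * \<tau>' (pprod a 1 (n - 1))
           + \<tau> (pmul (a 0) (pmul (ptr (a (k - 1))) (a (n - 1))))
             * (\<Prod>l\<in>{1..k - 2}. \<tau> (pmul (a l) (ptr (a (k - 1 + l)))))) \<and>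
      (\<forall>k. k \<ge> 2 \<and> n = 2 * k \<longrightarrow>
         \<tau>' (pprod a 0 n) =
           \<tau> (pmul (a 0) (a (n - 1))) * \<tau>' (pprod a 1 (n - 1))
           + (\<Prod>l<k. \<tau> (pmul (a l) (ptr (a (k + l))))))"
  proof (intro conjI allI impI)
    show "\<tau> (pprod a 0 n) = 0" using alt_zero[OF ne alt cent] tw by simp
  next
    assume n: "n = 2"
    then have "w = [b 0, b 1]" by (simp add: w_def upt_rec)
    then show "\<tau>' (pprod a 0 n) = 0" using t'_pair_zero[of "b 0" "b 1"] alt cent tw by simp
  next
    \<comment> \<open>\<open>l\<close> plays the part of the half length in the definition of
      freeness; here \<open>k\<close> already denotes the numbers of generators. The middle block
      sits at \<open>l - 1\<close> since positions start at 0.\<close>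
    fix l assume l: "l \<ge> 2 \<and> n = 2 * l - 1"
    have i: "0 < n" "n - 1 < n" "l - 1 < n" using l by auto
    have "t [b 0, tpb (b (l - 1)), b (n - 1)] = \<tau> (pmul (a 0) (pmul (ptr (a (l - 1))) (a (n - 1))))"
      using t_triple[OF ok(1)[OF i(1)] ok(2)[OF i(3)] ok(1)[OF i(2)]] by (simp add: b_def tpb_def)
    moreover have "(\<Prod>i\<in>{1..l - 2}. t [w ! i, tpb (w ! (l - 1 + i))]) =
        (\<Prod>i\<in>{1..l - 2}. \<tau> (pmul (a i) (ptr (a (l - 1 + i)))))"
      by (rule prod.cong) (use l in \<open>auto simp: nth pairt\<close>)
    ultimately show "\<tau>' (pprod a 0 n) =
           \<tau> (pmul (a 0) (a (n - 1))) * \<tau>' (pprod a 1 (n - 1))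
           + \<tau> (pmul (a 0) (pmul (ptr (a (l - 1))) (a (n - 1))))
             * (\<Prod>i\<in>{1..l - 2}. \<tau> (pmul (a i) (ptr (a (l - 1 + i)))))"
      using t'_odd[OF alt cent, of l] l len
      unfolding hd last tm tw pair[OF i(1,2)] nth[OF i(3)] by simp
  next
    fix l assume l: "l \<ge> 2 \<and> n = 2 * l"
    have i: "0 < n" "n - 1 < n" using l by auto
    have "(\<Prod>i<l. t [w ! i, tpb (w ! (l + i))]) = (\<Prod>i<l. \<tau> (pmul (a i) (ptr (a (l + i)))))"
      by (rule prod.cong) (use l in \<open>auto simp: nth pairt\<close>)
    then show "\<tau>' (pprod a 0 n) =
           \<tau> (pmul (a 0) (a (n - 1))) * \<tau>' (pprod a 1 (n - 1))
           + (\<Prod>i<l. \<tau> (pmul (a i) (ptr (a (l + i)))))"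
      using t'_even[OF alt cent, of l] l len
      unfolding hd last tm tw pair[OF i] by simp
  qed
qed

end

theorem theorem5p7:
  fixes M :: "nat \<Rightarrow> 'a measure"
    and X :: "nat \<Rightarrow> nat \<Rightarrow> nat \<Rightarrow> 'a \<Rightarrow> cmat"
    and s :: nat and k :: "nat \<Rightarrow> nat"
  assumes prob: "\<And>N. prob_space (M N)"
    and meas: "\<And>N j i r c. j < s \<Longrightarrow> i < k j \<Longrightarrow> r < N \<Longrightarrow> c < N \<Longrightarrow>
                 (\<lambda>\<omega>. X N j i \<omega> r c) \<in> borel_measurable (M N)"
    and moments: "\<And>N j i r c q. j < s \<Longrightarrow> i < k j \<Longrightarrow> r < N \<Longrightarrow> c < N \<Longrightarrow>
                 integrable (M N) (\<lambda>\<omega>. norm (X N j i \<omega> r c) ^ q)"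
    and indep: "\<And>N. prob_space.indep_sets (M N) (\<lambda>j. entry_sigma (M N) N (k j) (X N j)) {..<s}"
    and inv: "\<exists>j0. \<forall>j<s. j \<noteq> j0 \<longrightarrow> (\<forall>N. orth_invariant (M N) N (k j) (X N j))"
    and P1: "\<And>j. j < s \<Longrightarrow> \<exists>\<tau> \<tau>' :: ncpoly \<Rightarrow> complex. \<forall>p. poly_in (fam_letters k j) p \<longrightarrow>
                 (\<lambda>N. of_nat N * (Etr (M N) N (X N) p - \<tau> p) - \<tau>' p) \<longlonglongrightarrow> 0"
    and P2: "\<And>j p1 p2. j < s \<Longrightarrow> poly_in (fam_letters k j) p1 \<Longrightarrow> poly_in (fam_letters k j) p2 \<Longrightarrow>
                 convergent (\<lambda>N. cumulant (M N) (\<lambda>m. TrP N (X N) ([p1, p2] ! m)) 2)"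
    and P3: "\<And>j r ps. j < s \<Longrightarrow> r \<ge> 3 \<Longrightarrow> (\<forall>m<r. poly_in (fam_letters k j) (ps m)) \<Longrightarrow>
                 (\<lambda>N. of_nat N ^ (r - 3) * cumulant (M N) (\<lambda>m. TrP N (X N) (ps m)) r) \<longlonglongrightarrow> 0"
  shows "\<exists>\<tau> \<tau>' :: ncpoly \<Rightarrow> complex.
           (\<forall>p. poly_in (all_letters k s) p \<longrightarrow>
              (\<lambda>N. Etr (M N) N (X N) p) \<longlonglongrightarrow> \<tau> p \<and>
              (\<lambda>N. of_nat N * (Etr (M N) N (X N) p - \<tau> p)) \<longlonglongrightarrow> \<tau>' p) \<and>
           real_inf_prob_space (poly_in (all_letters k s)) \<tau> \<tau>' \<and>
           real_inf_free \<tau> \<tau>' (\<lambda>j. poly_in (fam_letters k j)) s"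
proof -
  from inv obtain j0 where j0: "\<And>j N. j < s \<Longrightarrow> j \<noteq> j0 \<Longrightarrow> orth_invariant (M N) N (k j) (X N j)" by blast
  interpret ensemble_seq M X s k j0
  proof (rule ensemble_seq.intro)
    show "ensemble (M N) N (X N) s k" for N
      unfolding ensemble_def ensemble_axioms_def using prob meas moments indep by blast
  qed (rule j0 P1 P2 P3; assumption)+
  show ?thesis
  proof (rule exI[of _ \<tau>], rule exI[of _ \<tau>'], intro conjI allI impI)
    fix p assume "poly_in (all_letters k s) p"
    from Etr_expands[OF this] show "(\<lambda>N. Etr (M N) N (X N) p) \<longlonglongrightarrow> \<tau> p"
      "(\<lambda>N. of_nat N * (Etr (M N) N (X N) p - \<tau> p)) \<longlonglongrightarrow> \<tau>' p"
      using expands_tendsto unfolding expands_def by auto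
  qed (rule real_inf_prob_space real_inf_free)+
qed

end
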